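(* Let $G$ be a finite group and let $\{U_g\}_{g\in G}$ be a unitary projective representation of $G$ on a nonzero finite-dimensional complex Hilbert space $H$, with all prior probabilities equal to $1/|G|$. Let $$\kappa:=\sum_\sigma\frac{\min(m_\sigma,d_\sigma)\,d_\sigma}{|G|},$$ where $\sigma$ runs over the (equivalence classes of) irreducible unitary projective representations of $G$ with the same factor set as $\{U_g\}$, $d_\sigma$ is the dimension of $\sigma$, and $m_\sigma$ is the multiplicity of $\sigma$ in the decomposition of $\{U_g\}$ into irreducibles. Put $m_c:=1-\kappa$. Then for every error margin $m\in[0,1]$, the maximum success probability of discriminating the processes $\{U_g\}_{g\in G}$ is $$P_{\max}(m)=P^{\mathrm{pure}}_{\max}(m)=\begin{cases}\kappa & \text{if } m_c\le m\le1,\\[1mm] \dfrac{\kappa}{1-\kappa}\,m&\text{if } 0\le m<m_c.\end{cases}$$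
   Context: A unitary projective representation of a finite group $G$ on $H$ is a family of unitary operators $\{U_g\}_{g\in G}$ on $H$ with $U_gU_h=c_{g,h}U_{gh}$ for all $g,h\in G$, where the $c_{g,h}$ are complex numbers with $|c_{g,h}|=1$; $\{c_{g,h}\}$ is called the factor set. For a fixed factor set, equivalence, irreducibility and decomposition into irreducibles (with multiplicities) are defined as for ordinary representations. Discrimination with error margin and equal priors: a strategy consists of a density operator $\rho$ on $H$ (input state) and a POVM $\{E_0\}\cup\{E_g\}_{g\in G}$ on $H$ (positive semidefinite operators with $E_0+\sum_{g\in G}E_g=1$; outcome $g$ means "guess $U_g$", and $E_0$ gives the inconclusive result). The success and mean error probabilities are $$P_\circ=\frac1{|G|}\sum_{g\in G}\mathrm{tr}(E_gU_g\rho U_g^\dagger),\qquad P_\times=\frac1{|G|}\sum_{g\ne h}\mathrm{tr}(E_gU_h\rho U_h^\dagger).$$ For $m\in[0,1]$, $P_{\max}(m)$ is the maximum of $P_\circ$ over all strategies with $P_\times\le m$; $P^{\mathrm{pure}}_{\max}(m)$ is the same maximum with $\rho$ restricted to pure states $|\phi\rangle\langle\phi|$, $\|\phi\|=1$. *)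

theory Defs
  imports "Jordan_Normal_Form.Schur_Decomposition"
begin

text \<open>The Hilbert space of dimension \<open>n\<close> is \<open>carrier_vec n\<close> over the complex numbers with inner
  product \<open>\<bullet>c\<close>; operators on it are the matrices in \<open>carrier_mat n n\<close>.\<close>

definition unitary_mat :: "nat \<Rightarrow> complex mat \<Rightarrow> bool" where
  "unitary_mat n A \<longleftrightarrow>
     A \<in> carrier_mat n n \<and> A * mat_adjoint A = 1\<^sub>m n \<and> mat_adjoint A * A = 1\<^sub>m n"

text \<open>The order on \<open>complex\<close> is the one of \<open>HOL-Library.Complex_Order\<close>: \<open>0 \<le> z\<close> says that \<open>z\<close>
  is real and nonnegative.\<close>

definition psd_mat :: "nat \<Rightarrow> complex mat \<Rightarrow> bool" where
  "psd_mat n A \<longleftrightarrow> A \<in> carrier_mat n n \<and> (\<forall>v\<in>carrier_vec n. 0 \<le> (A *\<^sub>v v) \<bullet>c v)"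

definition mat_trace :: "complex mat \<Rightarrow> complex" where
  "mat_trace A = (\<Sum>i<dim_row A. A $$ (i, i))"


section \<open>Unitary projective representations\<close>

type_synonym 'g rep = "nat \<times> ('g \<Rightarrow> complex mat)"

definition unitary_proj_rep ::
    "('g, 'b) monoid_scheme \<Rightarrow> ('g \<Rightarrow> 'g \<Rightarrow> complex) \<Rightarrow> nat \<Rightarrow> ('g \<Rightarrow> complex mat) \<Rightarrow> bool" where
  "unitary_proj_rep G c n U \<longleftrightarrow>
     (\<forall>g\<in>carrier G. unitary_mat n (U g)) \<and>
     (\<forall>g\<in>carrier G. \<forall>h\<in>carrier G.
        cmod (c g h) = 1 \<and> U g * U h = c g h \<cdot>\<^sub>m U (g \<otimes>\<^bsub>G\<^esub> h))"

definition invariant_subspace ::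
    "('g, 'b) monoid_scheme \<Rightarrow> nat \<Rightarrow> ('g \<Rightarrow> complex mat) \<Rightarrow> complex vec set \<Rightarrow> bool" where
  "invariant_subspace G n U W \<longleftrightarrow>
     VectorSpace.subspace class_ring W (module_vec TYPE(complex) n) \<and>
     (\<forall>g\<in>carrier G. \<forall>w\<in>W. U g *\<^sub>v w \<in> W)"

definition irreducible_proj_rep ::
    "('g, 'b) monoid_scheme \<Rightarrow> ('g \<Rightarrow> 'g \<Rightarrow> complex) \<Rightarrow> nat \<Rightarrow> ('g \<Rightarrow> complex mat) \<Rightarrow> bool" where
  "irreducible_proj_rep G c n U \<longleftrightarrow>
     unitary_proj_rep G c n U \<and> 0 < n \<and>
     (\<forall>W. invariant_subspace G n U W \<longrightarrow> W = {0\<^sub>v n} \<or> W = carrier_vec n)"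

fun rep_equiv :: "('g, 'b) monoid_scheme \<Rightarrow> 'g rep \<Rightarrow> 'g rep \<Rightarrow> bool" where
  "rep_equiv G (n, U) (k, V) \<longleftrightarrow>
     n = k \<and> (\<exists>T. unitary_mat n T \<and> (\<forall>g\<in>carrier G. T * U g = V g * T))"

definition irreps :: "('g, 'b) monoid_scheme \<Rightarrow> ('g \<Rightarrow> 'g \<Rightarrow> complex) \<Rightarrow> 'g rep set" where
  "irreps G c = {(d, \<sigma>). irreducible_proj_rep G c d \<sigma>}"

definition irrep_equiv_rel ::
    "('g, 'b) monoid_scheme \<Rightarrow> ('g \<Rightarrow> 'g \<Rightarrow> complex) \<Rightarrow> ('g rep \<times> 'g rep) set" where
  "irrep_equiv_rel G c = {(r, s). r \<in> irreps G c \<and> s \<in> irreps G c \<and> rep_equiv G r s}"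

definition irrep_classes ::
    "('g, 'b) monoid_scheme \<Rightarrow> ('g \<Rightarrow> 'g \<Rightarrow> complex) \<Rightarrow> 'g rep set set" where
  "irrep_classes G c = irreps G c // irrep_equiv_rel G c"

definition direct_sum :: "'g rep list \<Rightarrow> 'g rep" where
  "direct_sum rs = (sum_list (map fst rs), \<lambda>g. diag_block_mat (map (\<lambda>r. snd r g) rs))"

definition decomposition ::
    "('g, 'b) monoid_scheme \<Rightarrow> ('g \<Rightarrow> 'g \<Rightarrow> complex) \<Rightarrow> 'g rep \<Rightarrow> 'g rep list \<Rightarrow> bool" where
  "decomposition G c r rs \<longleftrightarrow> set rs \<subseteq> irreps G c \<and> rep_equiv G r (direct_sum rs)"

text \<open>For finite \<open>G\<close> a decomposition exists, and the number of its constituents in a given class does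
  not depend on the decomposition chosen.\<close>

definition multiplicity_of ::
    "('g, 'b) monoid_scheme \<Rightarrow> ('g \<Rightarrow> 'g \<Rightarrow> complex) \<Rightarrow> 'g rep \<Rightarrow> 'g rep set \<Rightarrow> nat" where
  "multiplicity_of G c r C = length (filter (\<lambda>s. s \<in> C) (SOME rs. decomposition G c r rs))"

definition class_dim :: "'g rep set \<Rightarrow> nat" where
  "class_dim C = the_elem (fst ` C)"

definition kappa ::
    "('g, 'b) monoid_scheme \<Rightarrow> ('g \<Rightarrow> 'g \<Rightarrow> complex) \<Rightarrow> nat \<Rightarrow> ('g \<Rightarrow> complex mat) \<Rightarrow> real" where
  "kappa G c n U =
     (\<Sum>C\<in>irrep_classes G c.
        real (min (multiplicity_of G c (n, U) C) (class_dim C) * class_dim C) / real (card (carrier G)))"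


section \<open>Discrimination with an error margin\<close>

definition density_operators :: "nat \<Rightarrow> complex mat set" where
  "density_operators n = {\<rho>. psd_mat n \<rho> \<and> mat_trace \<rho> = 1}"

definition ket_bra :: "complex vec \<Rightarrow> complex mat" where
  "ket_bra \<phi> = mat (dim_vec \<phi>) (dim_vec \<phi>) (\<lambda>(i, j). \<phi> $ i * cnj (\<phi> $ j))"

definition pure_states :: "nat \<Rightarrow> complex mat set" where
  "pure_states n = {ket_bra \<phi> | \<phi>. \<phi> \<in> carrier_vec n \<and> \<phi> \<bullet>c \<phi> = 1}"

definition povm ::
    "('g, 'b) monoid_scheme \<Rightarrow> nat \<Rightarrow> complex mat \<Rightarrow> ('g \<Rightarrow> complex mat) \<Rightarrow> bool" where
  "povm G n E0 E \<longleftrightarrow>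
     psd_mat n E0 \<and> (\<forall>g\<in>carrier G. psd_mat n (E g)) \<and>
     E0 + finsum (module_mat TYPE(complex) n n) E (carrier G) = 1\<^sub>m n"

text \<open>The traces below are real for a density operator and a POVM, so \<open>Re\<close> only changes the type.\<close>

definition outcome_prob ::
    "('g \<Rightarrow> complex mat) \<Rightarrow> complex mat \<Rightarrow> ('g \<Rightarrow> complex mat) \<Rightarrow> 'g \<Rightarrow> 'g \<Rightarrow> real" where
  "outcome_prob U \<rho> E g h = Re (mat_trace (E g * (U h * \<rho> * mat_adjoint (U h))))"

definition success_prob ::
    "('g, 'b) monoid_scheme \<Rightarrow> ('g \<Rightarrow> complex mat) \<Rightarrow> complex mat \<Rightarrow> ('g \<Rightarrow> complex mat) \<Rightarrow> real" where
  "success_prob G U \<rho> E = 1 / real (card (carrier G)) * (\<Sum>g\<in>carrier G. outcome_prob U \<rho> E g g)"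

definition error_prob ::
    "('g, 'b) monoid_scheme \<Rightarrow> ('g \<Rightarrow> complex mat) \<Rightarrow> complex mat \<Rightarrow> ('g \<Rightarrow> complex mat) \<Rightarrow> real" where
  "error_prob G U \<rho> E = 1 / real (card (carrier G)) *
     (\<Sum>g\<in>carrier G. \<Sum>h\<in>carrier G - {g}. outcome_prob U \<rho> E g h)"

definition success_values ::
    "('g, 'b) monoid_scheme \<Rightarrow> nat \<Rightarrow> ('g \<Rightarrow> complex mat) \<Rightarrow> complex mat set \<Rightarrow> real \<Rightarrow> real set" where
  "success_values G n U R m =
     {success_prob G U \<rho> E | \<rho> E0 E. \<rho> \<in> R \<and> povm G n E0 E \<and> error_prob G U \<rho> E \<le> m}"

definition is_maximum :: "real set \<Rightarrow> real \<Rightarrow> bool" where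
  "is_maximum S v \<longleftrightarrow> v \<in> S \<and> (\<forall>x\<in>S. x \<le> v)"

definition is_P_max ::
    "('g, 'b) monoid_scheme \<Rightarrow> nat \<Rightarrow> ('g \<Rightarrow> complex mat) \<Rightarrow> real \<Rightarrow> real \<Rightarrow> bool" where
  "is_P_max G n U m v \<longleftrightarrow> is_maximum (success_values G n U (density_operators n) m) v"

definition is_P_max_pure ::
    "('g, 'b) monoid_scheme \<Rightarrow> nat \<Rightarrow> ('g \<Rightarrow> complex mat) \<Rightarrow> real \<Rightarrow> real \<Rightarrow> bool" where
  "is_P_max_pure G n U m v \<longleftrightarrow> is_maximum (success_values G n U (pure_states n) m) v"

end

theory Submission
  imports Defs "Jordan_Normal_Form.Spectral_Radius" "HOL-Analysis.Convex"
begin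

text \<open>Let \<open>q\<close> be the sum of the success and error probabilities of a strategy. Everything follows from
  \<open>P\<^sub>\<circ> \<le> \<kappa> q\<close> and a pure strategy with \<open>P\<^sub>\<circ> = \<kappa>\<close>: below \<open>m\<^sub>c\<close> that strategy is mixed with the
  inconclusive outcome.

  Both \<open>\<rho>\<close> and \<open>E\<^sub>g\<close> are sums of rank-one operators, so the bound reduces to
  \<open>|\<langle>v, \<phi>\<rangle>|\<^sup>2 \<le> \<kappa> \<Sum>\<^sub>g |\<langle>v, U\<^sub>g \<phi>\<rangle>|\<^sup>2\<close>. In a basis adapted to the decomposition into irreducibles, \<open>v\<close>
  and \<open>\<phi>\<close> define for each class \<open>\<sigma>\<close> a matrix \<open>M\<^sub>\<sigma>\<close> of size \<open>d\<^sub>\<sigma>\<close> and rank at most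
  \<open>min m\<^sub>\<sigma> d\<^sub>\<sigma>\<close> with \<open>\<langle>v, \<phi>\<rangle> = \<Sum>\<^sub>\<sigma> tr M\<^sub>\<sigma>\<close>, and the orthogonality relations turn the right-hand sum into
  \<open>\<Sum>\<^sub>\<sigma> (|G| / d\<^sub>\<sigma>) \<parallel>M\<^sub>\<sigma>\<parallel>\<^sup>2\<close> (Frobenius norm). Now combine \<open>|tr M|\<^sup>2 \<le> rank M \<parallel>M\<parallel>\<^sup>2\<close> with the
  Cauchy-Schwarz inequality over \<open>\<sigma>\<close>.

  Uniqueness of multiplicities is never needed: the argument works for whichever decomposition
  defines \<open>\<kappa>\<close>.\<close>

text \<open>With P the success probability, P <= kappa q gives both branches: q <= 1 yields P <=
  kappa, and q <= P + m yields P (1 - kappa) <= kappa m. The constant arises from weighting the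
  Cauchy-Schwarz inequality by min(m_s, d_s) d_s / |G|, whose sum over the classes s is kappa. The
  bound is attained by a vector that generates a cyclic subspace of dimension r = kappa |G|: its
  orbit is a tight frame there with constant |G| / r, so the rescaled orbit projectors sum to the
  projection onto that subspace, and each guess is right with probability r / |G|.

  Two features of the definitions shape the rest. \<open>kappa\<close> sums over all equivalence
  classes, and a sum over an infinite set is 0 by convention, so finiteness of
  \<open>irrep_classes\<close> has to be proved. Constituents of the chosen decomposition that lie
  in one class are merely equivalent, whereas the orthogonality relations compare matrix entries;
  each constituent is therefore replaced by a fixed representative, after which copies of a class
  carry literally the same matrices.\<close>

lemma mat_adjoint_carrier [simp]:
  "A \<in> carrier_mat n k \<Longrightarrow> mat_adjoint A \<in> carrier_mat k n"
  unfolding mat_adjoint_def by auto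

lemma dim_mat_adjoint [simp]:
  "dim_row (mat_adjoint A) = dim_col A" "dim_col (mat_adjoint A) = dim_row A"
  unfolding mat_adjoint_def by auto

lemma index_mat_adjoint [simp]:
  fixes A :: "complex mat"
  assumes "i < dim_col A" "j < dim_row A"
  shows "mat_adjoint A $$ (i, j) = cnj (A $$ (j, i))"
  using assms unfolding mat_adjoint_def by (simp add: mat_of_rows_index)

lemma mat_adjoint_adjoint [simp]: "mat_adjoint (mat_adjoint A) = (A :: complex mat)"
  by (rule eq_matI) auto

lemma index_mult_sum:
  assumes "A \<in> carrier_mat n k" "B \<in> carrier_mat k l" "i < n" "j < l"
  shows "(A * B) $$ (i, j) = (\<Sum>x<k. A $$ (i, x) * B $$ (x, j))"
  using assms by (auto simp: scalar_prod_def atLeast0LessThan intro!: sum.cong)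

lemma index_mult_vec_sum:
  assumes "A \<in> carrier_mat n k" "v \<in> carrier_vec k" "i < n"
  shows "(A *\<^sub>v v) $ i = (\<Sum>x<k. A $$ (i, x) * v $ x)"
  using assms by (auto simp: scalar_prod_def atLeast0LessThan intro!: sum.cong)

lemma cscalar_prod_sum:
  fixes v w :: "complex vec"
  assumes "w \<in> carrier_vec n"
  shows "v \<bullet>c w = (\<Sum>i<n. v $ i * cnj (w $ i))"
  using assms by (auto simp: scalar_prod_def atLeast0LessThan intro!: sum.cong)

lemma mat_adjoint_mult:
  fixes A B :: "complex mat"
  assumes A: "A \<in> carrier_mat n k" and B: "B \<in> carrier_mat k l"
  shows "mat_adjoint (A * B) = mat_adjoint B * mat_adjoint A"
proof (rule eq_matI)
  fix i j assume ij: "i < dim_row (mat_adjoint B * mat_adjoint A)"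
    "j < dim_col (mat_adjoint B * mat_adjoint A)"
  have i: "i < l" and j: "j < n" using ij A B by auto
  have "mat_adjoint (A * B) $$ (i, j) = cnj ((A * B) $$ (j, i))"
    using i j A B by simp
  also have "\<dots> = (\<Sum>x<k. cnj (A $$ (j, x)) * cnj (B $$ (x, i)))"
    using index_mult_sum[OF A B j i] by simp
  also have "\<dots> = (mat_adjoint B * mat_adjoint A) $$ (i, j)"
    using index_mult_sum[OF mat_adjoint_carrier[OF B] mat_adjoint_carrier[OF A] i j] A B i j
    by (auto simp: mult.commute intro!: sum.cong)
  finally show "mat_adjoint (A * B) $$ (i, j) = (mat_adjoint B * mat_adjoint A) $$ (i, j)" .
qed (use A B in auto)

lemma mat_adjoint_smult:
  "mat_adjoint (a \<cdot>\<^sub>m A) = cnj a \<cdot>\<^sub>m mat_adjoint (A :: complex mat)"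
  by (rule eq_matI) auto

lemma mat_adjoint_one [simp]: "mat_adjoint (1\<^sub>m n) = (1\<^sub>m n :: complex mat)"
  by (rule eq_matI) auto

lemma cscalar_prod_adjoint:
  fixes v w :: "complex vec"
  assumes A: "A \<in> carrier_mat n k" and v: "v \<in> carrier_vec k" and w: "w \<in> carrier_vec n"
  shows "(A *\<^sub>v v) \<bullet>c w = v \<bullet>c (mat_adjoint A *\<^sub>v w)"
proof -
  have "(A *\<^sub>v v) \<bullet>c w = (\<Sum>i<n. \<Sum>x<k. A $$ (i, x) * v $ x * cnj (w $ i))"
    using w by (auto simp: cscalar_prod_sum index_mult_vec_sum[OF A v] sum_distrib_right
        intro!: sum.cong)
  also have "\<dots> = (\<Sum>x<k. \<Sum>i<n. A $$ (i, x) * v $ x * cnj (w $ i))"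
    by (rule sum.swap)
  also have "\<dots> = v \<bullet>c (mat_adjoint A *\<^sub>v w)"
    using A mult_mat_vec_carrier[OF mat_adjoint_carrier[OF A] w]
    by (auto simp: cscalar_prod_sum index_mult_vec_sum[OF mat_adjoint_carrier[OF A] w]
         sum_distrib_left simp del: index_mult_mat_vec intro!: sum.cong)
  finally show ?thesis .
qed

lemma mat_trace_comm:
  assumes A: "A \<in> carrier_mat n k" and B: "B \<in> carrier_mat k n"
  shows "mat_trace (A * B) = mat_trace (B * A)"
proof -
  have "mat_trace (A * B) = (\<Sum>i<n. \<Sum>x<k. A $$ (i, x) * B $$ (x, i))"
    unfolding mat_trace_def using A index_mult_sum[OF A B] by auto
  also have "\<dots> = (\<Sum>x<k. \<Sum>i<n. B $$ (x, i) * A $$ (i, x))"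
    by (subst sum.swap) (simp add: mult.commute)
  also have "\<dots> = mat_trace (B * A)"
    unfolding mat_trace_def using B index_mult_sum[OF B A] by auto
  finally show ?thesis .
qed

lemma mat_trace_mult_adjoint:
  assumes A: "A \<in> carrier_mat n k"
  shows "mat_trace (A * mat_adjoint A) = of_real (\<Sum>i<n. \<Sum>x<k. (cmod (A $$ (i, x)))\<^sup>2)"
  unfolding mat_trace_def
  using A index_mult_sum[OF A mat_adjoint_carrier[OF A]]
  by (auto simp: complex_mult_cnj cmod_power2 intro!: sum.cong)

lemma mat_trace_add:
  "A \<in> carrier_mat n n \<Longrightarrow> B \<in> carrier_mat n n \<Longrightarrow> mat_trace (A + B) = mat_trace A + mat_trace B"
  unfolding mat_trace_def by (auto simp: sum.distrib)

lemma mat_trace_smult: "A \<in> carrier_mat n n \<Longrightarrow> mat_trace (a \<cdot>\<^sub>m A) = a * mat_trace A"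
  unfolding mat_trace_def by (auto simp: sum_distrib_left)

section \<open>Positive semidefinite matrices\<close>

text \<open>Test vectors are functions rather than members of \<open>carrier_vec n\<close>, so that
  those used below can be written as function updates; values at indices from \<open>n\<close> on
  never enter.\<close>

lemma psd_mat_iff:
  "psd_mat n A \<longleftrightarrow> A \<in> carrier_mat n n \<and>
     (\<forall>v. 0 \<le> (\<Sum>i<n. \<Sum>j<n. A $$ (i, j) * v j * cnj (v i)))"
proof (cases "A \<in> carrier_mat n n")
  case True
  have *: "(A *\<^sub>v v) \<bullet>c v = (\<Sum>i<n. \<Sum>j<n. A $$ (i, j) * v $ j * cnj (v $ i))"
    if "v \<in> carrier_vec n" for v
    using that by (auto simp: cscalar_prod_sum index_mult_vec_sum[OF True] sum_distrib_right
        simp del: index_mult_mat_vec intro!: sum.cong)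
  have "(\<forall>v\<in>carrier_vec n. 0 \<le> (A *\<^sub>v v) \<bullet>c v) \<longleftrightarrow>
      (\<forall>v. 0 \<le> (\<Sum>i<n. \<Sum>j<n. A $$ (i, j) * v j * cnj (v i)))" (is "?L = ?R")
  proof
    assume L: ?L
    show ?R
    proof
      fix v :: "nat \<Rightarrow> complex"
      have "0 \<le> (A *\<^sub>v vec n v) \<bullet>c vec n v" using L by auto
      also have "\<dots> = (\<Sum>i<n. \<Sum>j<n. A $$ (i, j) * v j * cnj (v i))"
        by (subst *) auto
      finally show "0 \<le> (\<Sum>i<n. \<Sum>j<n. A $$ (i, j) * v j * cnj (v i))" .
    qed
  next
    assume ?R then show ?L using * by auto
  qed
  then show ?thesis using True unfolding psd_mat_def by auto
qed (auto simp: psd_mat_def)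


lemma sum_two_points:
  fixes f :: "nat \<Rightarrow> complex"
  assumes "i < n" "j < n" "i \<noteq> j" "v i = x" "v j = y" "\<And>k. k \<noteq> i \<Longrightarrow> k \<noteq> j \<Longrightarrow> v k = 0"
  shows "(\<Sum>k<n. f k * v k) = f i * x + f j * y"
proof -
  have "(\<Sum>k<n. f k * v k) = (\<Sum>k\<in>{i, j}. f k * v k)"
    using assms by (intro sum.mono_neutral_right) auto
  then show ?thesis using assms by simp
qed

text \<open>The matrix is a function as well, which lets the induction below pass to Schur
  complements without carrier conditions.\<close>

definition sform :: "nat \<Rightarrow> (nat \<Rightarrow> nat \<Rightarrow> complex) \<Rightarrow> (nat \<Rightarrow> complex) \<Rightarrow> complex" where
  "sform n A v = (\<Sum>i<n. \<Sum>j<n. A i j * v j * cnj (v i))"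

lemma sform_two_points:
  assumes ij: "i < n" "j < n" "i \<noteq> j"
  shows "sform n A ((\<lambda>_. 0)(i := x, j := y)) =
    A i i * x * cnj x + A i j * y * cnj x + A j i * x * cnj y + A j j * y * cnj y"
proof -
  let ?v = "(\<lambda>_. 0)(i := x, j := y)"
  have *: "(\<Sum>l<n. A k l * ?v l) = A k i * x + A k j * y" for k
    using ij by (intro sum_two_points) auto
  have "sform n A ?v = (\<Sum>k<n. (A k i * x + A k j * y) * cnj (?v k))"
    unfolding sform_def by (simp add: sum_distrib_right[symmetric] *[symmetric])
  also have "\<dots> = (A i i * x + A i j * y) * cnj x + (A j i * x + A j j * y) * cnj y"
    using ij by (intro sum_two_points) auto
  finally show ?thesis by (simp add: algebra_simps)
qed

lemma sform_one_point:
  assumes "i < n"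
  shows "sform n A ((\<lambda>_. 0)(i := x)) = A i i * x * cnj x"
proof -
  let ?v = "(\<lambda>_. 0)(i := x)"
  have "sform n A ?v = (\<Sum>k\<in>{i}. \<Sum>j<n. A k j * ?v j * cnj (?v k))"
    unfolding sform_def using assms by (intro sum.mono_neutral_right) auto
  also have "\<dots> = (\<Sum>j<n. A i j * ?v j * cnj x)" by simp
  also have "\<dots> = (\<Sum>j\<in>{i}. A i j * ?v j * cnj x)"
    using assms by (intro sum.mono_neutral_right) auto
  finally show ?thesis by simp
qed

context
  fixes n :: nat and A :: "nat \<Rightarrow> nat \<Rightarrow> complex"
  assumes psd: "\<And>v. 0 \<le> sform n A v"
begin

lemma sform_diag_nonneg: "i < n \<Longrightarrow> 0 \<le> A i i"
  using psd[of "(\<lambda>_. 0)(i := 1)"] by (simp add: sform_one_point del: fun_upd_apply)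

text \<open>The order on \<open>complex\<close> makes every value of the form real. At e_i + e_j
  this forces the imaginary parts of the two off-diagonal entries to be opposite, and at e_i + i e_j
  it forces their real parts to be equal.\<close>

lemma sform_hermitian:
  assumes ij: "i < n" "j < n"
  shows "A j i = cnj (A i j)"
proof (cases "i = j")
  case True
  then show ?thesis using sform_diag_nonneg[OF ij(1)]
    by (simp add: less_eq_complex_def complex_eq_iff)
next
  case False
  have d: "Im (A i i) = 0" "Im (A j j) = 0"
    using sform_diag_nonneg ij by (auto simp: less_eq_complex_def)
  have "Im (A i j) + Im (A j i) = 0"
    using psd[of "(\<lambda>_. 0)(i := 1, j := 1)"] d
    by (simp add: sform_two_points[OF ij False] less_eq_complex_def del: fun_upd_apply)
  moreover have "Re (A i j) = Re (A j i)"
    using psd[of "(\<lambda>_. 0)(i := 1, j := \<i>)"] d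
    by (simp add: sform_two_points[OF ij False] less_eq_complex_def del: fun_upd_apply)
  ultimately show ?thesis by (simp add: complex_eq_iff)
qed

text \<open>With zero diagonal entries, the form at e_i - conj(A_ij) e_j equals -2 |A_ij|^2, so it
  can be nonnegative only if the entry vanishes.\<close>

lemma sform_zero_diag:
  assumes ij: "i < n" "j < n" and z: "A i i = 0" "A j j = 0"
  shows "A i j = 0"
proof (cases "i = j")
  case False
  have "0 \<le> A i j * - cnj (A i j) + cnj (A i j) * - A i j"
    using psd[of "(\<lambda>_. 0)(i := 1, j := - cnj (A i j))"] z sform_hermitian[OF ij]
    by (simp add: sform_two_points[OF ij False] del: fun_upd_apply)
  then have "(Re (A i j))\<^sup>2 + (Im (A i j))\<^sup>2 \<le> 0"
    by (simp add: less_eq_complex_def power2_eq_square)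
  then show ?thesis by (simp add: complex_eq_iff sum_power2_le_zero_iff)
qed (use z in auto)

text \<open>Completing the square: the form of the complement at \<open>v\<close> is the form of
  \<open>A\<close> at \<open>v\<close> with coordinate \<open>a\<close> suitably shifted, so
  nonnegativity is inherited.\<close>

lemma sform_schur_complement:
  assumes a: "a < n" and nz: "A a a \<noteq> 0"
  shows "0 \<le> sform n (\<lambda>i j. A i j - A i a * A a j / A a a) v"
proof -
  define c where "c = (\<Sum>j<n. A a j * v j)"
  \<comment> \<open>This shift makes row \<open>a\<close> of \<open>A\<close> vanish on the shifted
    vector: \<open>c + A a a * s = 0\<close>.\<close>
  define s where "s = - c / A a a"
  let ?e = "\<lambda>i. if i = a then s else 0 :: complex"
  have cc: "(\<Sum>i<n. A i a * cnj (v i)) = cnj c"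
    unfolding c_def using sform_hermitian[OF a] by (auto intro!: sum.cong)
  have Ara: "cnj (A a a) = A a a" using sform_hermitian[OF a a] by simp
  have row: "(\<Sum>j<n. A i j * (v j + ?e j)) = (\<Sum>j<n. A i j * v j) + A i a * s" for i
  proof -
    have "A i j * (v j + ?e j) = A i j * v j + (if j = a then A i j * s else 0)" for j
      by (simp add: distrib_left)
    then show ?thesis using a by (simp add: sum.distrib)
  qed
  have "sform n A (\<lambda>i. v i + ?e i)
      = (\<Sum>i<n. (\<Sum>j<n. A i j * (v j + ?e j)) * cnj (v i + ?e i))"
    unfolding sform_def by (simp add: sum_distrib_right)
  also have "\<dots> = (\<Sum>i<n. ((\<Sum>j<n. A i j * v j) + A i a * s) * cnj (v i) +
      (if i = a then ((\<Sum>j<n. A i j * v j) + A i a * s) * cnj s else 0))"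
    unfolding row by (intro sum.cong) (auto simp: algebra_simps)
  also have "\<dots> = (\<Sum>i<n. (\<Sum>j<n. A i j * v j) * cnj (v i)) + s * (\<Sum>i<n. A i a * cnj (v i))
      + (c + A a a * s) * cnj s"
    using a by (simp add: sum.distrib distrib_right c_def)
      (simp add: sum_distrib_left mult_ac)
  also have "\<dots> = sform n A v + s * cnj c"
    unfolding cc s_def using nz by (simp add: sform_def sum_distrib_right)
  also have "s * cnj c = - (c * cnj c / A a a)" by (simp add: s_def)
  also have "c * cnj c = (\<Sum>i<n. (\<Sum>j<n. A i a * A a j * v j * cnj (v i)))"
    unfolding cc[symmetric] unfolding c_def
    by (simp add: sum_product sum_distrib_left sum_distrib_right mult_ac)

  also have "sform n A v + - (\<dots> / A a a) = sform n (\<lambda>i j. A i j - A i a * A a j / A a a) v"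
    unfolding sform_def
    by (simp add: sum_subtractf[symmetric] sum_divide_distrib left_diff_distrib)
  finally show ?thesis using psd[of "\<lambda>i. v i + ?e i"] by simp
qed

end

text \<open>Induction on the number of nonzero diagonal entries: each step splits off the rank-one term
  of a pivot and passes to the Schur complement.\<close>

lemma sform_gram:
  assumes "\<And>v. 0 \<le> sform n A v"
  shows "\<exists>(l::nat) F. \<forall>i<n. \<forall>j<n. A i j = (\<Sum>k<l. F i k * cnj (F j k))"
  using assms
proof (induction "card {i. i < n \<and> A i i \<noteq> 0}" arbitrary: A rule: less_induct)
  case less
  note psd = less.prems
  show ?case
  proof (cases "\<forall>i<n. A i i = 0")
    case True
    then have "\<forall>i<n. \<forall>j<n. A i j = 0" using sform_zero_diag[of n A, OF psd] by blast
    then show ?thesis by (intro exI[of _ 0]) auto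
  next
    case False
    then obtain a where a: "a < n" and nz: "A a a \<noteq> 0" by auto
    define B where "B = (\<lambda>i j. A i j - A i a * A a j / A a a)"
    have psdB: "0 \<le> sform n B v" for v
      unfolding B_def by (rule sform_schur_complement[of n A, OF psd a nz])
    have pos: "0 < Re (A a a)" and re: "A a a = of_real (Re (A a a))"
      using sform_diag_nonneg[of n A, OF psd a] nz
      by (auto simp: less_eq_complex_def complex_eq_iff)
    have herm: "A a i = cnj (A i a)" if "i < n" for i
      using sform_hermitian[of n A, OF psd] that a by blast
    \<comment> \<open>Zero diagonal entries stay zero, so the count in the induction really drops:
      here \<open>B i i\<close> is -|A_ia|^2 / A_aa, yet it is nonnegative as a diagonal value of
      \<open>B\<close>.\<close>
    have "B i i = 0" if i: "i < n" "A i i = 0" for i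
    proof -
      have "A i a * A a i = of_real ((cmod (A i a))\<^sup>2)"
        using herm[OF i(1)] by (simp add: complex_mult_cnj cmod_power2)
      then have "B i i = - of_real ((cmod (A i a))\<^sup>2 / Re (A a a))"
        unfolding B_def using i re by (metis diff_0 of_real_divide)
      moreover have "0 \<le> B i i" by (rule sform_diag_nonneg[of n B, OF psdB i(1)])
      ultimately have "(cmod (A i a))\<^sup>2 / Re (A a a) = 0"
        using pos by (auto simp: less_eq_complex_def divide_le_0_iff)
      then show ?thesis using \<open>B i i = _\<close> by simp
    qed
    moreover have "B a a = 0" unfolding B_def using nz by simp
    ultimately have "{i. i < n \<and> B i i \<noteq> 0} \<subset> {i. i < n \<and> A i i \<noteq> 0}"
      using a nz by auto
    then have "card {i. i < n \<and> B i i \<noteq> 0} < card {i. i < n \<and> A i i \<noteq> 0}"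
      by (intro psubset_card_mono) auto
    from less.hyps[OF this psdB] obtain l :: nat and F
      where F: "\<forall>i<n. \<forall>j<n. B i j = (\<Sum>k<l. F i k * cnj (F j k))" by blast
    define r where "r = complex_of_real (sqrt (Re (A a a)))"
    have rr: "r * cnj r = A a a"
      unfolding r_def using pos by (subst re) (simp flip: of_real_mult)
    define F' where "F' = (\<lambda>i k. if k = l then A i a / r else F i k)"
    have "A i j = (\<Sum>k<Suc l. F' i k * cnj (F' j k))" if ij: "i < n" "j < n" for i j
    proof -
      have "(\<Sum>k<Suc l. F' i k * cnj (F' j k)) = B i j + A i a / r * cnj (A j a / r)"
        using F ij by (simp add: F'_def)
      also have "A i a / r * cnj (A j a / r) = A i a * A a j / A a a"
        using herm[OF ij(2)] rr by simp
      finally show ?thesis by (simp add: B_def)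
    qed
    then show ?thesis by blast
  qed
qed

lemma psd_mat_gram:
  assumes "psd_mat n A"
  obtains l F where "F \<in> carrier_mat n l" "A = F * mat_adjoint F"
proof -
  have A: "A \<in> carrier_mat n n" and "0 \<le> sform n (\<lambda>i j. A $$ (i, j)) v" for v
    using assms unfolding psd_mat_iff sform_def by auto
  from sform_gram[OF this(2)] obtain l :: nat and F
    where F: "\<forall>i<n. \<forall>j<n. A $$ (i, j) = (\<Sum>k<l. F i k * cnj (F j k))" by blast
  define M where "M = mat n l (\<lambda>(i, k). F i k)"
  have M: "M \<in> carrier_mat n l" unfolding M_def by simp
  have "A = M * mat_adjoint M"
  proof (rule eq_matI)
    fix i j assume "i < dim_row (M * mat_adjoint M)" "j < dim_col (M * mat_adjoint M)"
    then have ij: "i < n" "j < n" using M by auto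
    show "A $$ (i, j) = (M * mat_adjoint M) $$ (i, j)"
      using index_mult_sum[OF M mat_adjoint_carrier[OF M] ij] ij F M by (simp add: M_def)
  qed (use A M in auto)
  then show ?thesis using that M by blast
qed

lemma psd_mat_mult_adjoint:
  assumes M: "M \<in> carrier_mat n l"
  shows "psd_mat n (M * mat_adjoint M)"
  unfolding psd_mat_def
proof (intro conjI ballI)
  fix v :: "complex vec" assume v: "v \<in> carrier_vec n"
  have "(M * mat_adjoint M *\<^sub>v v) \<bullet>c v = (mat_adjoint M *\<^sub>v v) \<bullet>c (mat_adjoint M *\<^sub>v v)"
    using M v cscalar_prod_adjoint[OF M mult_mat_vec_carrier[OF mat_adjoint_carrier[OF M] v] v]
    by (simp add: assoc_mult_mat_vec[of _ _ l _ n])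
  then show "0 \<le> (M * mat_adjoint M *\<^sub>v v) \<bullet>c v"
    by (simp add: conjugate_square_ge_0_vec)
qed (use M in auto)

section \<open>Schur's lemma and the orthogonality relations\<close>

lemma mult_mat_assoc4:
  fixes A B C D :: "'a :: semiring_0 mat"
  assumes A: "A \<in> carrier_mat n0 n1" and B: "B \<in> carrier_mat n1 n2"
    and C: "C \<in> carrier_mat n2 n3" and D: "D \<in> carrier_mat n3 n4"
  shows "A * B * (C * D) = A * (B * C) * D"
  using assoc_mult_mat[OF mult_carrier_mat[OF A B] C D] assoc_mult_mat[OF A B C] by simp

lemma smult_smult_mat: "a \<cdot>\<^sub>m (b \<cdot>\<^sub>m A) = (a * b :: 'a :: semigroup_mult) \<cdot>\<^sub>m A"
  by (rule eq_matI) (auto simp: mult.assoc)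

lemma smult_one_mat: "(1 :: 'a :: monoid_mult) \<cdot>\<^sub>m A = A"
  by (rule eq_matI) auto

lemma mult_smult_smult_mat:
  fixes A B :: "complex mat"
  assumes A: "A \<in> carrier_mat n k" and B: "B \<in> carrier_mat k l"
  shows "(a \<cdot>\<^sub>m A) * (b \<cdot>\<^sub>m B) = (a * b) \<cdot>\<^sub>m (A * B)"
  using mult_smult_assoc_mat[OF A smult_carrier_mat[OF B]] mult_smult_distrib[OF A B]
  by (simp add: smult_smult_mat)

lemma unitary_matD:
  assumes "unitary_mat n A"
  shows "A \<in> carrier_mat n n" "A * mat_adjoint A = 1\<^sub>m n" "mat_adjoint A * A = 1\<^sub>m n"
  using assms unfolding unitary_mat_def by auto

lemma unitary_mat_adjoint: "unitary_mat n A \<Longrightarrow> unitary_mat n (mat_adjoint A)"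
  unfolding unitary_mat_def by auto

lemma unitary_mat_one: "unitary_mat n (1\<^sub>m n)"
  unfolding unitary_mat_def by auto

lemma unitary_mat_mult:
  assumes A: "unitary_mat n A" and B: "unitary_mat n B"
  shows "unitary_mat n (A * B)"
proof -
  note a = unitary_matD[OF A] and b = unitary_matD[OF B]
  note ac = mat_adjoint_carrier[OF a(1)] and bc = mat_adjoint_carrier[OF b(1)]
  show ?thesis
    unfolding unitary_mat_def mat_adjoint_mult[OF a(1) b(1)]
    using mult_mat_assoc4[OF a(1) b(1) bc ac] mult_mat_assoc4[OF bc ac a(1) b(1)] a b ac bc by auto
qed

lemma unitary_proj_repD:
  assumes "unitary_proj_rep G c n U" "g \<in> carrier G"
  shows "unitary_mat n (U g)" "U g \<in> carrier_mat n n"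
    "\<And>h. h \<in> carrier G \<Longrightarrow> cmod (c g h) = 1"
    "\<And>h. h \<in> carrier G \<Longrightarrow> U g * U h = c g h \<cdot>\<^sub>m U (g \<otimes>\<^bsub>G\<^esub> h)"
  using assms unfolding unitary_proj_rep_def by (auto dest: unitary_matD)

lemma irreducible_proj_repD:
  assumes "irreducible_proj_rep G c n U"
  shows "unitary_proj_rep G c n U" "0 < n"
    "\<And>W. invariant_subspace G n U W \<Longrightarrow> W = {0\<^sub>v n} \<or> W = carrier_vec n"
  using assms unfolding irreducible_proj_rep_def by auto

lemma invariant_subspaceI:
  assumes "W \<subseteq> carrier_vec n" "0\<^sub>v n \<in> W"
    "\<And>v w. v \<in> W \<Longrightarrow> w \<in> W \<Longrightarrow> v + w \<in> W"
    "\<And>a v. v \<in> W \<Longrightarrow> a \<cdot>\<^sub>v v \<in> W"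
    "\<And>g w. g \<in> carrier G \<Longrightarrow> w \<in> W \<Longrightarrow> U g *\<^sub>v w \<in> W"
  shows "invariant_subspace G n U W"
  unfolding invariant_subspace_def VectorSpace.subspace_def submodule_def
  using assms vec_vs vec_module by (auto simp: module_vec_simps)

lemma invariant_subspaceD:
  assumes "invariant_subspace G n U W"
  shows "W \<subseteq> carrier_vec n" "0\<^sub>v n \<in> W"
    "\<And>v w. v \<in> W \<Longrightarrow> w \<in> W \<Longrightarrow> v + w \<in> W"
    "\<And>a v. v \<in> W \<Longrightarrow> a \<cdot>\<^sub>v v \<in> W"
    "\<And>g w. g \<in> carrier G \<Longrightarrow> w \<in> W \<Longrightarrow> U g *\<^sub>v w \<in> W"
  using assms unfolding invariant_subspace_def VectorSpace.subspace_def submodule_def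
  by (auto simp: module_vec_simps class_ring_simps)

text \<open>Schur's lemma for endomorphisms. Over the complex numbers \<open>B\<close> has an
  eigenvalue; its eigenspace is invariant and nonzero, hence the whole space.\<close>

lemma commuting_irreducible_scalar:
  assumes irr: "irreducible_proj_rep G c n U" and B: "B \<in> carrier_mat n n"
    and comm: "\<And>g. g \<in> carrier G \<Longrightarrow> B * U g = U g * B"
  obtains a where "B = a \<cdot>\<^sub>m 1\<^sub>m n"
proof -
  note I = irreducible_proj_repD[OF irr]
  obtain a where "a \<in> spectrum B" using spectrum_non_empty[OF B I(2)] by blast
  then obtain v where v: "v \<in> carrier_vec n" "v \<noteq> 0\<^sub>v n" "B *\<^sub>v v = a \<cdot>\<^sub>v v"
    using B unfolding spectrum_def eigenvalue_def eigenvector_def by auto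
  define W where "W = {w \<in> carrier_vec n. B *\<^sub>v w = a \<cdot>\<^sub>v w}"
  have "invariant_subspace G n U W"
  proof (rule invariant_subspaceI)
    fix g w assume g: "g \<in> carrier G" and w: "w \<in> W"
    note Ug = unitary_proj_repD(2)[OF I(1) g]
    have wc: "w \<in> carrier_vec n" and Bw: "B *\<^sub>v w = a \<cdot>\<^sub>v w" using w by (auto simp: W_def)
    have "B *\<^sub>v (U g *\<^sub>v w) = (B * U g) *\<^sub>v w" using assoc_mult_mat_vec[OF B Ug wc] by simp
    also have "\<dots> = U g *\<^sub>v (B *\<^sub>v w)" unfolding comm[OF g] using assoc_mult_mat_vec[OF Ug B wc] by simp
    also have "\<dots> = a \<cdot>\<^sub>v (U g *\<^sub>v w)" unfolding Bw using mult_mat_vec[OF Ug wc] by simp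
    finally show "U g *\<^sub>v w \<in> W" using Ug wc by (simp add: W_def)
  next
    fix v w assume "v \<in> W" "w \<in> W"
    then show "v + w \<in> W" using B
      by (auto simp: W_def mult_add_distrib_mat_vec[OF B] smult_add_distrib_vec[of _ n])
  next
    fix b v assume "v \<in> W"
    then show "b \<cdot>\<^sub>v v \<in> W"
      using B by (auto simp: W_def mult_mat_vec[OF B] smult_smult_assoc mult.commute)
  qed (use B in \<open>auto simp: W_def\<close>)
  moreover have "v \<in> W" using v by (simp add: W_def)
  ultimately have W: "W = carrier_vec n" using I(3) v(2) by blast
  have "B = a \<cdot>\<^sub>m 1\<^sub>m n"
  proof (rule eq_matI)
    fix i j assume "i < dim_row (a \<cdot>\<^sub>m 1\<^sub>m n)" "j < dim_col (a \<cdot>\<^sub>m 1\<^sub>m n)"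
    then have ij: "i < n" "j < n" by auto
    have "unit_vec n j \<in> W" using ij W by simp
    then have "(B *\<^sub>v unit_vec n j) $ i = (a \<cdot>\<^sub>v unit_vec n j) $ i" by (simp add: W_def)
    moreover have "(B *\<^sub>v unit_vec n j) $ i = B $$ (i, j)"
      using B ij by (simp add: scalar_prod_right_unit)
    ultimately show "B $$ (i, j) = (a \<cdot>\<^sub>m 1\<^sub>m n) $$ (i, j)" using ij by (simp add: unit_vec_def)
  qed (use B in auto)
  then show ?thesis using that by blast
qed

text \<open>Multiplying A U = V A by the adjoint of V on the left and that of U on the right moves
  the adjoints to the other sides; the adjoint of the resulting equation is the claim.\<close>

lemma intertwiner_adjoint:
  assumes U: "unitary_mat n U" and V: "unitary_mat k V" and A: "A \<in> carrier_mat k n"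
    and eq: "A * U = V * A"
  shows "mat_adjoint A * V = U * mat_adjoint A"
proof -
  note u = unitary_matD[OF U] and v = unitary_matD[OF V]
  note c = u(1) v(1) A mat_adjoint_carrier[OF u(1)] mat_adjoint_carrier[OF v(1)]
    mat_adjoint_carrier[OF A]
  have "mat_adjoint V * A = mat_adjoint V * A * (U * mat_adjoint U)"
    unfolding u(2) using c by simp
  also have "\<dots> = mat_adjoint V * (A * U) * mat_adjoint U"
    by (rule mult_mat_assoc4[OF c(5,3,1,4)])
  also have "\<dots> = mat_adjoint V * V * (A * mat_adjoint U)"
    unfolding eq by (rule mult_mat_assoc4[OF c(5,2,3,4), symmetric])
  also have "\<dots> = A * mat_adjoint U" unfolding v(3) using c by simp
  finally have "mat_adjoint V * A = A * mat_adjoint U" .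
  then have "mat_adjoint (mat_adjoint V * A) = mat_adjoint (A * mat_adjoint U)" by simp
  then show ?thesis using mat_adjoint_mult[OF c(5,3)] mat_adjoint_mult[OF c(3,4)] by simp
qed

text \<open>Both products of \<open>A\<close> with its adjoint commute with an irreducible
  representation, so they are scalars a and b. Associativity gives a A = b A, and equality of traces
  gives a n = b k. If \<open>A\<close> is nonzero, then a = b is positive, the dimensions agree, and
  a multiple of \<open>A\<close> is a unitary equivalence.\<close>

lemma intertwiner_zero_or_equiv:
  assumes irrU: "irreducible_proj_rep G c n U" and irrV: "irreducible_proj_rep G c k V"
    and A: "A \<in> carrier_mat k n" and eq: "\<And>g. g \<in> carrier G \<Longrightarrow> A * U g = V g * A"
  shows "A = 0\<^sub>m k n \<or> rep_equiv G (n, U) (k, V)"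
proof (rule disjCI)
  assume ne: "\<not> rep_equiv G (n, U) (k, V)"
  note IU = irreducible_proj_repD[OF irrU] and IV = irreducible_proj_repD[OF irrV]
  let ?A = "mat_adjoint A"
  note cA = mat_adjoint_carrier[OF A]
  have eq': "?A * V g = U g * ?A" if "g \<in> carrier G" for g
    using intertwiner_adjoint[OF unitary_proj_repD(1)[OF IU(1) that]
        unitary_proj_repD(1)[OF IV(1) that] A eq[OF that]] .
  have c1: "(?A * A) * U g = U g * (?A * A)" if g: "g \<in> carrier G" for g
  proof -
    note u = unitary_proj_repD(2)[OF IU(1) g] and v = unitary_proj_repD(2)[OF IV(1) g]
    show ?thesis
      using assoc_mult_mat[OF cA A u] assoc_mult_mat[OF cA v A] assoc_mult_mat[OF u cA A]
        eq[OF g] eq'[OF g] by simp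
  qed
  have c2: "(A * ?A) * V g = V g * (A * ?A)" if g: "g \<in> carrier G" for g
  proof -
    note u = unitary_proj_repD(2)[OF IU(1) g] and v = unitary_proj_repD(2)[OF IV(1) g]
    show ?thesis
      using assoc_mult_mat[OF A cA v] assoc_mult_mat[OF A u cA] assoc_mult_mat[OF v A cA]
        eq[OF g] eq'[OF g] by simp
  qed
  obtain a where a: "?A * A = a \<cdot>\<^sub>m 1\<^sub>m n"
    using commuting_irreducible_scalar[OF irrU mult_carrier_mat[OF cA A] c1] by blast
  obtain b where b: "A * ?A = b \<cdot>\<^sub>m 1\<^sub>m k"
    using commuting_irreducible_scalar[OF irrV mult_carrier_mat[OF A cA] c2] by blast
  have tra: "mat_trace (a \<cdot>\<^sub>m 1\<^sub>m n) = a * of_nat n" "mat_trace (b \<cdot>\<^sub>m 1\<^sub>m k) = b * of_nat k"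
    unfolding mat_trace_def by auto
  define r where "r = (\<Sum>i<k. \<Sum>x<n. (cmod (A $$ (i, x)))\<^sup>2)"
  have trb: "b * of_nat k = of_real r"
    using mat_trace_mult_adjoint[OF A] b tra by (simp add: r_def)
  have tra': "a * of_nat n = of_real r" using mat_trace_comm[OF A cA] a b tra trb by simp
  show "A = 0\<^sub>m k n"
  proof (rule ccontr)
    assume nz: "A \<noteq> 0\<^sub>m k n"
    then obtain i x where ix: "i < k" "x < n" "A $$ (i, x) \<noteq> 0"
      using A by (auto simp: mat_eq_iff)
    have "0 < (cmod (A $$ (i, x)))\<^sup>2" using ix by simp
    also have "\<dots> \<le> (\<Sum>x<n. (cmod (A $$ (i, x)))\<^sup>2)"
      using ix by (intro member_le_sum) auto
    also have "\<dots> \<le> r" unfolding r_def using ix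
      by (intro member_le_sum[of i "{..<k}" "\<lambda>i. \<Sum>x<n. (cmod (A $$ (i, x)))\<^sup>2"] sum_nonneg) auto
    finally have r: "0 < r" .
    have a_eq: "a = of_real (r / n)" using tra' IU(2) by (simp add: field_simps)
    have b_eq: "b = of_real (r / k)" using trb IV(2) by (simp add: field_simps)
    have "a \<cdot>\<^sub>m A = A * (?A * A)" using a A by (simp add: mult_smult_distrib[OF A one_carrier_mat])
    also have "\<dots> = (A * ?A) * A" using assoc_mult_mat[OF A cA A] by simp
    also have "\<dots> = b \<cdot>\<^sub>m A" using b A by (simp add: mult_smult_assoc_mat[of _ k k])
    finally have "(a \<cdot>\<^sub>m A) $$ (i, x) = (b \<cdot>\<^sub>m A) $$ (i, x)" by simp
    then have ab: "a = b" using ix A by simp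
    then have nk: "n = k" using a_eq b_eq r IU(2) IV(2) by (auto simp: field_simps)
    \<comment> \<open>The scalar is \<open>a = r / n\<close>, with \<open>r\<close> the squared
      Frobenius norm of \<open>A\<close>, so dividing \<open>A\<close> by its root makes it
      unitary.\<close>
    define s where "s = complex_of_real (1 / sqrt (r / n))"
    have s: "s * cnj s * a = 1" "cnj s * s * a = 1"
      unfolding s_def a_eq using r IU(2)
      by (simp_all flip: of_real_mult add: real_sqrt_mult[symmetric])
    have "unitary_mat n (s \<cdot>\<^sub>m A)"
      unfolding unitary_mat_def mat_adjoint_smult
      using A cA a b ab s nk mult_smult_smult_mat[OF A cA] mult_smult_smult_mat[OF cA A]
      by (auto simp: smult_smult_mat mult_ac smult_one_mat)
    moreover have "(s \<cdot>\<^sub>m A) * U g = V g * (s \<cdot>\<^sub>m A)" if g: "g \<in> carrier G" for g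
      using eq[OF g] A unitary_proj_repD(2)[OF IU(1) g] unitary_proj_repD(2)[OF IV(1) g] nk
      by (simp add: mult_smult_assoc_mat[of _ k k] mult_smult_distrib[of _ k k])
    ultimately have "rep_equiv G (n, U) (k, V)" using nk by auto
    then show False using ne by blast
  qed
qed

section \<open>Sums over the group and orthogonality of matrix coefficients\<close>

lemma sum_group_shift:
  assumes "group G" "h \<in> carrier G"
  shows "(\<Sum>g\<in>carrier G. f (h \<otimes>\<^bsub>G\<^esub> g)) = sum f (carrier G)"
proof -
  have "bij_betw (\<lambda>g. h \<otimes>\<^bsub>G\<^esub> g) (carrier G) (carrier G)"
    using assms by (simp add: bij_betw_def group.inj_on_cmult group.surj_const_mult)
  then show ?thesis by (rule sum.reindex_bij_betw)
qed

lemma sum_group_shift_right: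
  assumes "group G" "h \<in> carrier G"
  shows "(\<Sum>g\<in>carrier G. f (g \<otimes>\<^bsub>G\<^esub> h)) = sum f (carrier G)"
proof -
  interpret group G by fact
  have "bij_betw (\<lambda>g. g \<otimes>\<^bsub>G\<^esub> h) (carrier G) (carrier G)"
    by (rule bij_betwI[of _ _ _ "\<lambda>g. g \<otimes>\<^bsub>G\<^esub> inv\<^bsub>G\<^esub> h"]) (use assms in \<open>auto simp: m_assoc\<close>)
  then show ?thesis by (rule sum.reindex_bij_betw)
qed

text \<open>This is the sum over the group of U_g E_ab V_g^-1, where E_ab is a matrix unit; its
  entries are the inner products of matrix coefficients as functions on the group.\<close>

definition matrix_coeff_sum ::
  "('g, 'b) monoid_scheme \<Rightarrow> 'g rep \<Rightarrow> 'g rep \<Rightarrow> nat \<Rightarrow> nat \<Rightarrow> complex mat" where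
  "matrix_coeff_sum G s t a b = mat (fst s) (fst t)
     (\<lambda>(i, j). \<Sum>g\<in>carrier G. snd s g $$ (i, a) * cnj (snd t g $$ (j, b)))"

text \<open>Substitute h g for g. The phase \<open>c h g\<close> that arises when V_h is absorbed on
  the right is exactly the phase needed to split off U_h on the left, because both representations
  share the factor set.\<close>

lemma matrix_coeff_sum_intertwines:
  assumes G: "group G"
    and U: "unitary_proj_rep G c d U" and V: "unitary_proj_rep G c k V"
    and a: "a < d" and b: "b < k" and h: "h \<in> carrier G"
  shows "matrix_coeff_sum G (d, U) (k, V) a b * V h = U h * matrix_coeff_sum G (d, U) (k, V) a b"
    (is "?X * _ = _")
proof -
  have X: "?X \<in> carrier_mat d k" unfolding matrix_coeff_sum_def by simp
  note Uc = unitary_proj_repD(2)[OF U] and Vc = unitary_proj_repD(2)[OF V]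
  show ?thesis
  proof (rule eq_matI)
    fix i j assume "i < dim_row (U h * ?X)" "j < dim_col (U h * ?X)"
    then have ij: "i < d" "j < k" using X Uc[OF h] by auto
    have closed: "h \<otimes>\<^bsub>G\<^esub> g \<in> carrier G" if "g \<in> carrier G" for g
      using that h G by (simp add: group.is_monoid monoid.m_closed)
    have V': "(\<Sum>x<k. cnj (V (h \<otimes>\<^bsub>G\<^esub> g) $$ (x, b)) * V h $$ (x, j)) = c h g * cnj (V g $$ (j, b))"
      if g: "g \<in> carrier G" for g
    proof -
      note hV = unitary_matD[OF unitary_proj_repD(1)[OF V h]]
      have "cnj (c h g) * c h g = 1"
        using unitary_proj_repD(3)[OF V h g] complex_norm_square[of "c h g"] by (simp add: mult.commute)
      then have "V (h \<otimes>\<^bsub>G\<^esub> g) = cnj (c h g) \<cdot>\<^sub>m (V h * V g)"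
        unfolding unitary_proj_repD(4)[OF V h g]
        using Vc[OF closed[OF g]] by (simp add: smult_smult_mat smult_one_mat)
      then have "mat_adjoint (V h) * V (h \<otimes>\<^bsub>G\<^esub> g) = cnj (c h g) \<cdot>\<^sub>m (mat_adjoint (V h) * (V h * V g))"
        using mult_smult_distrib[OF mat_adjoint_carrier[OF hV(1)] mult_carrier_mat[OF hV(1) Vc[OF g]]]
        by simp
      also have "mat_adjoint (V h) * (V h * V g) = V g"
        using assoc_mult_mat[OF mat_adjoint_carrier[OF hV(1)] hV(1) Vc[OF g]] hV(3) Vc[OF g] by simp
      finally have "(mat_adjoint (V h) * V (h \<otimes>\<^bsub>G\<^esub> g)) $$ (j, b) = cnj (c h g) * V g $$ (j, b)"
        using Vc[OF g] ij b by simp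
      then have "(\<Sum>x<k. cnj (V h $$ (x, j)) * V (h \<otimes>\<^bsub>G\<^esub> g) $$ (x, b)) = cnj (c h g) * V g $$ (j, b)"
        using index_mult_sum[OF mat_adjoint_carrier[OF hV(1)] Vc[OF closed[OF g]] ij(2) b] hV(1) ij
        by simp
      from arg_cong[OF this, of cnj] show ?thesis by (simp add: mult.commute)
    qed
    have U': "(\<Sum>x<d. U h $$ (i, x) * U g $$ (x, a)) = c h g * U (h \<otimes>\<^bsub>G\<^esub> g) $$ (i, a)"
      if g: "g \<in> carrier G" for g
    proof -
      have "(U h * U g) $$ (i, a) = c h g * U (h \<otimes>\<^bsub>G\<^esub> g) $$ (i, a)"
        unfolding unitary_proj_repD(4)[OF U h g] using Uc[OF closed[OF g]] ij a by simp
      then show ?thesis using index_mult_sum[OF Uc[OF h] Uc[OF g] ij(1) a] by simp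
    qed
    have "(?X * V h) $$ (i, j) =
        (\<Sum>x<k. \<Sum>g\<in>carrier G. U g $$ (i, a) * cnj (V g $$ (x, b)) * V h $$ (x, j))"
      using index_mult_sum[OF X Vc[OF h] ij] ij by (simp add: matrix_coeff_sum_def sum_distrib_right)
    also have "\<dots> = (\<Sum>g\<in>carrier G. U g $$ (i, a) * (\<Sum>x<k. cnj (V g $$ (x, b)) * V h $$ (x, j)))"
      by (subst sum.swap) (simp add: sum_distrib_left mult.assoc)
    also have "\<dots> = (\<Sum>g\<in>carrier G. U (h \<otimes>\<^bsub>G\<^esub> g) $$ (i, a) *
        (\<Sum>x<k. cnj (V (h \<otimes>\<^bsub>G\<^esub> g) $$ (x, b)) * V h $$ (x, j)))"
      by (rule sum_group_shift[OF G h, symmetric])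
    also have "\<dots> = (\<Sum>g\<in>carrier G. (\<Sum>x<d. U h $$ (i, x) * U g $$ (x, a)) * cnj (V g $$ (j, b)))"
      by (rule sum.cong[OF refl], simp only: U' V') (simp add: mult_ac)
    also have "\<dots> = (\<Sum>x<d. \<Sum>g\<in>carrier G. U h $$ (i, x) * (U g $$ (x, a) * cnj (V g $$ (j, b))))"
      by (subst sum.swap) (simp add: sum_distrib_right mult.assoc)
    also have "\<dots> = (U h * ?X) $$ (i, j)"
      using index_mult_sum[OF Uc[OF h] X ij] ij by (simp add: matrix_coeff_sum_def sum_distrib_left)
    finally show "(?X * V h) $$ (i, j) = (U h * ?X) $$ (i, j)" .
  qed (use X Uc[OF h] Vc[OF h] in auto)
qed

text \<open>The summed matrix unit intertwines \<open>V\<close> with \<open>U\<close>, in this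
  direction, so without an equivalence from \<open>V\<close> to \<open>U\<close> it is zero.\<close>

lemma schur_orthogonality_inequivalent:
  assumes G: "group G"
    and U: "irreducible_proj_rep G c d U" and V: "irreducible_proj_rep G c k V"
    and ne: "\<not> rep_equiv G (k, V) (d, U)"
    and idx: "i < d" "a < d" "j < k" "b < k"
  shows "(\<Sum>g\<in>carrier G. U g $$ (i, a) * cnj (V g $$ (j, b))) = 0"
proof -
  let ?X = "matrix_coeff_sum G (d, U) (k, V) a b"
  have "?X \<in> carrier_mat d k" unfolding matrix_coeff_sum_def by simp
  then have "?X = 0\<^sub>m d k"
    using intertwiner_zero_or_equiv[OF V U] ne idx
      matrix_coeff_sum_intertwines[OF G irreducible_proj_repD(1)[OF U] irreducible_proj_repD(1)[OF V]]
    by blast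
  then have "?X $$ (i, j) = 0" using idx by simp
  then show ?thesis using idx by (simp add: matrix_coeff_sum_def)
qed

text \<open>The summed matrix unit is a scalar \<open>l\<close> times the identity. Taking the trace
  determines it: d l is the sum over g of an entry of the adjoint of U_g times U_g, which is |G| or
  0.\<close>

lemma schur_orthogonality_same:
  assumes G: "group G"
    and U: "irreducible_proj_rep G c d U"
    and idx: "i < d" "a < d" "j < d" "b < d"
  shows "(\<Sum>g\<in>carrier G. U g $$ (i, a) * cnj (U g $$ (j, b))) =
    (if i = j \<and> a = b then of_nat (card (carrier G)) / of_nat d else 0)"
proof -
  let ?X = "matrix_coeff_sum G (d, U) (d, U) a b"
  note I = irreducible_proj_repD[OF U]
  have Xc: "?X \<in> carrier_mat d d" unfolding matrix_coeff_sum_def by simp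
  obtain l where X: "?X = l \<cdot>\<^sub>m 1\<^sub>m d"
    using commuting_irreducible_scalar[OF U Xc] matrix_coeff_sum_intertwines[OF G I(1) I(1)] idx
    by blast
  have ent: "(\<Sum>g\<in>carrier G. U g $$ (x, a) * cnj (U g $$ (y, b))) = (if x = y then l else 0)"
    if xy: "x < d" "y < d" for x y
    using arg_cong[OF X, of "\<lambda>M. M $$ (x, y)"] xy by (simp add: matrix_coeff_sum_def)
  have "of_nat d * l = (\<Sum>x<d. \<Sum>g\<in>carrier G. U g $$ (x, a) * cnj (U g $$ (x, b)))"
    using ent by simp
  also have "\<dots> = (\<Sum>g\<in>carrier G. \<Sum>x<d. cnj (U g $$ (x, b)) * U g $$ (x, a))"
    by (subst sum.swap) (simp add: mult.commute)
  also have "\<dots> = (\<Sum>g\<in>carrier G. if a = b then 1 else 0)"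
  proof (rule sum.cong[OF refl])
    fix g assume g: "g \<in> carrier G"
    note u = unitary_matD[OF unitary_proj_repD(1)[OF I(1) g]]
    have "(mat_adjoint (U g) * U g) $$ (b, a) = (if b = a then 1 else 0)"
      unfolding u(3) using idx by simp
    then show "(\<Sum>x<d. cnj (U g $$ (x, b)) * U g $$ (x, a)) = (if a = b then 1 else 0)"
      using index_mult_sum[OF mat_adjoint_carrier[OF u(1)] u(1), of b a] idx u(1) by auto
  qed
  finally have "of_nat d * l = (if a = b then of_nat (card (carrier G)) else 0)" by simp
  then have "l = (if a = b then of_nat (card (carrier G)) / of_nat d else 0)"
    using I(2) by (simp add: field_simps split: if_splits)
  then show ?thesis using ent idx by simp
qed

section \<open>Orthonormal families\<close>

text \<open>Functions on an arbitrary finite set, so that the same facts serve vectors, functions on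
  the group and matrices viewed as functions on index pairs.\<close>

lemma orthonormal_residual:
  fixes f :: "'i \<Rightarrow> 'x \<Rightarrow> complex" and u :: "'x \<Rightarrow> complex"
  assumes "finite I" "finite X"
    and on: "\<And>i j. i \<in> I \<Longrightarrow> j \<in> I \<Longrightarrow> (\<Sum>x\<in>X. f i x * cnj (f j x)) = (if i = j then 1 else 0)"
  defines "c \<equiv> \<lambda>i. \<Sum>x\<in>X. u x * cnj (f i x)"
  defines "r \<equiv> \<lambda>x. u x - (\<Sum>i\<in>I. c i * f i x)"
  shows "\<And>j. j \<in> I \<Longrightarrow> (\<Sum>x\<in>X. r x * cnj (f j x)) = 0"
    and "(\<Sum>x\<in>X. (cmod (r x))\<^sup>2) = (\<Sum>x\<in>X. (cmod (u x))\<^sup>2) - (\<Sum>i\<in>I. (cmod (c i))\<^sup>2)"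
proof -
  show orth: "(\<Sum>x\<in>X. r x * cnj (f j x)) = 0" if j: "j \<in> I" for j
  proof -
    have "(\<Sum>x\<in>X. r x * cnj (f j x)) = c j - (\<Sum>x\<in>X. \<Sum>i\<in>I. c i * (f i x * cnj (f j x)))"
      unfolding r_def c_def
      by (simp add: left_diff_distrib sum_subtractf sum_distrib_right mult.assoc)
    also have "(\<Sum>x\<in>X. \<Sum>i\<in>I. c i * (f i x * cnj (f j x))) =
        (\<Sum>i\<in>I. c i * (\<Sum>x\<in>X. f i x * cnj (f j x)))"
      by (subst sum.swap) (simp add: sum_distrib_left)
    also have "\<dots> = (\<Sum>i\<in>I. if i = j then c i else 0)"
      using on j by (intro sum.cong) auto
    finally show ?thesis using j \<open>finite I\<close> by simp
  qed
  have "(\<Sum>x\<in>X. r x * cnj (r x)) =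
      (\<Sum>x\<in>X. r x * cnj (u x)) - (\<Sum>x\<in>X. \<Sum>i\<in>I. cnj (c i) * (r x * cnj (f i x)))"
    by (simp add: r_def right_diff_distrib sum_subtractf sum_distrib_left mult_ac)
  also have "(\<Sum>x\<in>X. \<Sum>i\<in>I. cnj (c i) * (r x * cnj (f i x))) =
      (\<Sum>i\<in>I. cnj (c i) * (\<Sum>x\<in>X. r x * cnj (f i x)))"
    by (subst sum.swap) (simp add: sum_distrib_left)
  also have "\<dots> = 0" using orth by simp
  also have "(\<Sum>x\<in>X. r x * cnj (u x)) =
      (\<Sum>x\<in>X. u x * cnj (u x)) - (\<Sum>x\<in>X. \<Sum>i\<in>I. c i * cnj (u x * cnj (f i x)))"
    by (simp add: r_def left_diff_distrib right_diff_distrib sum_subtractf sum_distrib_left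
        sum_distrib_right mult_ac)
  also have "(\<Sum>x\<in>X. \<Sum>i\<in>I. c i * cnj (u x * cnj (f i x))) = (\<Sum>i\<in>I. c i * cnj (c i))"
    by (subst sum.swap) (simp add: sum_distrib_left c_def)
  finally have "of_real (\<Sum>x\<in>X. (cmod (r x))\<^sup>2) =
      complex_of_real ((\<Sum>x\<in>X. (cmod (u x))\<^sup>2) - (\<Sum>i\<in>I. (cmod (c i))\<^sup>2))"
    by (simp flip: complex_norm_square)
  then show "(\<Sum>x\<in>X. (cmod (r x))\<^sup>2) = (\<Sum>x\<in>X. (cmod (u x))\<^sup>2) - (\<Sum>i\<in>I. (cmod (c i))\<^sup>2)"
    using of_real_eq_iff by blast
qed

lemma bessel_inequality:
  fixes f :: "'i \<Rightarrow> 'x \<Rightarrow> complex" and u :: "'x \<Rightarrow> complex"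
  assumes "finite I" "finite X"
    and "\<And>i j. i \<in> I \<Longrightarrow> j \<in> I \<Longrightarrow> (\<Sum>x\<in>X. f i x * cnj (f j x)) = (if i = j then 1 else 0)"
  shows "(\<Sum>i\<in>I. (cmod (\<Sum>x\<in>X. u x * cnj (f i x)))\<^sup>2) \<le> (\<Sum>x\<in>X. (cmod (u x))\<^sup>2)"
proof -
  have "0 \<le> (\<Sum>x\<in>X. (cmod (u x - (\<Sum>i\<in>I. (\<Sum>x\<in>X. u x * cnj (f i x)) * f i x)))\<^sup>2)"
    by (intro sum_nonneg) auto
  then show ?thesis using orthonormal_residual(2)[OF assms, of u] by simp
qed

definition orthonormal :: "nat \<Rightarrow> nat \<Rightarrow> (nat \<Rightarrow> complex vec) \<Rightarrow> bool" where
  "orthonormal n k e \<longleftrightarrow> (\<forall>i<k. e i \<in> carrier_vec n) \<and>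
     (\<forall>i<k. \<forall>j<k. e i \<bullet>c e j = (if i = j then 1 else 0))"

lemma orthonormal_sum:
  assumes "orthonormal n k e" "i < k" "j < k"
  shows "(\<Sum>x<n. e i $ x * cnj (e j $ x)) = (if i = j then 1 else 0)"
  using assms cscalar_prod_sum[of "e j" n "e i"] unfolding orthonormal_def by auto

text \<open>Double counting: Bessel's inequality for the unit vector at \<open>a\<close> gives sum_i
  |e_i(a)|^2 <= 1. Summed over \<open>a\<close>, the left side counts the \<open>k\<close> unit
  vectors and the right side is \<open>n\<close>.\<close>

lemma orthonormal_size:
  assumes on: "orthonormal n k e"
  shows "k \<le> n"
proof -
  have "(\<Sum>i<k. (cmod (e i $ a))\<^sup>2) \<le> 1" if a: "a < n" for a
  proof -
    define u where "u = (\<lambda>x. if x = a then 1 else 0 :: complex)"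
    have u: "(\<Sum>x<n. u x * f x) = f a" for f
    proof -
      have "(\<Sum>x<n. u x * f x) = (\<Sum>x<n. if x = a then f x else 0)"
        unfolding u_def by (rule sum.cong) auto
      then show ?thesis using a by simp
    qed
    have "(\<Sum>i<k. (cmod (\<Sum>x<n. u x * cnj (e i $ x)))\<^sup>2) \<le> (\<Sum>x<n. (cmod (u x))\<^sup>2)"
      by (rule bessel_inequality) (use orthonormal_sum[OF on] in auto)
    moreover have "(\<Sum>x<n. (cmod (u x))\<^sup>2) = (\<Sum>x<n. if x = a then 1 else 0)"
      unfolding u_def by (rule sum.cong) auto
    ultimately show ?thesis using a by (simp add: u)
  qed
  then have "(\<Sum>a<n. \<Sum>i<k. (cmod (e i $ a))\<^sup>2) \<le> (\<Sum>a<n. 1)" by (intro sum_mono) auto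
  moreover have "(\<Sum>a<n. \<Sum>i<k. (cmod (e i $ a))\<^sup>2) = real k"
  proof -
    have "(\<Sum>x<n. (cmod (e i $ x))\<^sup>2) = 1" if i: "i < k" for i
    proof -
      have "complex_of_real (\<Sum>x<n. (cmod (e i $ x))\<^sup>2) = of_real 1"
        using orthonormal_sum[OF on i i] by (simp flip: complex_norm_square)
      then show ?thesis using of_real_eq_iff by blast
    qed
    then show ?thesis by (subst sum.swap) simp
  qed
  ultimately show ?thesis by simp
qed

lemma subspace_lincomb:
  fixes W :: "complex vec set" and k :: nat
  assumes W: "W \<subseteq> carrier_vec n" "\<And>v w. v \<in> W \<Longrightarrow> w \<in> W \<Longrightarrow> v + w \<in> W"
    "\<And>a v. v \<in> W \<Longrightarrow> a \<cdot>\<^sub>v v \<in> W"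
    and w: "w \<in> W" and e: "\<And>i. i < k \<Longrightarrow> e i \<in> W"
  shows "vec n (\<lambda>x. w $ x + (\<Sum>i<k. c i * e i $ x)) \<in> W"
  using e
proof (induction k)
  case 0
  have "vec n (\<lambda>x. w $ x + (\<Sum>i<0. c i * e i $ x)) = w"
    using w W(1) by (intro eq_vecI) auto
  then show ?case using w by simp
next
  case (Suc k)
  have ek: "e k \<in> W" using Suc.prems by simp
  then have "dim_vec (e k) = n" using W(1) by auto
  then have "vec n (\<lambda>x. w $ x + (\<Sum>i<Suc k. c i * e i $ x)) =
      vec n (\<lambda>x. w $ x + (\<Sum>i<k. c i * e i $ x)) + c k \<cdot>\<^sub>v e k"
    by (intro eq_vecI) auto
  then show ?case using Suc.IH Suc.prems W(2) W(3)[OF ek] by simp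
qed

text \<open>Take a longest orthonormal extension inside \<open>W\<close>, which exists because its
  length is at most \<open>n\<close>. If some vector of \<open>W\<close> were not given by its
  expansion, the normalised residual would lie in \<open>W\<close> and lengthen the family.\<close>

lemma orthonormal_extend:
  fixes W :: "complex vec set"
  assumes W: "W \<subseteq> carrier_vec n" "\<And>v w. v \<in> W \<Longrightarrow> w \<in> W \<Longrightarrow> v + w \<in> W"
    "\<And>a v. v \<in> W \<Longrightarrow> a \<cdot>\<^sub>v v \<in> W"
    and e: "orthonormal n k e" "\<And>i. i < k \<Longrightarrow> e i \<in> W"
  obtains k' e' where "k \<le> k'" "\<And>i. i < k \<Longrightarrow> e' i = e i" "orthonormal n k' e'"
    "\<And>i. i < k' \<Longrightarrow> e' i \<in> W"
    "\<And>w x. w \<in> W \<Longrightarrow> x < n \<Longrightarrow> w $ x = (\<Sum>i<k'. (w \<bullet>c e' i) * e' i $ x)"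
proof -
  define P where "P = (\<lambda>(k', e'). k \<le> k' \<and> (\<forall>i<k. e' i = e i) \<and> orthonormal n k' e' \<and>
    (\<forall>i<k'. e' i \<in> W))"
  have "P (k, e)" using e by (auto simp: P_def)
  moreover have "\<forall>y. P y \<longrightarrow> fst y < Suc n"
    using orthonormal_size by (auto simp: P_def less_Suc_eq_le)
  ultimately obtain y where y: "P y" "\<And>z. P z \<Longrightarrow> fst z \<le> fst y"
    using ex_has_greatest_nat[of P "(k, e)" fst "Suc n"] by blast
  obtain k' e' where ye: "y = (k', e')" by (cases y)
  have k': "k \<le> k'" "\<And>i. i < k \<Longrightarrow> e' i = e i" "orthonormal n k' e'" "\<And>i. i < k' \<Longrightarrow> e' i \<in> W"
    using y(1) by (auto simp: P_def ye)
  have "w $ x = (\<Sum>i<k'. (w \<bullet>c e' i) * e' i $ x)" if w: "w \<in> W" and x: "x < n" for w x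
  proof (rule ccontr)
    assume ne: "w $ x \<noteq> (\<Sum>i<k'. (w \<bullet>c e' i) * e' i $ x)"
    have c: "w \<bullet>c e' i = (\<Sum>x<n. w $ x * cnj (e' i $ x))" if "i < k'" for i
      using cscalar_prod_sum[of "e' i" n w] k'(4)[OF that] W(1) by auto
    define r where "r = vec n (\<lambda>x. w $ x - (\<Sum>i<k'. (w \<bullet>c e' i) * e' i $ x))"
    have rx: "r $ x = w $ x - (\<Sum>i<k'. (\<Sum>x<n. w $ x * cnj (e' i $ x)) * e' i $ x)" if "x < n" for x
      using that c by (simp add: r_def)
    have "r = vec n (\<lambda>x. w $ x + (\<Sum>i<k'. - (w \<bullet>c e' i) * e' i $ x))"
      unfolding r_def by (simp add: sum_negf)
    then have rW: "r \<in> W" using subspace_lincomb[where e = e' and k = k', OF W w k'(4)] by presburger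
    have orth: "r \<bullet>c e' j = 0" if j: "j < k'" for j
    proof -
      have "r \<bullet>c e' j = (\<Sum>x<n. r $ x * cnj (e' j $ x))"
        using cscalar_prod_sum[of "e' j" n r] k'(4)[OF j] W(1) by auto
      also have "\<dots> = (\<Sum>x<n. (w $ x - (\<Sum>i<k'. (\<Sum>x<n. w $ x * cnj (e' i $ x)) * e' i $ x)) * cnj (e' j $ x))"
        using rx by simp
      also have "\<dots> = 0"
        by (rule orthonormal_residual(1)) (use orthonormal_sum[OF k'(3)] j in auto)
      finally show ?thesis .
    qed
    have rc: "r \<in> carrier_vec n" by (simp add: r_def)
    have "r \<noteq> 0\<^sub>v n" using ne x by (auto simp: r_def vec_eq_iff)
    then have "r \<bullet>c r \<noteq> 0" "0 \<le> r \<bullet>c r"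
      using conjugate_square_eq_0_vec[OF rc] conjugate_square_ge_0_vec[of r] by auto
    then have pos: "0 < Re (r \<bullet>c r)" and re: "r \<bullet>c r = of_real (Re (r \<bullet>c r))"
      by (auto simp: less_eq_complex_def complex_eq_iff)
    define s where "s = complex_of_real (1 / sqrt (Re (r \<bullet>c r)))"
    have ss: "s * cnj s * (r \<bullet>c r) = 1"
      unfolding s_def by (subst re) (use pos in \<open>simp flip: of_real_mult\<close>)
    define e'' where "e'' = (\<lambda>i. if i = k' then s \<cdot>\<^sub>v r else e' i)"
    have ec: "e' i \<in> carrier_vec n" if "i < k'" for i using k'(4)[OF that] W(1) by auto
    have orth': "e' j \<bullet>c r = 0" if j: "j < k'" for j
    proof -
      have "e' j \<bullet>c r = cnj (r \<bullet>c e' j)"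
        using cscalar_prod_sum[OF rc, of "e' j"] cscalar_prod_sum[OF ec[OF j], of r]
        by (simp add: mult.commute)
      then show ?thesis using orth[OF j] by simp
    qed
    have "orthonormal n (Suc k') e''"
      unfolding orthonormal_def
    proof (intro conjI allI impI)
      fix i j assume i: "i < Suc k'" and j: "j < Suc k'"
      have *: "(s \<cdot>\<^sub>v r) \<bullet>c (s \<cdot>\<^sub>v r) = 1"
        using ss rc by (simp add: conjugate_smult_vec mult_ac)
      show "e'' i \<bullet>c e'' j = (if i = j then 1 else 0)"
        using i j * orth orth' k'(3) rc ec
        unfolding e''_def orthonormal_def
        by (auto simp: less_Suc_eq conjugate_smult_vec)
    qed (use k' rc W(1) in \<open>auto simp: e''_def orthonormal_def less_Suc_eq\<close>)
    then have "P (Suc k', e'')"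
      using k' rW W(3) by (auto simp: P_def e''_def less_Suc_eq)
    from y(2)[OF this] show False by (simp add: ye)
  qed
  then show ?thesis using that k' by blast
qed

section \<open>Equivalence of representations\<close>

lemma rep_equiv_refl:
  "(\<And>g. g \<in> carrier G \<Longrightarrow> U g \<in> carrier_mat n n) \<Longrightarrow> rep_equiv G (n, U) (n, U)"
  using unitary_mat_one[of n] by (auto intro!: exI[of _ "1\<^sub>m n"] simp: left_mult_one_mat[of _ n n] right_mult_one_mat[of _ n n])

lemma rep_equiv_sym:
  assumes U: "unitary_proj_rep G c n U" and V: "unitary_proj_rep G c k V"
    and eq: "rep_equiv G (n, U) (k, V)"
  shows "rep_equiv G (k, V) (n, U)"
proof -
  obtain T where T: "n = k" "unitary_mat n T" "\<And>g. g \<in> carrier G \<Longrightarrow> T * U g = V g * T"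
    using eq by auto
  have "mat_adjoint T * V g = U g * mat_adjoint T" if g: "g \<in> carrier G" for g
    using intertwiner_adjoint[OF _ _ _ T(3)[OF g]] T(1) unitary_proj_repD(1)[OF U g]
      unitary_proj_repD(1)[OF V g] unitary_matD(1)[OF T(2)] by blast
  then show ?thesis using T unitary_mat_adjoint[OF T(2)] by (auto intro!: exI[of _ "mat_adjoint T"])
qed

lemma rep_equiv_trans:
  assumes eq1: "rep_equiv G (n, U) (k, V)" and eq2: "rep_equiv G (k, V) (l, X)"
    and U: "\<And>g. g \<in> carrier G \<Longrightarrow> U g \<in> carrier_mat n n"
    and V: "\<And>g. g \<in> carrier G \<Longrightarrow> V g \<in> carrier_mat k k"
    and X: "\<And>g. g \<in> carrier G \<Longrightarrow> X g \<in> carrier_mat l l"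
  shows "rep_equiv G (n, U) (l, X)"
proof -
  obtain S where S: "n = k" "unitary_mat n S" "\<And>g. g \<in> carrier G \<Longrightarrow> S * U g = V g * S"
    using eq1 by auto
  obtain T where T: "k = l" "unitary_mat k T" "\<And>g. g \<in> carrier G \<Longrightarrow> T * V g = X g * T"
    using eq2 by auto
  note dims = S(1)[symmetric] T(1)[symmetric]
  have Sc: "S \<in> carrier_mat n n" and Tc: "T \<in> carrier_mat n n"
    using unitary_matD(1)[OF S(2)] unitary_matD(1)[OF T(2)] dims by auto
  have "T * S * U g = X g * (T * S)" if g: "g \<in> carrier G" for g
  proof -
    have c: "U g \<in> carrier_mat n n" "V g \<in> carrier_mat n n" "X g \<in> carrier_mat n n"
      using U[OF g] V[OF g] X[OF g] dims by auto
    show ?thesis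
      using assoc_mult_mat[OF Tc Sc c(1)] assoc_mult_mat[OF Tc c(2) Sc]
        assoc_mult_mat[OF c(3) Tc Sc] S(3)[OF g] T(3)[OF g] by simp
  qed
  moreover have "unitary_mat n (T * S)" using unitary_mat_mult S T by auto
  ultimately show ?thesis using S(1) T(1) by auto
qed

section \<open>Block-diagonal sums of operators and representations\<close>

definition block_diag :: "complex mat \<Rightarrow> complex mat \<Rightarrow> complex mat" where
  "block_diag A B = four_block_mat A (0\<^sub>m (dim_row A) (dim_col B)) (0\<^sub>m (dim_row B) (dim_col A)) B"

lemma block_diag_carrier [simp]:
  "A \<in> carrier_mat n n \<Longrightarrow> B \<in> carrier_mat k k \<Longrightarrow> block_diag A B \<in> carrier_mat (n + k) (n + k)"
  unfolding block_diag_def by simp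

lemma block_diag_mult:
  assumes "A \<in> carrier_mat n n" "A' \<in> carrier_mat n n" "B \<in> carrier_mat k k" "B' \<in> carrier_mat k k"
  shows "block_diag A B * block_diag A' B' = block_diag (A * A') (B * B')"
proof -
  have "block_diag A B * block_diag A' B' = four_block_mat (A * A' + 0\<^sub>m n k * 0\<^sub>m k n)
     (A * 0\<^sub>m n k + 0\<^sub>m n k * B') (0\<^sub>m k n * A' + B * 0\<^sub>m k n) (0\<^sub>m k n * 0\<^sub>m n k + B * B')"
    unfolding block_diag_def using assms mult_four_block_mat[of A n n "0\<^sub>m n k" k "0\<^sub>m k n" k B A' n "0\<^sub>m n k" k "0\<^sub>m k n" B']
    by auto
  then show ?thesis unfolding block_diag_def using assms by simp
qed

lemma block_diag_adjoint:
  assumes "A \<in> carrier_mat n n" "B \<in> carrier_mat k k"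
  shows "mat_adjoint (block_diag A B) = block_diag (mat_adjoint A) (mat_adjoint B)"
  by (rule eq_matI) (use assms in \<open>auto simp: block_diag_def\<close>)

lemma block_diag_one: "block_diag (1\<^sub>m n) (1\<^sub>m k) = 1\<^sub>m (n + k)"
  unfolding block_diag_def by simp

lemma block_diag_smult: "a \<cdot>\<^sub>m block_diag A B = block_diag (a \<cdot>\<^sub>m A) (a \<cdot>\<^sub>m B)"
  by (rule eq_matI) (auto simp: block_diag_def)

lemma block_diag_inject:
  assumes "A \<in> carrier_mat n n" "A' \<in> carrier_mat n n" "B \<in> carrier_mat k k" "B' \<in> carrier_mat k k"
    and eq: "block_diag A B = block_diag A' B'"
  shows "A = A'" "B = B'"
proof -
  have ent: "block_diag A B $$ (i, j) = block_diag A' B' $$ (i, j)" for i j using eq by simp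
  show "A = A'"
  proof (rule eq_matI)
    fix i j assume "i < dim_row A'" "j < dim_col A'"
    then show "A $$ (i, j) = A' $$ (i, j)"
      using ent[of i j] assms(1-4) by (auto simp: block_diag_def)
  qed (use assms in auto)
  show "B = B'"
  proof (rule eq_matI)
    fix i j assume "i < dim_row B'" "j < dim_col B'"
    then show "B $$ (i, j) = B' $$ (i, j)"
      using ent[of "n + i" "n + j"] assms(1-4) by (auto simp: block_diag_def)
  qed (use assms in auto)
qed

lemma block_diag_unitary:
  assumes A: "unitary_mat n A" and B: "unitary_mat k B"
  shows "unitary_mat (n + k) (block_diag A B)"
proof -
  note a = unitary_matD[OF A] and b = unitary_matD[OF B]
  show ?thesis
    unfolding unitary_mat_def block_diag_adjoint[OF a(1) b(1)]
    using block_diag_mult[OF a(1) mat_adjoint_carrier[OF a(1)] b(1) mat_adjoint_carrier[OF b(1)]]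
      block_diag_mult[OF mat_adjoint_carrier[OF a(1)] a(1) mat_adjoint_carrier[OF b(1)] b(1)]
      a b block_diag_one by auto
qed

lemma unitary_proj_rep_block_diagD:
  assumes rep: "unitary_proj_rep G c (n + k) (\<lambda>g. block_diag (A g) (B g))" and G: "group G"
    and A: "\<And>g. g \<in> carrier G \<Longrightarrow> A g \<in> carrier_mat n n"
    and B: "\<And>g. g \<in> carrier G \<Longrightarrow> B g \<in> carrier_mat k k"
  shows "unitary_proj_rep G c n A" "unitary_proj_rep G c k B"
proof -
  have u: "unitary_mat n (A g) \<and> unitary_mat k (B g)" if g: "g \<in> carrier G" for g
  proof -
    note ag = A[OF g] mat_adjoint_carrier[OF A[OF g]]
    note bg = B[OF g] mat_adjoint_carrier[OF B[OF g]]
    note h = unitary_matD[OF unitary_proj_repD(1)[OF rep g]]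
    have 1: "block_diag (A g * mat_adjoint (A g)) (B g * mat_adjoint (B g)) = block_diag (1\<^sub>m n) (1\<^sub>m k)"
      using h(2) block_diag_mult[OF ag bg] block_diag_adjoint[OF ag(1) bg(1)] block_diag_one by simp
    have 2: "block_diag (mat_adjoint (A g) * A g) (mat_adjoint (B g) * B g) = block_diag (1\<^sub>m n) (1\<^sub>m k)"
      using h(3) block_diag_mult[OF ag(2,1) bg(2,1)] block_diag_adjoint[OF ag(1) bg(1)] block_diag_one
      by simp
    show ?thesis
      unfolding unitary_mat_def using ag(1) bg(1)
        block_diag_inject[OF mult_carrier_mat[OF ag] one_carrier_mat mult_carrier_mat[OF bg] one_carrier_mat 1]
        block_diag_inject[OF mult_carrier_mat[OF ag(2,1)] one_carrier_mat mult_carrier_mat[OF bg(2,1)] one_carrier_mat 2]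
      by blast
  qed
  have m: "A g * A h = c g h \<cdot>\<^sub>m A (g \<otimes>\<^bsub>G\<^esub> h) \<and> B g * B h = c g h \<cdot>\<^sub>m B (g \<otimes>\<^bsub>G\<^esub> h)"
    if g: "g \<in> carrier G" and h: "h \<in> carrier G" for g h
  proof -
    have gh: "g \<otimes>\<^bsub>G\<^esub> h \<in> carrier G" using g h G by (simp add: group.is_monoid monoid.m_closed)
    have eq: "block_diag (A g * A h) (B g * B h) =
        block_diag (c g h \<cdot>\<^sub>m A (g \<otimes>\<^bsub>G\<^esub> h)) (c g h \<cdot>\<^sub>m B (g \<otimes>\<^bsub>G\<^esub> h))"
      using unitary_proj_repD(4)[OF rep g h] block_diag_mult[OF A[OF g] A[OF h] B[OF g] B[OF h]]
      by (simp add: block_diag_smult)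
    show ?thesis
      using block_diag_inject[OF mult_carrier_mat[OF A[OF g] A[OF h]] smult_carrier_mat[OF A[OF gh]]
          mult_carrier_mat[OF B[OF g] B[OF h]] smult_carrier_mat[OF B[OF gh]] eq] by blast
  qed
  show "unitary_proj_rep G c n A" "unitary_proj_rep G c k B"
    unfolding unitary_proj_rep_def using u m unitary_proj_repD(3)[OF rep] by blast+
qed

lemma rep_equiv_block_diag:
  assumes eq1: "rep_equiv G (n, A) (n', A')" and eq2: "rep_equiv G (k, B) (k', B')"
    and A: "\<And>g. g \<in> carrier G \<Longrightarrow> A g \<in> carrier_mat n n" "\<And>g. g \<in> carrier G \<Longrightarrow> A' g \<in> carrier_mat n' n'"
    and B: "\<And>g. g \<in> carrier G \<Longrightarrow> B g \<in> carrier_mat k k" "\<And>g. g \<in> carrier G \<Longrightarrow> B' g \<in> carrier_mat k' k'"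
  shows "rep_equiv G (n + k, \<lambda>g. block_diag (A g) (B g)) (n' + k', \<lambda>g. block_diag (A' g) (B' g))"
proof -
  obtain S where S: "n = n'" "unitary_mat n S" "\<And>g. g \<in> carrier G \<Longrightarrow> S * A g = A' g * S"
    using eq1 by auto
  obtain T where T: "k = k'" "unitary_mat k T" "\<And>g. g \<in> carrier G \<Longrightarrow> T * B g = B' g * T"
    using eq2 by auto
  have "block_diag S T * block_diag (A g) (B g) = block_diag (A' g) (B' g) * block_diag S T"
    if g: "g \<in> carrier G" for g
    using block_diag_mult[OF unitary_matD(1)[OF S(2)] A(1)[OF g] unitary_matD(1)[OF T(2)] B(1)[OF g]]
      block_diag_mult[OF A(2)[OF g] _ B(2)[OF g]] unitary_matD(1)[OF S(2)] unitary_matD(1)[OF T(2)]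
      S T g by simp
  then show ?thesis using S(1) T(1) block_diag_unitary[OF S(2) T(2)] by auto
qed

section \<open>Complete reducibility\<close>

lemma unitary_proj_rep_cong:
  assumes "group G" "\<And>g. g \<in> carrier G \<Longrightarrow> U g = V g" "unitary_proj_rep G c n U"
  shows "unitary_proj_rep G c n V"
proof -
  have "g \<otimes>\<^bsub>G\<^esub> h \<in> carrier G" if "g \<in> carrier G" "h \<in> carrier G" for g h
    using that assms(1) by (simp add: group.is_monoid monoid.m_closed)
  then show ?thesis using assms(2,3) unfolding unitary_proj_rep_def by simp
qed

lemma unitary_proj_rep_conjugate:
  assumes rep: "unitary_proj_rep G c n U" and E: "unitary_mat n E" and G: "group G"
  shows "unitary_proj_rep G c n (\<lambda>g. mat_adjoint E * U g * E)"
  unfolding unitary_proj_rep_def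
proof (intro conjI ballI)
  fix g assume g: "g \<in> carrier G"
  note U = unitary_proj_repD(1,2)[OF rep]
  note Ec = unitary_matD(1)[OF E] mat_adjoint_carrier[OF unitary_matD(1)[OF E]]
  show "unitary_mat n (mat_adjoint E * U g * E)"
    by (intro unitary_mat_mult unitary_mat_adjoint E U g)
  fix h assume h: "h \<in> carrier G"
  show "cmod (c g h) = 1" using unitary_proj_repD(3)[OF rep g h] .
  have gh: "g \<otimes>\<^bsub>G\<^esub> h \<in> carrier G" using g h G by (simp add: group.is_monoid monoid.m_closed)
  have UE: "mat_adjoint E * U g \<in> carrier_mat n n"
    by (rule mult_carrier_mat[OF Ec(2) U(2)[OF g]])
  have "mat_adjoint E * U g * E * (mat_adjoint E * U h * E)
      = mat_adjoint E * U g * E * (mat_adjoint E * (U h * E))"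
    using assoc_mult_mat[OF Ec(2) U(2)[OF h] Ec(1)] by simp
  also have "\<dots> = mat_adjoint E * U g * (E * mat_adjoint E) * (U h * E)"
    by (rule mult_mat_assoc4[OF UE Ec mult_carrier_mat[OF U(2)[OF h] Ec(1)]])
  also have "\<dots> = mat_adjoint E * U g * (U h * E)" unfolding unitary_matD(2)[OF E] right_mult_one_mat[OF UE] ..
  also have "\<dots> = mat_adjoint E * (U g * U h) * E"
    by (rule mult_mat_assoc4[OF Ec(2) U(2)[OF g] U(2)[OF h] Ec(1)])
  also have "\<dots> = c g h \<cdot>\<^sub>m (mat_adjoint E * U (g \<otimes>\<^bsub>G\<^esub> h) * E)"
    unfolding unitary_proj_repD(4)[OF rep g h]
    using mult_smult_distrib[OF Ec(2) U(2)[OF gh]]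
      mult_smult_assoc_mat[OF mult_carrier_mat[OF Ec(2) U(2)[OF gh]] Ec(1)] by simp
  finally show "mat_adjoint E * U g * E * (mat_adjoint E * U h * E) =
      c g h \<cdot>\<^sub>m (mat_adjoint E * U (g \<otimes>\<^bsub>G\<^esub> h) * E)" .
qed

text \<open>Cancel one factor in U_1 U_1 = c(1,1) U_1. A general factor set is not normalised, so
  this phase has to be carried along.\<close>

lemma unitary_proj_rep_one:
  assumes G: "group G" and rep: "unitary_proj_rep G c n U"
  shows "U \<one>\<^bsub>G\<^esub> = c \<one>\<^bsub>G\<^esub> \<one>\<^bsub>G\<^esub> \<cdot>\<^sub>m 1\<^sub>m n"
proof -
  interpret group G by fact
  note u = unitary_matD[OF unitary_proj_repD(1)[OF rep one_closed]]
  have sq: "U \<one>\<^bsub>G\<^esub> * U \<one>\<^bsub>G\<^esub> = c \<one>\<^bsub>G\<^esub> \<one>\<^bsub>G\<^esub> \<cdot>\<^sub>m U \<one>\<^bsub>G\<^esub>"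
    using unitary_proj_repD(4)[OF rep one_closed one_closed] by simp
  have "U \<one>\<^bsub>G\<^esub> = mat_adjoint (U \<one>\<^bsub>G\<^esub>) * (U \<one>\<^bsub>G\<^esub> * U \<one>\<^bsub>G\<^esub>)"
    using assoc_mult_mat[OF mat_adjoint_carrier[OF u(1)] u(1) u(1)] u by simp
  also have "\<dots> = c \<one>\<^bsub>G\<^esub> \<one>\<^bsub>G\<^esub> \<cdot>\<^sub>m 1\<^sub>m n"
    unfolding sq using mult_smult_distrib[OF mat_adjoint_carrier[OF u(1)] u(1)] u(3) by simp
  finally show ?thesis .
qed

text \<open>The product of U_g and U at the inverse of g is a phase times the identity. The
  consequence of interest is that adjoints preserve invariant subspaces too, so orthogonal
  complements are invariant.\<close>

lemma unitary_proj_rep_adjoint: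
  assumes G: "group G" and rep: "unitary_proj_rep G c n U" and g: "g \<in> carrier G"
  obtains a where "mat_adjoint (U g) = a \<cdot>\<^sub>m U (inv\<^bsub>G\<^esub> g)"
proof -
  interpret group G by fact
  define b where "b = c g (inv\<^bsub>G\<^esub> g) * c \<one>\<^bsub>G\<^esub> \<one>\<^bsub>G\<^esub>"
  have ig: "inv\<^bsub>G\<^esub> g \<in> carrier G" using g by simp
  note u = unitary_matD[OF unitary_proj_repD(1)[OF rep g]]
  note ui = unitary_proj_repD(2)[OF rep ig]
  have "cmod b = 1" unfolding b_def
    using unitary_proj_repD(3)[OF rep g ig] unitary_proj_repD(3)[OF rep one_closed one_closed]
    by (simp add: norm_mult)
  then have bb: "cnj b * b = 1" using complex_norm_square[of b] by (simp add: mult.commute)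
  have "U g * U (inv\<^bsub>G\<^esub> g) = b \<cdot>\<^sub>m 1\<^sub>m n"
    using unitary_proj_repD(4)[OF rep g ig] g unitary_proj_rep_one[OF G rep]
    by (simp add: b_def smult_smult_mat)
  then have "U (inv\<^bsub>G\<^esub> g) = mat_adjoint (U g) * (b \<cdot>\<^sub>m 1\<^sub>m n)"
    using assoc_mult_mat[OF mat_adjoint_carrier[OF u(1)] u(1) ui] u(3) ui by simp
  also have "\<dots> = b \<cdot>\<^sub>m mat_adjoint (U g)"
    using mult_smult_distrib[OF mat_adjoint_carrier[OF u(1)] one_carrier_mat, of b]
      right_mult_one_mat[OF mat_adjoint_carrier[OF u(1)]] by simp
  finally have "mat_adjoint (U g) = cnj b \<cdot>\<^sub>m U (inv\<^bsub>G\<^esub> g)"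
    using bb by (simp add: smult_smult_mat smult_one_mat)
  then show ?thesis using that by blast
qed

text \<open>An orthonormal basis of \<open>W\<close> is completed to one of the whole space. In that
  basis the operators are block-diagonal: the lower left block vanishes because \<open>W\<close> is
  invariant, the upper right one because \<open>W\<close> is invariant under the adjoints.\<close>

lemma invariant_subspace_split:
  assumes G: "group G" and rep: "unitary_proj_rep G c n U" and inv: "invariant_subspace G n U W"
    and W0: "W \<noteq> {0\<^sub>v n}" and W1: "W \<noteq> carrier_vec n"
  obtains k A B where "0 < k" "k < n" "unitary_proj_rep G c k A" "unitary_proj_rep G c (n - k) B"
    "rep_equiv G (n, U) (n, \<lambda>g. block_diag (A g) (B g))"
proof -
  interpret group G by fact
  note W = invariant_subspaceD[OF inv]
  \<comment> \<open>Extending the empty family inside \<open>W\<close> produces an orthonormal basis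
    of \<open>W\<close>; \<open>undefined\<close> stands for a family of length 0.\<close>
  obtain k e where k: "orthonormal n k e" "\<And>i. i < k \<Longrightarrow> e i \<in> W"
    "\<And>w x. w \<in> W \<Longrightarrow> x < n \<Longrightarrow> w $ x = (\<Sum>i<k. (w \<bullet>c e i) * e i $ x)"
    using orthonormal_extend[OF W(1,3,4), of 0 undefined] by (auto simp: orthonormal_def)
  have ecn: "e i \<in> carrier_vec n" if "i < k" for i using k(2)[OF that] W(1) by blast
  have smult_closed: "a \<cdot>\<^sub>v v \<in> carrier_vec n" if "v \<in> carrier_vec n" for a and v :: "complex vec"
    using that by simp
  have "\<exists>n' f. k \<le> n' \<and> (\<forall>i<k. f i = e i) \<and> orthonormal n n' f \<and>
      (\<forall>w\<in>carrier_vec n. \<forall>x<n. w $ x = (\<Sum>i<n'. (w \<bullet>c f i) * f i $ x))"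
  proof (rule orthonormal_extend[OF subset_refl add_carrier_vec smult_closed k(1) ecn])
    fix k' e'
    assume "k \<le> k'" "\<And>i. i < k \<Longrightarrow> e' i = e i" "orthonormal n k' e'"
      "\<And>w x. w \<in> carrier_vec n \<Longrightarrow> x < n \<Longrightarrow> w $ x = (\<Sum>i<k'. (w \<bullet>c e' i) * e' i $ x)"
    then show ?thesis by (intro exI[of _ k'] exI[of _ e']) blast
  qed
  then obtain n' f where f: "k \<le> n'" "\<And>i. i < k \<Longrightarrow> f i = e i" "orthonormal n n' f"
    and f_exp: "\<And>w x. w \<in> carrier_vec n \<Longrightarrow> x < n \<Longrightarrow> w $ x = (\<Sum>i<n'. (w \<bullet>c f i) * f i $ x)"
    by blast
  have fc: "f i \<in> carrier_vec n" if "i < n'" for i using f(3) that by (auto simp: orthonormal_def)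
  have exp: "(\<Sum>i<n'. f i $ x * cnj (f i $ x)) = 1" if x: "x < n" for x
  proof -
    have "1 = unit_vec n x $ x" using x by simp
    also have "\<dots> = (\<Sum>i<n'. (unit_vec n x \<bullet>c f i) * f i $ x)" using f_exp[OF unit_vec_carrier x] .
    also have "\<dots> = (\<Sum>i<n'. f i $ x * cnj (f i $ x))"
    proof (rule sum.cong[OF refl])
      fix i assume "i \<in> {..<n'}"
      then have i: "f i \<in> carrier_vec n" using fc by simp
      have "unit_vec n x \<bullet>c f i = cnj (f i $ x)"
        using scalar_prod_left_unit[of "conjugate (f i)" n x] i x by simp
      then show "(unit_vec n x \<bullet>c f i) * f i $ x = f i $ x * cnj (f i $ x)" by simp
    qed
    finally show ?thesis by simp
  qed
  \<comment> \<open>Summing the completeness relation over its diagonal counts \<open>n\<close>,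
    while summing the norms of the basis vectors counts \<open>n'\<close>.\<close>
  have "of_nat n = (\<Sum>x<n. \<Sum>i<n'. f i $ x * cnj (f i $ x))" using exp by simp
  also have "\<dots> = of_nat n'"
    using orthonormal_sum[OF f(3)] by (subst sum.swap) simp
  finally have n': "n' = n" using of_nat_eq_iff by metis
  have kn: "k \<le> n" using f(1) n' by simp
  define E where "E = mat n n (\<lambda>(x, i). f i $ x)"
  have Ec: "E \<in> carrier_mat n n" by (simp add: E_def)
  note Ea = mat_adjoint_carrier[OF Ec]
  have colE: "col E j = f j" if "j < n" for j
    using that fc[of j] n' by (intro eq_vecI) (auto simp: E_def)
  have "mat_adjoint E * E = 1\<^sub>m n"
  proof (rule eq_matI)
    fix i j assume "i < dim_row (1\<^sub>m n :: complex mat)" "j < dim_col (1\<^sub>m n :: complex mat)"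
    then have ij: "i < n" "j < n" by auto
    show "(mat_adjoint E * E) $$ (i, j) = 1\<^sub>m n $$ (i, j)"
      using index_mult_sum[OF Ea Ec ij] orthonormal_sum[OF f(3), of j i] ij n'
      by (auto simp: E_def mult.commute)
  qed (use Ec in auto)
  then have E: "unitary_mat n E"
    unfolding unitary_mat_def using Ec mat_mult_left_right_inverse[OF Ea Ec] by auto
  define U' where "U' = (\<lambda>g. mat_adjoint E * U g * E)"
  have rep': "unitary_proj_rep G c n U'"
    unfolding U'_def by (rule unitary_proj_rep_conjugate[OF rep E G])
  have ent: "U' g $$ (i, j) = (U g *\<^sub>v f j) \<bullet>c f i" if g: "g \<in> carrier G" and ij: "i < n" "j < n" for g i j
  proof -
    note Ug = unitary_proj_repD(2)[OF rep g]
    have "U' g $$ (i, j) = (\<Sum>x<n. mat_adjoint E $$ (i, x) * (U g * E) $$ (x, j))"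
      unfolding U'_def assoc_mult_mat[OF Ea Ug Ec]
      by (rule index_mult_sum[OF Ea mult_carrier_mat[OF Ug Ec] ij])
    also have "\<dots> = (\<Sum>x<n. (U g *\<^sub>v f j) $ x * cnj (f i $ x))"
      using Ec Ug ij colE[OF ij(2)] by (intro sum.cong) (auto simp: E_def mult.commute)
    also have "\<dots> = (U g *\<^sub>v f j) \<bullet>c f i"
      using cscalar_prod_sum[of "f i" n "U g *\<^sub>v f j"] fc n' ij by simp
    finally show ?thesis .
  qed
  have orthW: "w \<bullet>c f i = 0" if w: "w \<in> W" and i: "k \<le> i" "i < n" for w i
  proof -
    have "w \<bullet>c f i = (\<Sum>x<n. w $ x * cnj (f i $ x))"
      using cscalar_prod_sum[of "f i" n w] fc n' i by simp
    also have "\<dots> = (\<Sum>x<n. \<Sum>j<k. (w \<bullet>c e j) * (e j $ x * cnj (f i $ x)))"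
      using k(3)[OF w] by (simp add: sum_distrib_right mult.assoc)
    also have "\<dots> = (\<Sum>j<k. (w \<bullet>c e j) * (\<Sum>x<n. f j $ x * cnj (f i $ x)))"
      using f(2) by (subst sum.swap) (simp add: sum_distrib_left)
    also have "\<dots> = 0" using orthonormal_sum[OF f(3)] i n' by (intro sum.neutral) auto
    finally show ?thesis .
  qed
  have fW: "f j \<in> W" if "j < k" for j using k(2) f(2) that by simp
  have low: "U' g $$ (i, j) = 0" if g: "g \<in> carrier G" and "k \<le> i" "i < n" "j < k" for g i j
    using ent[OF g, of i j] orthW[OF W(5)[OF g fW]] that kn by simp
  \<comment> \<open>The entry is the conjugate of an inner product of the adjoint of
    \<open>U g\<close> applied to \<open>f i\<close>, which stays in \<open>W\<close>, with
    \<open>f j\<close>, which is orthogonal to \<open>W\<close>.\<close>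
  have up: "U' g $$ (i, j) = 0" if g: "g \<in> carrier G" and ij: "i < k" "k \<le> j" "j < n" for g i j
  proof -
    note Ug = unitary_proj_repD(2)[OF rep g]
    obtain a where a: "mat_adjoint (U g) = a \<cdot>\<^sub>m U (inv\<^bsub>G\<^esub> g)"
      using unitary_proj_rep_adjoint[OF G rep g] .
    have ig: "inv\<^bsub>G\<^esub> g \<in> carrier G" using g by simp
    have ji: "i < n" "j < n'" using ij n' by auto
    have "mat_adjoint (U g) *\<^sub>v f i = a \<cdot>\<^sub>v (U (inv\<^bsub>G\<^esub> g) *\<^sub>v f i)"
      unfolding a using unitary_proj_repD(2)[OF rep ig] fc[of i] ji n'
      by (intro eq_vecI) (auto simp: scalar_prod_def sum_distrib_left mult_ac)
    then have inW: "mat_adjoint (U g) *\<^sub>v f i \<in> W"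
      using W(4)[OF W(5)[OF ig fW[OF ij(1)]]] by simp
    have ac: "mat_adjoint (U g) *\<^sub>v f i \<in> carrier_vec n" using inW W(1) by blast
    have "U' g $$ (i, j) = f j \<bullet>c (mat_adjoint (U g) *\<^sub>v f i)"
      using ent[OF g, of i j] ij ji cscalar_prod_adjoint[OF Ug fc[OF ji(2)], of "f i"] fc n' by simp
    also have "\<dots> = cnj ((mat_adjoint (U g) *\<^sub>v f i) \<bullet>c f j)"
      using cscalar_prod_sum[OF ac, of "f j"] cscalar_prod_sum[OF fc[OF ji(2)], of "mat_adjoint (U g) *\<^sub>v f i"]
      by (simp add: mult.commute del: index_mult_mat_vec)
    also have "\<dots> = 0" using orthW[OF inW] ij by simp
    finally show ?thesis .
  qed
  define A where "A = (\<lambda>g. mat k k (\<lambda>(i, j). U' g $$ (i, j)))"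
  define B where "B = (\<lambda>g. mat (n - k) (n - k) (\<lambda>(i, j). U' g $$ (k + i, k + j)))"
  have AB: "block_diag (A g) (B g) = U' g" if g: "g \<in> carrier G" for g
    by (rule eq_matI) (use unitary_proj_repD(2)[OF rep' g] low[OF g] up[OF g] kn in
        \<open>auto simp: block_diag_def A_def B_def\<close>)
  have "unitary_proj_rep G c (k + (n - k)) (\<lambda>g. block_diag (A g) (B g))"
    using unitary_proj_rep_cong[OF G _ rep', of "\<lambda>g. block_diag (A g) (B g)"] AB kn by simp
  from unitary_proj_rep_block_diagD[OF this G]
  have reps: "unitary_proj_rep G c k A" "unitary_proj_rep G c (n - k) B"
    by (auto simp: A_def B_def)
  have "mat_adjoint E * U g = block_diag (A g) (B g) * mat_adjoint E" if g: "g \<in> carrier G" for g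
  proof -
    note Ug = unitary_proj_repD(2)[OF rep g]
    have "mat_adjoint E * U g * E * mat_adjoint E = mat_adjoint E * U g"
      using assoc_mult_mat[OF mult_carrier_mat[OF Ea Ug] Ec Ea] unitary_matD(2)[OF E]
        right_mult_one_mat[OF mult_carrier_mat[OF Ea Ug]] by simp
    then show ?thesis unfolding AB[OF g] U'_def by simp
  qed
  then have equiv: "rep_equiv G (n, U) (n, \<lambda>g. block_diag (A g) (B g))"
    using unitary_mat_adjoint[OF E] by auto
  have "k \<noteq> 0"
  proof
    assume "k = 0"
    then have "w = 0\<^sub>v n" if "w \<in> W" for w using k(3)[OF that] W(1) that by (intro eq_vecI) auto
    then show False using W0 W(2) by blast
  qed
  moreover have "k \<noteq> n"
  proof
    assume kn: "k = n"
    have "v \<in> W" if v: "v \<in> carrier_vec n" for v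
    proof -
      have v_eq: "v = vec n (\<lambda>x. 0\<^sub>v n $ x + (\<Sum>i<k. (v \<bullet>c f i) * f i $ x))"
        using f_exp[OF v] v kn n' by (intro eq_vecI) auto
      show ?thesis
        by (subst v_eq, rule subspace_lincomb) (use W fW in auto)
    qed
    then show False using W1 W(1) by blast
  qed
  ultimately show ?thesis using that[OF _ _ reps equiv] kn by simp
qed

section \<open>Direct sums and the existence of a decomposition\<close>

lemma direct_sum_Nil: "direct_sum [] = (0, \<lambda>g. 0\<^sub>m 0 0)"
  unfolding direct_sum_def by simp

lemma direct_sum_Cons:
  "direct_sum (r # rs) =
     (fst r + fst (direct_sum rs), \<lambda>g. block_diag (snd r g) (snd (direct_sum rs) g))"
  unfolding direct_sum_def block_diag_def by (simp add: Let_def)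

lemma direct_sum_append:
  "direct_sum (rs @ rs') = (fst (direct_sum rs) + fst (direct_sum rs'),
     \<lambda>g. block_diag (snd (direct_sum rs) g) (snd (direct_sum rs') g))"
  unfolding direct_sum_def block_diag_def by (simp add: Let_def diag_block_mat_append)

lemma direct_sum_singleton: "direct_sum [r] = r"
  unfolding direct_sum_def by (simp del: diag_block_mat.simps)

lemma irrepsD:
  assumes "r \<in> irreps G c"
  shows "irreducible_proj_rep G c (fst r) (snd r)" "unitary_proj_rep G c (fst r) (snd r)" "0 < fst r"
    "\<And>g. g \<in> carrier G \<Longrightarrow> snd r g \<in> carrier_mat (fst r) (fst r)"
  using assms irreducible_proj_repD[of G c "fst r" "snd r"] unitary_proj_repD(2)[of G c "fst r" "snd r"]
  unfolding irreps_def by (auto simp: case_prod_unfold)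

lemma direct_sum_carrier:
  assumes "set rs \<subseteq> irreps G c" "g \<in> carrier G"
  shows "snd (direct_sum rs) g \<in> carrier_mat (fst (direct_sum rs)) (fst (direct_sum rs))"
  using assms(1)
  by (induction rs) (use assms(2) irrepsD(4) in \<open>auto simp: direct_sum_Nil direct_sum_Cons
      intro!: block_diag_carrier\<close>)

text \<open>This permits replacing every constituent of a decomposition by the representative of its
  class.\<close>

lemma rep_equiv_direct_sum:
  assumes "list_all2 (rep_equiv G) rs rs'" "set rs \<subseteq> irreps G c" "set rs' \<subseteq> irreps G c"
  shows "rep_equiv G (direct_sum rs) (direct_sum rs')"
  using assms
proof (induction rule: list_all2_induct)
  case Nil
  then show ?case unfolding direct_sum_Nil by (intro rep_equiv_refl) auto
next
  case (Cons r rs r' rs')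
  have "rep_equiv G (fst r, snd r) (fst r', snd r')"
    "rep_equiv G (fst (direct_sum rs), snd (direct_sum rs)) (fst (direct_sum rs'), snd (direct_sum rs'))"
    using Cons by auto
  then show ?case unfolding direct_sum_Cons
    using Cons.prems irrepsD(4)[of r G c] irrepsD(4)[of r' G c] direct_sum_carrier[of rs G c] direct_sum_carrier[of rs' G c]
    by (intro rep_equiv_block_diag) auto
qed

text \<open>Strong induction on the dimension: a reducible representation splits into two blocks of
  smaller positive dimension, whose decompositions are concatenated. Existence makes the
  \<open>SOME\<close> in \<open>multiplicity_of\<close> denote an actual decomposition.\<close>

lemma decomposition_exists:
  assumes G: "group G" and "0 < n" "unitary_proj_rep G c n U"
  shows "\<exists>rs. decomposition G c (n, U) rs"
  using assms(2,3)
proof (induction n arbitrary: U rule: less_induct)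
  case (less n)
  note Uc = unitary_proj_repD(2)[OF less.prems(2)]
  show ?case
  proof (cases "irreducible_proj_rep G c n U")
    case True
    then have "decomposition G c (n, U) [(n, U)]"
      using rep_equiv_refl[of G U n] Uc
      unfolding decomposition_def direct_sum_singleton by (auto simp: irreps_def)
    then show ?thesis by blast
  next
    case False
    then obtain W where W: "invariant_subspace G n U W" "W \<noteq> {0\<^sub>v n}" "W \<noteq> carrier_vec n"
      using less.prems unfolding irreducible_proj_rep_def by blast
    obtain k A B where k: "0 < k" "k < n"
      and AB: "unitary_proj_rep G c k A" "unitary_proj_rep G c (n - k) B"
      and eq: "rep_equiv G (n, U) (n, \<lambda>g. block_diag (A g) (B g))"
      using invariant_subspace_split[OF G less.prems(2) W] .
    obtain rs where rs: "set rs \<subseteq> irreps G c" "rep_equiv G (k, A) (direct_sum rs)"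
      using less.IH[OF k(2) k(1) AB(1)] unfolding decomposition_def by blast
    obtain rs' where rs': "set rs' \<subseteq> irreps G c" "rep_equiv G (n - k, B) (direct_sum rs')"
      using less.IH[of "n - k", OF _ _ AB(2)] k unfolding decomposition_def by auto
    note cs = unitary_proj_repD(2)[OF AB(1)] direct_sum_carrier[OF rs(1)]
      unitary_proj_repD(2)[OF AB(2)] direct_sum_carrier[OF rs'(1)]
    have eq1: "rep_equiv G (k, A) (fst (direct_sum rs), snd (direct_sum rs))"
      and eq2: "rep_equiv G (n - k, B) (fst (direct_sum rs'), snd (direct_sum rs'))"
      using rs(2) rs'(2) by simp_all
    have "rep_equiv G (k + (n - k), \<lambda>g. block_diag (A g) (B g)) (direct_sum (rs @ rs'))"
      unfolding direct_sum_append
      by (rule rep_equiv_block_diag[OF eq1 eq2 cs])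
    then have eq': "rep_equiv G (n, \<lambda>g. block_diag (A g) (B g)) (fst (direct_sum (rs @ rs')), snd (direct_sum (rs @ rs')))"
      using k by simp
    have sub: "set (rs @ rs') \<subseteq> irreps G c" using rs rs' by simp
    have bc: "block_diag (A g) (B g) \<in> carrier_mat n n" if "g \<in> carrier G" for g
      using block_diag_carrier[OF cs(1)[OF that] cs(3)[OF that]] k by simp
    have "rep_equiv G (n, U) (fst (direct_sum (rs @ rs')), snd (direct_sum (rs @ rs')))"
      using rep_equiv_trans[OF eq eq' Uc bc direct_sum_carrier[OF sub]] .
    then have "decomposition G c (n, U) (rs @ rs')" using sub unfolding decomposition_def by simp
    then show ?thesis by blast
  qed
qed

section \<open>Classes of irreducible representations\<close>

lemma equiv_irrep_equiv_rel: "equiv (irreps G c) (irrep_equiv_rel G c)"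
proof (rule equivI)
  show "irrep_equiv_rel G c \<subseteq> irreps G c \<times> irreps G c" by (auto simp: irrep_equiv_rel_def)
  show "refl_on (irreps G c) (irrep_equiv_rel G c)"
  proof (rule refl_onI)
    fix r assume "r \<in> irreps G c"
    then show "(r, r) \<in> irrep_equiv_rel G c"
      using rep_equiv_refl[of G "snd r" "fst r"] irrepsD(4)[of r G c] by (simp add: irrep_equiv_rel_def)
  qed
  show "sym (irrep_equiv_rel G c)"
  proof (rule symI)
    fix r s assume "(r, s) \<in> irrep_equiv_rel G c"
    then show "(s, r) \<in> irrep_equiv_rel G c"
      using rep_equiv_sym[of G c "fst r" "snd r" "fst s" "snd s"] irrepsD(2)[of r G c] irrepsD(2)[of s G c]
      by (simp add: irrep_equiv_rel_def)
  qed
  show "trans (irrep_equiv_rel G c)"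
  proof (rule transI)
    fix r s t assume "(r, s) \<in> irrep_equiv_rel G c" "(s, t) \<in> irrep_equiv_rel G c"
    then show "(r, t) \<in> irrep_equiv_rel G c"
      using rep_equiv_trans[of G "fst r" "snd r" "fst s" "snd s" "fst t" "snd t"]
        irrepsD(4)[of r G c] irrepsD(4)[of s G c] irrepsD(4)[of t G c]
      by (simp add: irrep_equiv_rel_def)
  qed
qed

text \<open>Fixing one concrete matrix representation per class turns equivalence of constituents
  into equality, which is what the entrywise orthogonality relations can see.\<close>

definition class_rep :: "'g rep set \<Rightarrow> 'g rep" where
  "class_rep C = (SOME r. r \<in> C)"

lemma class_rep_in:
  assumes "C \<in> irrep_classes G c"
  shows "class_rep C \<in> C"
  using assms in_quotient_imp_non_empty[OF equiv_irrep_equiv_rel, of C G c]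
  unfolding class_rep_def irrep_classes_def by (auto intro: someI_ex)

lemma irrep_class_irreps: "C \<in> irrep_classes G c \<Longrightarrow> C \<subseteq> irreps G c"
  unfolding irrep_classes_def using in_quotient_imp_subset[OF equiv_irrep_equiv_rel] by blast

lemma irrep_class_equiv:
  assumes "C \<in> irrep_classes G c" "r \<in> C" "s \<in> C"
  shows "rep_equiv G r s"
  using assms in_quotient_imp_in_rel[OF equiv_irrep_equiv_rel, of C G c r s]
  unfolding irrep_classes_def by (auto simp: irrep_equiv_rel_def)

lemma irrep_class_eq:
  assumes "C \<in> irrep_classes G c" "D \<in> irrep_classes G c" "r \<in> C" "s \<in> D" "rep_equiv G r s"
  shows "C = D"
proof -
  have "(r, s) \<in> irrep_equiv_rel G c"
    using assms irrep_class_irreps[of C G c] irrep_class_irreps[of D G c]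
    by (auto simp: irrep_equiv_rel_def)
  then show ?thesis
    using assms quotient_eqI[OF equiv_irrep_equiv_rel, of C G c D r s] unfolding irrep_classes_def
    by blast
qed

text \<open>Equivalent representations have equal dimension, so the set under
  \<open>the_elem\<close> in \<open>class_dim\<close> is a singleton.\<close>

lemma class_dim_eq:
  assumes C: "C \<in> irrep_classes G c" and r: "r \<in> C"
  shows "class_dim C = fst r"
proof -
  have "fst s = fst r" if "s \<in> C" for s
    using irrep_class_equiv[OF C that r] by (cases s; cases r) simp
  then have "fst ` C = (\<lambda>_. fst r) ` C" by (intro image_cong refl)
  then have "fst ` C = {fst r}" using r by (simp only: image_constant)
  then show ?thesis by (simp add: class_dim_def)
qed

lemma inj_class_rep: "inj_on class_rep (irrep_classes G c)"
proof (rule inj_onI)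
  fix C D assume CD: "C \<in> irrep_classes G c" "D \<in> irrep_classes G c" "class_rep C = class_rep D"
  have "rep_equiv G (class_rep C) (class_rep D)"
    using irrep_class_equiv[OF CD(1) class_rep_in[OF CD(1)] class_rep_in[OF CD(1)]] CD(3) by simp
  then show "C = D" using irrep_class_eq CD class_rep_in by blast
qed

lemma class_rep_orthogonality:
  assumes G: "group G" and s: "s \<in> class_rep ` irrep_classes G c" and t: "t \<in> class_rep ` irrep_classes G c"
    and idx: "i < fst s" "a < fst s" "j < fst t" "b < fst t"
  shows "(\<Sum>g\<in>carrier G. snd s g $$ (i, a) * cnj (snd t g $$ (j, b))) =
    (if s = t \<and> i = j \<and> a = b then of_nat (card (carrier G)) / of_nat (fst s) else 0)"
proof -
  obtain C D where C: "C \<in> irrep_classes G c" "s = class_rep C" and D: "D \<in> irrep_classes G c" "t = class_rep D"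
    using s t by blast
  have sC: "s \<in> C" and tD: "t \<in> D" using class_rep_in C D by auto
  have irr: "irreducible_proj_rep G c (fst s) (snd s)" "irreducible_proj_rep G c (fst t) (snd t)"
    using irrepsD(1) sC tD irrep_class_irreps[OF C(1)] irrep_class_irreps[OF D(1)] by blast+
  show ?thesis
  proof (cases "s = t")
    case True
    then show ?thesis using schur_orthogonality_same[OF G irr(1)] idx by simp
  next
    case False
    then have "\<not> rep_equiv G t s" using irrep_class_eq[OF D(1) C(1) tD sC] C(2) D(2) by blast
    then show ?thesis using schur_orthogonality_inequivalent[OF G irr] idx False by simp
  qed
qed

text \<open>The normalised coefficients \<open>\<sigma>(g)\<^sub>0\<^sub>0\<close> of inequivalent irreducibles are orthonormal functions on
  \<open>G\<close>, and each has modulus at least \<open>1 / sqrt |G|\<close> at the identity.\<close>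

lemma finite_irrep_classes:
  fixes G :: "('g, 'b) monoid_scheme" and c :: "'g \<Rightarrow> 'g \<Rightarrow> complex"
  assumes G: "group G" and fin: "finite (carrier G)"
  shows "finite (irrep_classes G c)"
proof -
  interpret group G by fact
  let ?N = "real (card (carrier G))"
  have N: "0 < ?N" using fin one_closed card_gt_0_iff by fastforce
  have "card F \<le> card (carrier G)" if F: "F \<subseteq> class_rep ` irrep_classes G c" "finite F" for F
  proof -
    \<comment> \<open>By the orthogonality relations a coefficient of \<open>s\<close> has squared
      norm |G| / d, which fixes this normalising factor.\<close>
    define f where "f = (\<lambda>(s :: 'g rep) g. complex_of_real (sqrt (real (fst s) / ?N)) * snd s g $$ (0, 0))"
    have pos: "0 < fst s" and irr: "unitary_proj_rep G c (fst s) (snd s)" if "s \<in> F" for s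
      using that F class_rep_in[of _ G c] irrep_class_irreps[of _ G c] irrepsD(2,3)[of s G c] by blast+
    have sq: "complex_of_real (sqrt (real (fst s) / ?N)) * complex_of_real (sqrt (real (fst s) / ?N)) =
        of_nat (fst s) / of_nat (card (carrier G))" for s :: "'g rep"
    proof -
      have "sqrt (real (fst s) / ?N) * sqrt (real (fst s) / ?N) = real (fst s) / ?N" by simp
      then show ?thesis by (metis of_real_divide of_real_mult of_real_of_nat_eq)
    qed
    have "(\<Sum>g\<in>carrier G. f s g * cnj (f t g)) = (if s = t then 1 else 0)"
      if st: "s \<in> F" "t \<in> F" for s t
    proof -
      have "(\<Sum>g\<in>carrier G. f s g * cnj (f t g)) =
          complex_of_real (sqrt (real (fst s) / ?N)) * complex_of_real (sqrt (real (fst t) / ?N)) *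
          (\<Sum>g\<in>carrier G. snd s g $$ (0, 0) * cnj (snd t g $$ (0, 0)))"
        by (simp add: f_def sum_distrib_left mult_ac)
      also have "(\<Sum>g\<in>carrier G. snd s g $$ (0, 0) * cnj (snd t g $$ (0, 0))) =
          (if s = t then of_nat (card (carrier G)) / of_nat (fst s) else 0)"
        using class_rep_orthogonality[OF G subsetD[OF F(1) st(1)] subsetD[OF F(1) st(2)], of 0 0 0 0]
          pos[OF st(1)] pos[OF st(2)] by simp
      also have "complex_of_real (sqrt (real (fst s) / ?N)) * complex_of_real (sqrt (real (fst t) / ?N)) * \<dots>
          = (if s = t then 1 else 0)"
        using pos[OF st(1)] N sq[of s] by auto
      finally show ?thesis .
    qed
    \<comment> \<open>Bessel's inequality for the point mass at the identity: its coefficients are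
      the conjugated values \<open>f s\<close> at the identity, and their squares, each at least 1 /
      |G|, add up to at most 1. Hence \<open>F\<close> has at most |G| elements.\<close>
    from bessel_inequality[OF F(2) fin this, of "\<lambda>g. if g = \<one>\<^bsub>G\<^esub> then 1 else 0"]
    have "(\<Sum>s\<in>F. (cmod (\<Sum>g\<in>carrier G. (if g = \<one>\<^bsub>G\<^esub> then 1 else 0) * cnj (f s g)))\<^sup>2)
        \<le> (\<Sum>g\<in>carrier G. (cmod (if g = \<one>\<^bsub>G\<^esub> then 1 else 0))\<^sup>2)" .
    also have "\<dots> = (\<Sum>g\<in>carrier G. if g = \<one>\<^bsub>G\<^esub> then 1 else 0)" by (rule sum.cong) auto
    also have "\<dots> = 1" using fin by simp
    finally have le: "(\<Sum>s\<in>F. (cmod (\<Sum>g\<in>carrier G. (if g = \<one>\<^bsub>G\<^esub> then 1 else 0) * cnj (f s g)))\<^sup>2) \<le> 1" .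
    have "1 / ?N \<le> (cmod (\<Sum>g\<in>carrier G. (if g = \<one>\<^bsub>G\<^esub> then 1 else 0) * cnj (f s g)))\<^sup>2" if s: "s \<in> F" for s
    proof -
      have "(\<Sum>g\<in>carrier G. (if g = \<one>\<^bsub>G\<^esub> then 1 else 0) * cnj (f s g)) =
          (\<Sum>g\<in>carrier G. if g = \<one>\<^bsub>G\<^esub> then cnj (f s g) else 0)"
        by (rule sum.cong) auto
      also have "\<dots> = cnj (f s \<one>\<^bsub>G\<^esub>)" using fin by simp
      finally have eq: "(\<Sum>g\<in>carrier G. (if g = \<one>\<^bsub>G\<^esub> then 1 else 0) * cnj (f s g)) = cnj (f s \<one>\<^bsub>G\<^esub>)" .
      have "cmod (snd s \<one>\<^bsub>G\<^esub> $$ (0, 0)) = 1"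
        unfolding unitary_proj_rep_one[OF G irr[OF s]]
        using pos[OF s] unitary_proj_repD(3)[OF irr[OF s] one_closed one_closed] by simp
      then have "(cmod (cnj (f s \<one>\<^bsub>G\<^esub>)))\<^sup>2 = real (fst s) / ?N"
        by (simp add: f_def norm_mult)
      then show ?thesis unfolding eq using pos[OF s] N by (simp add: divide_right_mono)
    qed
    then have "(\<Sum>s\<in>F. 1 / ?N) \<le> 1" using le by (meson order_trans sum_mono)
    then show ?thesis using N by (simp add: divide_le_eq)
  qed
  then have "finite (class_rep ` irrep_classes G c)"
    using finite_if_finite_subsets_card_bdd by blast
  then show ?thesis using finite_imageD inj_class_rep by blast
qed

section \<open>Bases adapted to a decomposition\<close>

lemma sum_blocks:
  fixes f :: "nat \<Rightarrow> 'a :: comm_monoid_add"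
  shows "(\<Sum>x<sum_list ds. f x) =
    (\<Sum>j<length ds. \<Sum>a<ds ! j. f (sum_list (take j ds) + a))"
proof (induction ds arbitrary: f)
  case (Cons d ds)
  have "(\<Sum>x<d + sum_list ds. f x) = (\<Sum>x<d. f x) + (\<Sum>x<sum_list ds. f (d + x))"
    for d :: nat
  proof -
    have "(\<Sum>x<d + m. f x) = (\<Sum>x<d. f x) + (\<Sum>x<m. f (d + x))" for m
      by (induction m) (auto simp: add.assoc)
    then show ?thesis .
  qed
  then show ?case
    using Cons.IH[of "\<lambda>x. f (d + x)"] by (simp add: sum.lessThan_Suc_shift add.assoc del: sum.lessThan_Suc)
qed simp

lemma block_index_less:
  "j < length ds \<Longrightarrow> a < ds ! j \<Longrightarrow> sum_list (take j ds) + a < (sum_list ds :: nat)"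
proof (induction ds arbitrary: j)
  case (Cons d ds)
  then show ?case by (cases j) (auto simp: add.assoc)
qed simp

text \<open>The partial sum of block sizes is the offset of a block. The case distinction on both
  block numbers peels off the first block, in step with the recursion of
  \<open>diag_block_mat\<close>.\<close>

lemma index_diag_block_mat:
  assumes "\<And>A. A \<in> set As \<Longrightarrow> dim_row A = dim_col A" "j < length As" "k < length As"
    "a < dim_row (As ! j)" "b < dim_row (As ! k)"
  shows "diag_block_mat As $$ (sum_list (take j (map dim_row As)) + a, sum_list (take k (map dim_row As)) + b)
    = (if j = k then As ! j $$ (a, b) else 0)"
  using assms
proof (induction As arbitrary: j k)
  case (Cons A As)
  let ?d = "dim_row A" and ?ds = "map dim_row As"
  let ?off = "\<lambda>i. sum_list (take i ?ds)"
  have "map dim_col As = ?ds" using Cons.prems(1) by simp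
  then have dims: "dim_col A = ?d" "dim_row (diag_block_mat As) = sum_list ?ds"
    "dim_col (diag_block_mat As) = sum_list ?ds"
    using Cons.prems(1)[of A] by (simp_all only: dim_diag_block_mat) simp
  have bnd: "?off i + x < sum_list ?ds" if "i < length As" "x < dim_row (As ! i)" for i x
    using block_index_less[of i ?ds x] that by simp
  have ent: "diag_block_mat (A # As) $$ (x, y) =
      (if x < ?d then (if y < ?d then A $$ (x, y) else 0)
       else (if y < ?d then 0 else diag_block_mat As $$ (x - ?d, y - ?d)))"
    if "x < ?d + sum_list ?ds" "y < ?d + sum_list ?ds" for x y
    using that dims by (simp add: Let_def)
  show ?case
  proof (cases j)
    case 0
    show ?thesis
    proof (cases k)
      case 0
      then show ?thesis using \<open>j = 0\<close> Cons.prems(4,5) by (subst ent) auto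
    next
      case (Suc k')
      then show ?thesis using \<open>j = 0\<close> Cons.prems(3-5) bnd[of k' b] by (subst ent) auto
    qed
  next
    case (Suc j')
    show ?thesis
    proof (cases k)
      case 0
      then show ?thesis using \<open>j = Suc j'\<close> Cons.prems(2-5) bnd[of j' a] by (subst ent) auto
    next
      case (Suc k')
      have "diag_block_mat As $$ (?off j' + a, ?off k' + b) = (if j' = k' then As ! j' $$ (a, b) else 0)"
        using Cons.prems \<open>j = Suc j'\<close> Suc by (intro Cons.IH) auto
      then show ?thesis
        using \<open>j = Suc j'\<close> Suc Cons.prems(2-5) bnd[of j' a] bnd[of k' b]
        by (subst ent) (auto simp: add.assoc)
    qed
  qed
qed simp

text \<open>All that the optimisation takes from representation theory. \<open>q j\<close> is the
  representative of constituent \<open>j\<close>, and \<open>e j a x\<close> is coordinate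
  \<open>x\<close> of its basis vector number \<open>a\<close>. By \<open>basis_action\<close>,
  constituents of one class transform by identical matrices. \<open>Q\<close> may also contain
  classes of multiplicity zero.\<close>

locale adapted_basis =
  fixes G :: "('g, 'b) monoid_scheme" and c :: "'g \<Rightarrow> 'g \<Rightarrow> complex" and n :: nat
    and U :: "'g \<Rightarrow> complex mat" and Q :: "'g rep set" and l :: nat and q :: "nat \<Rightarrow> 'g rep"
    and e :: "nat \<Rightarrow> nat \<Rightarrow> nat \<Rightarrow> complex"
  assumes G: "group G" and finite_G: "finite (carrier G)" and n_pos: "0 < n"
    and rep: "unitary_proj_rep G c n U"
    and finite_Q: "finite Q" and dim_pos: "\<And>s. s \<in> Q \<Longrightarrow> 0 < fst s"
    and q_in: "\<And>j. j < l \<Longrightarrow> q j \<in> Q"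
    and orthogonality: "\<And>s t i a j b. s \<in> Q \<Longrightarrow> t \<in> Q \<Longrightarrow> i < fst s \<Longrightarrow> a < fst s \<Longrightarrow> j < fst t \<Longrightarrow> b < fst t \<Longrightarrow>
      (\<Sum>g\<in>carrier G. snd s g $$ (i, a) * cnj (snd t g $$ (j, b))) =
      (if s = t \<and> i = j \<and> a = b then of_nat (card (carrier G)) / of_nat (fst s) else 0)"
    and basis_orthonormal: "\<And>j a k b. j < l \<Longrightarrow> a < fst (q j) \<Longrightarrow> k < l \<Longrightarrow> b < fst (q k) \<Longrightarrow>
      (\<Sum>x<n. e j a x * cnj (e k b x)) = (if j = k \<and> a = b then 1 else 0)"
    and basis_complete: "\<And>x y. x < n \<Longrightarrow> y < n \<Longrightarrow>
      (\<Sum>j<l. \<Sum>a<fst (q j). e j a x * cnj (e j a y)) = (if x = y then 1 else 0)"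
    and basis_action: "\<And>g j b x. g \<in> carrier G \<Longrightarrow> j < l \<Longrightarrow> b < fst (q j) \<Longrightarrow> x < n \<Longrightarrow>
      (\<Sum>y<n. U g $$ (x, y) * e j b y) = (\<Sum>a<fst (q j). snd (q j) g $$ (a, b) * e j a x)"

text \<open>A unitary equivalence with the direct sum of the representatives supplies the basis, and
  the decomposition it starts from is the very one selected by \<open>SOME\<close> in
  \<open>multiplicity_of\<close>, so \<open>kappa\<close> can be read off by counting.\<close>

lemma adapted_basis_exists:
  assumes G: "group G" and fin: "finite (carrier G)" and n: "0 < n" and rep: "unitary_proj_rep G c n U"
  shows "\<exists>Q l q e. adapted_basis G c n U Q l q e \<and>
    kappa G c n U = (\<Sum>s\<in>Q. real (min (card {j. j < l \<and> q j = s}) (fst s) * fst s) / real (card (carrier G)))"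
proof -
  define Q where "Q = class_rep ` irrep_classes G c"
  define rs where "rs = (SOME rs. decomposition G c (n, U) rs)"
  have dec: "decomposition G c (n, U) rs"
    unfolding rs_def using decomposition_exists[OF G n rep] by (rule someI_ex)
  then have rs: "set rs \<subseteq> irreps G c" and eq: "rep_equiv G (n, U) (direct_sum rs)"
    unfolding decomposition_def by auto
  define cls where "cls = (\<lambda>r. irrep_equiv_rel G c `` {r})"
  define l where "l = length rs"
  define rs' where "rs' = map (\<lambda>r. class_rep (cls r)) rs"
  have cls: "cls r \<in> irrep_classes G c" "r \<in> cls r" if "r \<in> irreps G c" for r
    using that equiv_class_self[OF equiv_irrep_equiv_rel that] unfolding cls_def irrep_classes_def
    by (auto intro: quotientI)
  have l': "length rs' = l" by (simp add: rs'_def l_def)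
  have rsj: "rs ! j \<in> irreps G c" if "j < l" for j using that rs nth_mem l_def by blast
  have rs'j: "rs' ! j = class_rep (cls (rs ! j))" if "j < l" for j using that by (simp add: rs'_def l_def)
  have inQ: "rs' ! j \<in> Q" if "j < l" for j
    unfolding Q_def rs'j[OF that] using cls(1)[OF rsj[OF that]] by blast
  have Qirr: "s \<in> irreps G c" if "s \<in> Q" for s
    using that class_rep_in[of _ G c] irrep_class_irreps[of _ G c] unfolding Q_def by blast
  have rs': "set rs' \<subseteq> irreps G c"
    using inQ Qirr l' by (metis in_set_conv_nth subsetI)
  \<comment> \<open>Passing to representatives keeps the class of each constituent, so a
    multiplicity becomes the number of positions at which \<open>rs'\<close> has a given
    value.\<close>
  have mem: "rs ! j \<in> C \<longleftrightarrow> rs' ! j = class_rep C" if j: "j < l" and C: "C \<in> irrep_classes G c" for j C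
  proof -
    note cj = cls[OF rsj[OF j]]
    have "rs ! j \<in> C \<longleftrightarrow> cls (rs ! j) = C"
      using cj C irrep_class_eq[OF cj(1) C cj(2)] irrep_class_equiv[OF C] by blast
    also have "\<dots> \<longleftrightarrow> rs' ! j = class_rep C"
      unfolding rs'j[OF j] using inj_class_rep[of G c] cj(1) C by (auto dest: inj_onD)
    finally show ?thesis .
  qed
  have "list_all2 (rep_equiv G) rs rs'"
    unfolding list_all2_conv_all_nth
  proof (intro conjI allI impI)
    fix j assume "j < length rs"
    then have j: "j < l" by (simp add: l_def)
    show "rep_equiv G (rs ! j) (rs' ! j)"
      unfolding rs'j[OF j] using cls[OF rsj[OF j]] class_rep_in irrep_class_equiv by blast
  qed (simp add: rs'_def)
  then have eq2: "rep_equiv G (direct_sum rs) (direct_sum rs')"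
    using rs rs' by (rule rep_equiv_direct_sum)
  have "rep_equiv G (n, U) (fst (direct_sum rs'), snd (direct_sum rs'))"
    using rep_equiv_trans[of G n U "fst (direct_sum rs)" "snd (direct_sum rs)"
        "fst (direct_sum rs')" "snd (direct_sum rs')"] eq eq2 unitary_proj_repD(2)[OF rep]
      direct_sum_carrier[OF rs] direct_sum_carrier[OF rs'] by simp
  from this[unfolded rep_equiv.simps] obtain T where N: "n = fst (direct_sum rs')" and T: "unitary_mat n T"
    and TU: "\<And>g. g \<in> carrier G \<Longrightarrow> T * U g = snd (direct_sum rs') g * T" by auto
  define ds where "ds = map fst rs'"
  have lds: "length ds = l" by (simp add: ds_def l')
  have dsj: "ds ! j = fst (rs' ! j)" if "j < l" for j using that l' by (simp add: ds_def)
  have Nds: "sum_list ds = n" unfolding N by (simp add: ds_def direct_sum_def)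
  define off where "off = (\<lambda>j. sum_list (take j ds))"
  have off: "off j + a < n" if "j < l" "a < fst (rs' ! j)" for j a
    using block_index_less[of j ds a] that dsj lds Nds by (simp add: off_def)
  have sum_off: "(\<Sum>x<n. f x) = (\<Sum>j<l. \<Sum>a<fst (rs' ! j). f (off j + a))" for f :: "nat \<Rightarrow> complex"
    using sum_blocks[of f ds] lds Nds dsj by (simp add: off_def)
  have entry: "snd (direct_sum rs') g $$ (off j + a, off k + b) = (if j = k then snd (rs' ! j) g $$ (a, b) else 0)"
    if g: "g \<in> carrier G" and "j < l" "a < fst (rs' ! j)" "k < l" "b < fst (rs' ! k)" for g j a k b
  proof -
    have car: "snd r g \<in> carrier_mat (fst r) (fst r)" if "r \<in> set rs'" for r
      using irrepsD(4)[OF _ g] rs' that by blast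
    have dims: "map dim_row (map (\<lambda>r. snd r g) rs') = ds" using car by (auto simp: ds_def)
    have dimr: "dim_row (snd r g) = dim_col (snd r g)" if "r \<in> set rs'" for r
      using car[OF that] by simp
    have dimi: "dim_row (snd (rs' ! i) g) = fst (rs' ! i)" if "i < l" for i
      using car[of "rs' ! i"] that l' by simp
    have "diag_block_mat (map (\<lambda>r. snd r g) rs') $$ (off j + a, off k + b) =
        (if j = k then map (\<lambda>r. snd r g) rs' ! j $$ (a, b) else 0)"
      unfolding off_def dims[symmetric]
      by (rule index_diag_block_mat) (use that l' dimr dimi in auto)
    then show ?thesis using that l' by (simp add: direct_sum_def)
  qed
  \<comment> \<open>Uniqueness of block positions is read off from the identity matrix: assembled
    from identity blocks, its entry at these two positions is 1 exactly when the block and the place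
    inside it agree.\<close>
  have delta: "off j + a = off k + b \<longleftrightarrow> j = k \<and> a = b"
    if ja: "j < l" "a < fst (rs' ! j)" and kb: "k < l" "b < fst (rs' ! k)" for j a k b
  proof -
    let ?As = "map (\<lambda>A. 1\<^sub>m (dim_row A) :: complex mat) (map (\<lambda>d. 1\<^sub>m d :: complex mat) ds)"
    have dims: "map dim_row ?As = ds" by (simp add: comp_def)
    have one: "diag_block_mat ?As = 1\<^sub>m n"
      unfolding diag_block_one_mat using Nds by (simp add: comp_def)
    have "diag_block_mat ?As $$ (sum_list (take j (map dim_row ?As)) + a, sum_list (take k (map dim_row ?As)) + b)
        = (if j = k then ?As ! j $$ (a, b) else 0)"
      by (rule index_diag_block_mat) (use that lds dsj in auto)
    then have "diag_block_mat ?As $$ (off j + a, off k + b) = (if j = k then ?As ! j $$ (a, b) else 0)"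
      unfolding dims off_def .
    then show ?thesis unfolding one
      using that off[OF ja] off[OF kb] lds dsj by (auto split: if_splits)
  qed
  note Tm = unitary_matD[OF T]
  note Ta = mat_adjoint_carrier[OF Tm(1)]
  \<comment> \<open>From T U = D T with T unitary, U acts on the columns of the adjoint of T through
    D. The basis therefore consists of these columns, the conjugated rows of \<open>T\<close>, cut
    at the block offsets.\<close>
  define e where "e = (\<lambda>j a x. cnj (T $$ (off j + a, x)))"
  have finQ: "finite Q" unfolding Q_def using finite_irrep_classes[OF G fin] by simp
  have ab: "adapted_basis G c n U Q l (\<lambda>j. rs' ! j) e"
  proof (rule adapted_basis.intro)
    show "group G" "finite (carrier G)" "0 < n" "unitary_proj_rep G c n U" "finite Q"
      by fact+
    show "0 < fst s" if "s \<in> Q" for s using irrepsD(3)[OF Qirr[OF that]] .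
    show "rs' ! j \<in> Q" if "j < l" for j using inQ[OF that] .
    show "(\<Sum>g\<in>carrier G. snd s g $$ (i, a) * cnj (snd t g $$ (j, b))) =
      (if s = t \<and> i = j \<and> a = b then of_nat (card (carrier G)) / of_nat (fst s) else 0)"
      if "s \<in> Q" "t \<in> Q" "i < fst s" "a < fst s" "j < fst t" "b < fst t" for s t i a j b
      using class_rep_orthogonality[OF G, of s c t] that unfolding Q_def by blast
    show "(\<Sum>x<n. e j a x * cnj (e k b x)) = (if j = k \<and> a = b then 1 else 0)"
      if ja: "j < l" "a < fst (rs' ! j)" and kb: "k < l" "b < fst (rs' ! k)" for j a k b
    proof -
      have "(T * mat_adjoint T) $$ (off k + b, off j + a) = (if k = j \<and> b = a then 1 else 0)"
        unfolding Tm(2) using off[OF ja] off[OF kb] delta[OF kb ja] by simp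
      then show ?thesis
        using index_mult_sum[OF Tm(1) Ta off[OF kb] off[OF ja]] off[OF ja] Tm(1)
        by (auto simp: e_def mult.commute)
    qed
    show "(\<Sum>j<l. \<Sum>a<fst (rs' ! j). e j a x * cnj (e j a y)) = (if x = y then 1 else 0)"
      if xy: "x < n" "y < n" for x y
    proof -
      have "(mat_adjoint T * T) $$ (x, y) = (\<Sum>z<n. cnj (T $$ (z, x)) * T $$ (z, y))"
        using index_mult_sum[OF Ta Tm(1) xy] Tm(1) xy by simp
      also have "\<dots> = (\<Sum>j<l. \<Sum>a<fst (rs' ! j). e j a x * cnj (e j a y))"
        unfolding sum_off by (simp add: e_def)
      finally show ?thesis unfolding Tm(3) using xy by simp
    qed
    show "(\<Sum>y<n. U g $$ (x, y) * e j b y) = (\<Sum>a<fst (rs' ! j). snd (rs' ! j) g $$ (a, b) * e j a x)"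
      if g: "g \<in> carrier G" and jb: "j < l" "b < fst (rs' ! j)" and x: "x < n" for g j b x
    proof -
      define D where "D = snd (direct_sum rs') g"
      have D: "D \<in> carrier_mat n n" unfolding D_def N using direct_sum_carrier[OF rs' g] by simp
      note Ug = unitary_proj_repD(2)[OF rep g]
      have "U g * mat_adjoint T = mat_adjoint T * T * (U g * mat_adjoint T)"
        unfolding Tm(3) by (rule left_mult_one_mat[OF mult_carrier_mat[OF Ug Ta], symmetric])
      also have "\<dots> = mat_adjoint T * (T * U g) * mat_adjoint T"
        by (rule mult_mat_assoc4[OF Ta Tm(1) Ug Ta])
      also have "\<dots> = mat_adjoint T * D * (T * mat_adjoint T)"
        unfolding TU[OF g] D_def[symmetric] by (rule mult_mat_assoc4[OF Ta D Tm(1) Ta, symmetric])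
      also have "\<dots> = mat_adjoint T * D"
        unfolding Tm(2) by (rule right_mult_one_mat[OF mult_carrier_mat[OF Ta D]])
      finally have eq: "U g * mat_adjoint T = mat_adjoint T * D" .
      have "(\<Sum>y<n. U g $$ (x, y) * e j b y) = (U g * mat_adjoint T) $$ (x, off j + b)"
        using index_mult_sum[OF Ug Ta x off[OF jb]] off[OF jb] Tm(1) by (simp add: e_def)
      also have "\<dots> = (\<Sum>z<n. mat_adjoint T $$ (x, z) * D $$ (z, off j + b))"
        unfolding eq by (rule index_mult_sum[OF Ta D x off[OF jb]])
      also have "\<dots> = (\<Sum>k<l. \<Sum>a<fst (rs' ! k). if k = j then snd (rs' ! j) g $$ (a, b) * e j a x else 0)"
        unfolding sum_off
      proof (intro sum.cong refl)
        fix k a assume "k \<in> {..<l}" "a \<in> {..<fst (rs' ! k)}"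
        then have ka: "k < l" "a < fst (rs' ! k)" by auto
        show "mat_adjoint T $$ (x, off k + a) * D $$ (off k + a, off j + b) =
          (if k = j then snd (rs' ! j) g $$ (a, b) * e j a x else 0)"
          unfolding D_def entry[OF g ka jb] using off[OF ka] x Tm(1) by (simp add: e_def)
      qed
      also have "\<dots> = (\<Sum>k<l. if k = j then (\<Sum>a<fst (rs' ! j). snd (rs' ! j) g $$ (a, b) * e j a x) else 0)"
        by (rule sum.cong) auto
      finally show ?thesis using jb by simp
    qed
  qed
  have "kappa G c n U = (\<Sum>C\<in>irrep_classes G c.
      real (min (card {j. j < l \<and> rs' ! j = class_rep C}) (fst (class_rep C)) * fst (class_rep C)) / real (card (carrier G)))"
    unfolding kappa_def
  proof (rule sum.cong[OF refl])
    fix C assume C: "C \<in> irrep_classes G c"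
    have "multiplicity_of G c (n, U) C = card {j. j < l \<and> rs' ! j = class_rep C}"
      unfolding multiplicity_of_def rs_def[symmetric] length_filter_conv_card
      using mem[OF _ C] by (auto simp: l_def intro: arg_cong[where f = card])
    then show "real (min (multiplicity_of G c (n, U) C) (class_dim C) * class_dim C) / real (card (carrier G)) =
      real (min (card {j. j < l \<and> rs' ! j = class_rep C}) (fst (class_rep C)) * fst (class_rep C)) / real (card (carrier G))"
      using class_dim_eq[OF C class_rep_in[OF C]] by simp
  qed
  also have "\<dots> = (\<Sum>s\<in>Q. real (min (card {j. j < l \<and> rs' ! j = s}) (fst s) * fst s) / real (card (carrier G)))"
    unfolding Q_def by (simp add: sum.reindex[OF inj_class_rep])
  finally show ?thesis using ab by blast
qed

section \<open>The upper bound\<close>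

text \<open>Two coefficient families are allowed because the frame identity of the optimal strategy
  pairs two different coordinates; equal families give the norm identity for amplitudes.\<close>

lemma parseval_sesquilinear:
  fixes F :: "'k \<Rightarrow> 'x \<Rightarrow> complex"
  assumes K: "finite K"
    and orth: "\<And>k k'. k \<in> K \<Longrightarrow> k' \<in> K \<Longrightarrow>
      (\<Sum>x\<in>X. F k x * cnj (F k' x)) = (if k = k' then w k else 0)"
  shows "(\<Sum>x\<in>X. (\<Sum>k\<in>K. a k * F k x) * cnj (\<Sum>k\<in>K. b k * F k x)) =
    (\<Sum>k\<in>K. w k * (a k * cnj (b k)))"
proof -
  have "(\<Sum>x\<in>X. (\<Sum>k\<in>K. a k * F k x) * cnj (\<Sum>k\<in>K. b k * F k x)) =
      (\<Sum>x\<in>X. \<Sum>k\<in>K. \<Sum>k'\<in>K. a k * cnj (b k') * (F k x * cnj (F k' x)))"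
    by (simp add: sum_product mult_ac)
  also have "\<dots> = (\<Sum>k\<in>K. \<Sum>k'\<in>K. \<Sum>x\<in>X. a k * cnj (b k') * (F k x * cnj (F k' x)))"
    by (subst sum.swap) (intro sum.cong refl sum.swap)
  also have "\<dots> = (\<Sum>k\<in>K. \<Sum>k'\<in>K. if k' = k then w k * (a k * cnj (b k)) else 0)"
    by (intro sum.cong refl) (simp add: sum_distrib_left[symmetric] orth mult_ac)
  finally show ?thesis using K by simp
qed

lemma parseval_orthogonal:
  fixes F :: "'k \<Rightarrow> 'x \<Rightarrow> complex"
  assumes "finite K"
    and "\<And>k k'. k \<in> K \<Longrightarrow> k' \<in> K \<Longrightarrow>
      (\<Sum>x\<in>X. F k x * cnj (F k' x)) = (if k = k' then of_real (w k) else 0)"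
  shows "(\<Sum>x\<in>X. (cmod (\<Sum>k\<in>K. a k * F k x))\<^sup>2) = (\<Sum>k\<in>K. w k * (cmod (a k))\<^sup>2)"
proof -
  have "complex_of_real (\<Sum>x\<in>X. (cmod (\<Sum>k\<in>K. a k * F k x))\<^sup>2) =
      (\<Sum>x\<in>X. (\<Sum>k\<in>K. a k * F k x) * cnj (\<Sum>k\<in>K. a k * F k x))"
    by (simp only: of_real_sum complex_norm_square)
  also have "\<dots> = (\<Sum>k\<in>K. of_real (w k) * (a k * cnj (a k)))"
    by (rule parseval_sesquilinear[OF assms])
  also have "\<dots> = complex_of_real (\<Sum>k\<in>K. w k * (cmod (a k))\<^sup>2)"
    by (simp only: of_real_sum of_real_mult complex_norm_square)
  finally show ?thesis using of_real_eq_iff by blast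
qed

lemma cmod_sum_squared_le:
  "(cmod (\<Sum>i\<in>I. t i))\<^sup>2 \<le> real (card I) * (\<Sum>i\<in>I. (cmod (t i))\<^sup>2)"
proof -
  have "(cmod (\<Sum>i\<in>I. t i))\<^sup>2 \<le> (\<Sum>i\<in>I. 1 * cmod (t i))\<^sup>2"
    by (intro power_mono) (simp_all add: norm_sum)
  also have "\<dots> \<le> (\<Sum>i\<in>I. 1\<^sup>2) * (\<Sum>i\<in>I. (cmod (t i))\<^sup>2)" by (rule Cauchy_Schwarz_ineq_sum)
  finally show ?thesis by simp
qed

text \<open>Gram-Schmidt, one function at a time. Only a nonzero residual enlarges the family, so
  its length never exceeds \<open>card J\<close>; this count is the rank bound used for the
  trace.\<close>

lemma orthonormal_spanning:
  fixes X :: "'j \<Rightarrow> 'x \<Rightarrow> complex"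
  assumes "finite J" and D: "finite D"
  shows "\<exists>(k::nat) f. k \<le> card J \<and>
    (\<forall>i<k. \<forall>i'<k. (\<Sum>a\<in>D. f i a * cnj (f i' a)) = (if i = i' then 1 else 0)) \<and>
    (\<forall>j\<in>J. \<forall>a\<in>D. X j a = (\<Sum>i<k. (\<Sum>b\<in>D. X j b * cnj (f i b)) * f i a))"
  using assms(1)
proof (induction J rule: finite_induct)
  case empty
  then show ?case by auto
next
  case (insert j J)
  then obtain k :: nat and f where k: "k \<le> card J"
    and on: "\<And>i i'. i < k \<Longrightarrow> i' < k \<Longrightarrow> (\<Sum>a\<in>D. f i a * cnj (f i' a)) = (if i = i' then 1 else 0)"
    and span: "\<And>j a. j \<in> J \<Longrightarrow> a \<in> D \<Longrightarrow> X j a = (\<Sum>i<k. (\<Sum>b\<in>D. X j b * cnj (f i b)) * f i a)"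
    by blast
  define r where "r = (\<lambda>a. X j a - (\<Sum>i<k. (\<Sum>b\<in>D. X j b * cnj (f i b)) * f i a))"
  have orth: "(\<Sum>a\<in>D. r a * cnj (f i a)) = 0" if "i < k" for i
    unfolding r_def by (rule orthonormal_residual(1)) (use D on that in auto)
  have orth': "(\<Sum>a\<in>D. f i a * cnj (r a)) = 0" if "i < k" for i
    using arg_cong[OF orth[OF that], of cnj] by (simp add: mult.commute)
  show ?case
  proof (cases "\<forall>a\<in>D. r a = 0")
    case True
    then have "\<forall>a\<in>D. X j a = (\<Sum>i<k. (\<Sum>b\<in>D. X j b * cnj (f i b)) * f i a)"
      unfolding r_def right_minus_eq .
    then have "\<forall>j'\<in>insert j J. \<forall>a\<in>D. X j' a = (\<Sum>i<k. (\<Sum>b\<in>D. X j' b * cnj (f i b)) * f i a)"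
      using span by blast
    moreover have "k \<le> card (insert j J)" using k insert.hyps by simp
    ultimately show ?thesis using on by blast
  next
    case False
    then obtain a0 where a0: "a0 \<in> D" "r a0 \<noteq> 0" by blast
    define R where "R = (\<Sum>a\<in>D. (cmod (r a))\<^sup>2)"
    have "0 < (cmod (r a0))\<^sup>2" using a0 by simp
    also have "\<dots> \<le> R" unfolding R_def using a0 D by (intro member_le_sum) auto
    finally have R: "0 < R" .
    have RR: "(\<Sum>a\<in>D. r a * cnj (r a)) = of_real R" unfolding R_def by (simp flip: complex_norm_square)
    define f' where "f' = (\<lambda>i a. if i = k then r a / of_real (sqrt R) else f i a)"
    have sR: "complex_of_real (sqrt R) * complex_of_real (sqrt R) = of_real R"
      using R by (simp flip: of_real_mult)
    have f'k: "(\<Sum>a\<in>D. f' k a * cnj (f' k a)) = 1"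
    proof -
      have "(\<Sum>a\<in>D. f' k a * cnj (f' k a)) = (\<Sum>a\<in>D. r a * cnj (r a)) / of_real R"
        by (simp add: f'_def sR sum_divide_distrib)
      then show ?thesis using R RR by simp
    qed
    have f'ki: "(\<Sum>a\<in>D. f' k a * cnj (f' i a)) = 0" "(\<Sum>a\<in>D. f' i a * cnj (f' k a)) = 0" if "i < k" for i
      using orth[OF that] orth'[OF that] that
      by (simp_all add: f'_def sum_divide_distrib[symmetric])
    have on': "(\<Sum>a\<in>D. f' i a * cnj (f' i' a)) = (if i = i' then 1 else 0)" if ii: "i < Suc k" "i' < Suc k" for i i'
    proof -
      consider "i = k" "i' = k" | "i = k" "i' < k" | "i < k" "i' = k" | "i < k" "i' < k"
        using ii unfolding less_Suc_eq by blast
      then show ?thesis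
        by cases (use f'k f'ki on in \<open>auto simp: f'_def\<close>)
    qed
    have "X j' a = (\<Sum>i<Suc k. (\<Sum>b\<in>D. X j' b * cnj (f' i b)) * f' i a)"
      if j': "j' \<in> insert j J" and a: "a \<in> D" for j' a
    proof -
      have *: "(\<Sum>i<Suc k. (\<Sum>b\<in>D. X j' b * cnj (f' i b)) * f' i a) =
          (\<Sum>i<k. (\<Sum>b\<in>D. X j' b * cnj (f i b)) * f i a) +
          (\<Sum>b\<in>D. X j' b * cnj (r b)) / of_real R * r a"
      proof -
        have "(\<Sum>b\<in>D. X j' b * cnj (f' k b)) * f' k a = (\<Sum>b\<in>D. X j' b * cnj (r b)) / of_real R * r a"
          by (simp add: f'_def sum_divide_distrib[symmetric] sR[symmetric])
        then show ?thesis by (simp add: f'_def)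
      qed
      have X_r: "(\<Sum>b\<in>D. (\<Sum>i<k. t i * f i b) * cnj (r b)) = 0" for t
      proof -
        have "(\<Sum>b\<in>D. (\<Sum>i<k. t i * f i b) * cnj (r b)) = (\<Sum>i<k. t i * (\<Sum>b\<in>D. f i b * cnj (r b)))"
          by (simp add: sum_distrib_right sum_distrib_left mult.assoc) (rule sum.swap)
        then show ?thesis using orth' by simp
      qed
      show ?thesis
      proof (cases "j' = j")
        case True
        have "(\<Sum>b\<in>D. X j b * cnj (r b)) = (\<Sum>b\<in>D. r b * cnj (r b))"
          using X_r[of "\<lambda>i. \<Sum>b\<in>D. X j b * cnj (f i b)"]
          by (simp add: r_def left_diff_distrib sum_subtractf)
        then have "(\<Sum>b\<in>D. X j b * cnj (r b)) = of_real R" unfolding RR .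
        then show ?thesis unfolding * unfolding True using R by (simp add: r_def)
      next
        case False
        then have j'J: "j' \<in> J" using j' by simp
        have "(\<Sum>b\<in>D. X j' b * cnj (r b)) =
            (\<Sum>b\<in>D. (\<Sum>i<k. (\<Sum>b\<in>D. X j' b * cnj (f i b)) * f i b) * cnj (r b))"
          by (intro sum.cong refl arg_cong2[where f = "(*)"] span j'J)
        then have "(\<Sum>b\<in>D. X j' b * cnj (r b)) = 0" unfolding X_r .
        then show ?thesis unfolding * using span[OF j'J a] by simp
      qed
    qed
    moreover have "Suc k \<le> card (insert j J)" using k insert.hyps by simp
    ultimately show ?thesis using on' by blast
  qed
qed

text \<open>The bound by \<open>d\<close> is Cauchy-Schwarz on the diagonal. For the bound by
  \<open>card J\<close>, an orthonormal family \<open>f\<close> spanning the \<open>X j\<close>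
  writes the trace as a sum of at most \<open>card J\<close> inner products of \<open>M\<close> with
  orthonormal rank-one matrices, whose squares Bessel's inequality controls by the Frobenius
  norm.\<close>

lemma trace_rank_bound:
  fixes X Y :: "'j \<Rightarrow> nat \<Rightarrow> complex"
  assumes J: "finite J"
  defines "M \<equiv> \<lambda>a b. \<Sum>j\<in>J. Y j a * X j b"
  shows "(cmod (\<Sum>a<d. M a a))\<^sup>2 \<le> real (min (card J) d) * (\<Sum>a<d. \<Sum>b<d. (cmod (M a b))\<^sup>2)"
proof -
  let ?F = "\<Sum>a<d. \<Sum>b<d. (cmod (M a b))\<^sup>2"
  have "(cmod (\<Sum>a<d. M a a))\<^sup>2 \<le> real (card {..<d}) * (\<Sum>a<d. (cmod (M a a))\<^sup>2)"
    by (rule cmod_sum_squared_le)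
  also have "\<dots> \<le> real d * ?F"
    by (auto intro!: mult_left_mono sum_mono member_le_sum)
  finally have bound_d: "(cmod (\<Sum>a<d. M a a))\<^sup>2 \<le> real d * ?F" .
  obtain k :: nat and f where k: "k \<le> card J"
    and on: "\<And>i i'. i < k \<Longrightarrow> i' < k \<Longrightarrow> (\<Sum>a<d. f i a * cnj (f i' a)) = (if i = i' then 1 else 0)"
    and span: "\<And>j a. j \<in> J \<Longrightarrow> a < d \<Longrightarrow> X j a = (\<Sum>i<k. (\<Sum>b<d. X j b * cnj (f i b)) * f i a)"
    using orthonormal_spanning[OF J finite_lessThan[of d], of X] unfolding Ball_def lessThan_iff
    by blast
  \<comment> \<open>Up to transposition, \<open>P i\<close> is the projector onto
    \<open>f i\<close>. The inner product of two of them is the squared modulus of that of the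
    vectors, so they are orthonormal as functions on index pairs.\<close>
  define P where "P = (\<lambda>i (p::nat \<times> nat). cnj (f i (fst p)) * f i (snd p))"
  define t where "t = (\<lambda>i. \<Sum>p\<in>{..<d} \<times> {..<d}. M (fst p) (snd p) * cnj (P i p))"
  have "(\<Sum>p\<in>{..<d} \<times> {..<d}. P i p * cnj (P i' p)) = (if i = i' then 1 else 0)"
    if "i \<in> {..<k}" "i' \<in> {..<k}" for i i'
  proof -
    have "(\<Sum>p\<in>{..<d} \<times> {..<d}. P i p * cnj (P i' p)) =
        (\<Sum>a<d. f i' a * cnj (f i a)) * (\<Sum>b<d. f i b * cnj (f i' b))"
      by (simp add: P_def sum_product sum.cartesian_product case_prod_unfold mult_ac)
    then show ?thesis using on that by auto
  qed
  from bessel_inequality[OF finite_lessThan _ this, where u = "\<lambda>p. M (fst p) (snd p)"]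
  have bess: "(\<Sum>i<k. (cmod (t i))\<^sup>2) \<le> ?F"
    unfolding t_def by (simp add: sum.cartesian_product case_prod_unfold)
  have "(\<Sum>a<d. M a a) = (\<Sum>a<d. \<Sum>j\<in>J. \<Sum>i<k. \<Sum>b<d. Y j a * X j b * cnj (f i b) * f i a)"
    unfolding M_def
  proof (intro sum.cong refl)
    fix a j assume aj: "a \<in> {..<d}" "j \<in> J"
    have "X j a = (\<Sum>i<k. (\<Sum>b<d. X j b * cnj (f i b)) * f i a)"
      by (rule span) (use aj in auto)
    from arg_cong[OF this, of "\<lambda>z. Y j a * z"]
    show "Y j a * X j a = (\<Sum>i<k. \<Sum>b<d. Y j a * X j b * cnj (f i b) * f i a)"
      unfolding sum_distrib_left sum_distrib_right by (simp only: mult.assoc)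
  qed
  also have "\<dots> = (\<Sum>a<d. \<Sum>i<k. \<Sum>b<d. M a b * cnj (f i b) * f i a)"
  proof (rule sum.cong[OF refl])
    fix a
    have "(\<Sum>j\<in>J. \<Sum>i<k. \<Sum>b<d. Y j a * X j b * cnj (f i b) * f i a) =
        (\<Sum>i<k. \<Sum>j\<in>J. \<Sum>b<d. Y j a * X j b * cnj (f i b) * f i a)" by (rule sum.swap)
    also have "\<dots> = (\<Sum>i<k. \<Sum>b<d. M a b * cnj (f i b) * f i a)"
      by (intro sum.cong refl, subst sum.swap) (simp add: M_def sum_distrib_right)
    finally show "(\<Sum>j\<in>J. \<Sum>i<k. \<Sum>b<d. Y j a * X j b * cnj (f i b) * f i a) =
      (\<Sum>i<k. \<Sum>b<d. M a b * cnj (f i b) * f i a)" .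
  qed
  also have "\<dots> = (\<Sum>i<k. \<Sum>a<d. \<Sum>b<d. M a b * cnj (f i b) * f i a)" by (rule sum.swap)
  also have "\<dots> = (\<Sum>i<k. t i)"
    by (simp add: t_def P_def sum.cartesian_product case_prod_unfold mult_ac)
  finally have "(cmod (\<Sum>a<d. M a a))\<^sup>2 \<le> real (card {..<k}) * (\<Sum>i<k. (cmod (t i))\<^sup>2)"
    using cmod_sum_squared_le[of t "{..<k}"] by simp
  also have "\<dots> \<le> real (card J) * ?F"
    using k bess by (intro mult_mono) (auto intro: sum_nonneg)
  finally show ?thesis using bound_d by (simp add: min_def)
qed

section \<open>Overlaps and amplitudes in adapted coordinates\<close>

context adapted_basis
begin

abbreviation order_G :: real where "order_G \<equiv> real (card (carrier G))"

definition J :: "'g rep \<Rightarrow> nat set" where "J s = {j. j < l \<and> q j = s}"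

definition coord :: "(nat \<Rightarrow> complex) \<Rightarrow> nat \<Rightarrow> nat \<Rightarrow> complex" where
  "coord v j a = (\<Sum>x<n. cnj (e j a x) * v x)"

text \<open>The inner product of \<open>v\<close> with U_g applied to \<open>\<phi>\<close>; its
  squared modulus is the contribution of a rank-one effect and a rank-one state to an outcome
  probability.\<close>

definition amplitude :: "(nat \<Rightarrow> complex) \<Rightarrow> (nat \<Rightarrow> complex) \<Rightarrow> 'g \<Rightarrow> complex" where
  "amplitude v \<phi> g = (\<Sum>x<n. cnj (v x) * (\<Sum>y<n. U g $$ (x, y) * \<phi> y))"

definition kap :: real where
  "kap = (\<Sum>s\<in>Q. real (min (card (J s)) (fst s) * fst s) / order_G)"

lemma order_G_pos: "0 < order_G"
  using finite_G group.is_monoid[OF G] monoid.one_closed card_gt_0_iff by fastforce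

lemma finite_J [simp]: "finite (J s)" unfolding J_def by simp

lemma sum_J: "(\<Sum>j<l. f j) = (\<Sum>s\<in>Q. \<Sum>j\<in>J s. f j)" for f :: "nat \<Rightarrow> 'c :: comm_monoid_add"
  using sum.group[of "{..<l}" Q q f] finite_Q q_in unfolding J_def by (simp add: image_subset_iff)

lemma expand:
  assumes "x < n"
  shows "v x = (\<Sum>j<l. \<Sum>a<fst (q j). coord v j a * e j a x)"
proof -
  have "v x = (\<Sum>y<n. if y = x then v y else 0)" using assms by simp
  also have "\<dots> = (\<Sum>y<n. (\<Sum>j<l. \<Sum>a<fst (q j). e j a x * cnj (e j a y)) * v y)"
    using basis_complete[OF assms] by (intro sum.cong) auto
  also have "\<dots> = (\<Sum>j<l. \<Sum>a<fst (q j). \<Sum>y<n. e j a x * cnj (e j a y) * v y)"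
    by (simp add: sum_distrib_right) (subst sum.swap, intro sum.cong refl sum.swap)
  finally show ?thesis by (simp add: coord_def sum_distrib_left sum_distrib_right mult_ac)
qed

lemma inner_coord:
  "(\<Sum>x<n. cnj (v x) * \<phi> x) = (\<Sum>j<l. \<Sum>a<fst (q j). cnj (coord v j a) * coord \<phi> j a)"
proof -
  have "(\<Sum>x<n. cnj (v x) * \<phi> x) = (\<Sum>x<n. \<Sum>j<l. \<Sum>a<fst (q j). cnj (v x) * (coord \<phi> j a * e j a x))"
    by (intro sum.cong refl) (simp add: expand[of _ \<phi>] sum_distrib_left)
  also have "\<dots> = (\<Sum>j<l. \<Sum>a<fst (q j). \<Sum>x<n. cnj (v x) * (coord \<phi> j a * e j a x))"
    by (subst sum.swap) (intro sum.cong refl sum.swap)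
  finally show ?thesis by (simp add: coord_def[of v] sum_distrib_left sum_distrib_right mult_ac)
qed

lemma coord_action:
  assumes g: "g \<in> carrier G" and j: "j < l" and a: "a < fst (q j)"
  shows "coord (\<lambda>x. \<Sum>y<n. U g $$ (x, y) * \<phi> y) j a =
    (\<Sum>b<fst (q j). snd (q j) g $$ (a, b) * coord \<phi> j b)"
proof -
  have U\<phi>: "(\<Sum>y<n. U g $$ (x, y) * \<phi> y) =
      (\<Sum>k<l. \<Sum>b<fst (q k). \<Sum>i<fst (q k). coord \<phi> k b * snd (q k) g $$ (i, b) * e k i x)"
    if x: "x < n" for x
  proof -
    have "(\<Sum>y<n. U g $$ (x, y) * \<phi> y) =
        (\<Sum>y<n. \<Sum>k<l. \<Sum>b<fst (q k). U g $$ (x, y) * (coord \<phi> k b * e k b y))"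
      by (intro sum.cong refl) (simp add: expand[of _ \<phi>] sum_distrib_left)
    also have "\<dots> = (\<Sum>k<l. \<Sum>b<fst (q k). \<Sum>y<n. U g $$ (x, y) * (coord \<phi> k b * e k b y))"
      by (subst sum.swap) (intro sum.cong refl sum.swap)
    also have "\<dots> = (\<Sum>k<l. \<Sum>b<fst (q k). coord \<phi> k b * (\<Sum>y<n. U g $$ (x, y) * e k b y))"
      by (simp add: sum_distrib_left mult_ac)
    also have "\<dots> = (\<Sum>k<l. \<Sum>b<fst (q k). coord \<phi> k b * (\<Sum>i<fst (q k). snd (q k) g $$ (i, b) * e k i x))"
      using basis_action[OF g _ _ x] by simp
    finally show ?thesis by (simp add: sum_distrib_left mult_ac)
  qed
  have "coord (\<lambda>x. \<Sum>y<n. U g $$ (x, y) * \<phi> y) j a =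
      (\<Sum>x<n. \<Sum>k<l. \<Sum>b<fst (q k). \<Sum>i<fst (q k).
         coord \<phi> k b * snd (q k) g $$ (i, b) * (e k i x * cnj (e j a x)))"
    unfolding coord_def[of "\<lambda>x. \<Sum>y<n. U g $$ (x, y) * \<phi> y"]
  proof (intro sum.cong refl)
    fix x assume "x \<in> {..<n}"
    then have x: "x < n" by simp
    show "cnj (e j a x) * (\<Sum>y<n. U g $$ (x, y) * \<phi> y) = (\<Sum>k<l. \<Sum>b<fst (q k). \<Sum>i<fst (q k).
        coord \<phi> k b * snd (q k) g $$ (i, b) * (e k i x * cnj (e j a x)))"
      unfolding U\<phi>[OF x] by (simp add: sum_distrib_left mult_ac)
  qed
  also have "\<dots> = (\<Sum>k<l. \<Sum>x<n. \<Sum>b<fst (q k). \<Sum>i<fst (q k).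
         coord \<phi> k b * snd (q k) g $$ (i, b) * (e k i x * cnj (e j a x)))"
    by (rule sum.swap)
  also have "\<dots> = (\<Sum>k<l. \<Sum>b<fst (q k). \<Sum>x<n. \<Sum>i<fst (q k).
         coord \<phi> k b * snd (q k) g $$ (i, b) * (e k i x * cnj (e j a x)))"
    by (intro sum.cong refl sum.swap)
  also have "\<dots> = (\<Sum>k<l. \<Sum>b<fst (q k). \<Sum>i<fst (q k). \<Sum>x<n.
         coord \<phi> k b * snd (q k) g $$ (i, b) * (e k i x * cnj (e j a x)))"
    by (intro sum.cong refl sum.swap)
  also have "\<dots> = (\<Sum>k<l. \<Sum>b<fst (q k). \<Sum>i<fst (q k).
         if k = j \<and> i = a then coord \<phi> k b * snd (q k) g $$ (i, b) else 0)"
    using basis_orthonormal[OF _ _ j a]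
    by (intro sum.cong refl) (simp flip: sum_distrib_left)
  also have "\<dots> = (\<Sum>k<l. if k = j then \<Sum>b<fst (q k). coord \<phi> k b * snd (q k) g $$ (a, b) else 0)"
    using a by (intro sum.cong refl) auto
  finally show ?thesis using j by (simp add: mult.commute)
qed

text \<open>In adapted coordinates the isotypic component of class \<open>s\<close> contributes the matrix
  \<open>M s = \<Sum>\<^bsub>j \<in> J s\<^esub> conj v\<^sub>j \<otimes> \<phi>\<^sub>j\<close>, a product through a space of dimension \<open>card (J s)\<close>.\<close>

definition M :: "(nat \<Rightarrow> complex) \<Rightarrow> (nat \<Rightarrow> complex) \<Rightarrow> 'g rep \<Rightarrow> nat \<Rightarrow> nat \<Rightarrow> complex" where
  "M v \<phi> s a b = (\<Sum>j\<in>J s. cnj (coord v j a) * coord \<phi> j b)"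

lemma inner_M: "(\<Sum>x<n. cnj (v x) * \<phi> x) = (\<Sum>s\<in>Q. \<Sum>a<fst s. M v \<phi> s a a)"
proof -
  have "(\<Sum>x<n. cnj (v x) * \<phi> x) = (\<Sum>s\<in>Q. \<Sum>j\<in>J s. \<Sum>a<fst s. cnj (coord v j a) * coord \<phi> j a)"
    unfolding inner_coord sum_J by (intro sum.cong refl) (auto simp: J_def)
  also have "\<dots> = (\<Sum>s\<in>Q. \<Sum>a<fst s. M v \<phi> s a a)"
    unfolding M_def by (intro sum.cong refl sum.swap)
  finally show ?thesis .
qed

text \<open>The dependence on \<open>g\<close> now sits entirely in the matrix coefficients of the
  representatives, so the amplitude is a combination of mutually orthogonal functions on the
  group.\<close>

lemma amplitude_M:
  assumes g: "g \<in> carrier G"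
  shows "amplitude v \<phi> g = (\<Sum>s\<in>Q. \<Sum>a<fst s. \<Sum>b<fst s. M v \<phi> s a b * snd s g $$ (a, b))"
proof -
  have "amplitude v \<phi> g = (\<Sum>j<l. \<Sum>a<fst (q j). cnj (coord v j a) *
      (\<Sum>b<fst (q j). snd (q j) g $$ (a, b) * coord \<phi> j b))"
    unfolding amplitude_def inner_coord using coord_action[OF g] by (intro sum.cong refl) simp
  also have "\<dots> = (\<Sum>s\<in>Q. \<Sum>j\<in>J s. \<Sum>a<fst s. \<Sum>b<fst s.
      cnj (coord v j a) * coord \<phi> j b * snd s g $$ (a, b))"
    unfolding sum_J by (intro sum.cong refl) (auto simp: J_def sum_distrib_left mult_ac)
  also have "\<dots> = (\<Sum>s\<in>Q. \<Sum>a<fst s. \<Sum>j\<in>J s. \<Sum>b<fst s.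
      cnj (coord v j a) * coord \<phi> j b * snd s g $$ (a, b))"
    by (intro sum.cong refl sum.swap)
  also have "\<dots> = (\<Sum>s\<in>Q. \<Sum>a<fst s. \<Sum>b<fst s. \<Sum>j\<in>J s.
      cnj (coord v j a) * coord \<phi> j b * snd s g $$ (a, b))"
    by (intro sum.cong refl sum.swap)
  finally show ?thesis by (simp add: M_def sum_distrib_right)
qed

lemma sum_coefficients:
  "(\<Sum>s\<in>Q. \<Sum>a<fst s. \<Sum>b<fst s. h s a b) =
    (\<Sum>(s, a, b)\<in>Sigma Q (\<lambda>s. {..<fst s} \<times> {..<fst s}). h s a b)"
  for h :: "'g rep \<Rightarrow> nat \<Rightarrow> nat \<Rightarrow> 'c :: comm_monoid_add"
  using finite_Q by (simp add: sum.Sigma sum.cartesian_product case_prod_unfold)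

text \<open>Parseval's identity for the matrix coefficients indexed by triples
  \<open>(s, a, b)\<close>, each of squared norm |G| / d.\<close>

lemma sum_amplitude_squared:
  "(\<Sum>g\<in>carrier G. (cmod (amplitude v \<phi> g))\<^sup>2) =
     (\<Sum>s\<in>Q. order_G / real (fst s) * (\<Sum>a<fst s. \<Sum>b<fst s. (cmod (M v \<phi> s a b))\<^sup>2))"
proof -
  let ?K = "Sigma Q (\<lambda>s. {..<fst s} \<times> {..<fst s})"
  define F where "F = (\<lambda>(s :: 'g rep, a, b) g. snd s g $$ (a, b) :: complex)"
  note K = sum_coefficients
  have "(\<Sum>g\<in>carrier G. (cmod (amplitude v \<phi> g))\<^sup>2) =
      (\<Sum>g\<in>carrier G. (cmod (\<Sum>k\<in>?K. (case k of (s, a, b) \<Rightarrow> M v \<phi> s a b) * F k g))\<^sup>2)"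
    by (intro sum.cong refl) (simp add: amplitude_M K F_def case_prod_unfold)
  also have "\<dots> = (\<Sum>k\<in>?K. order_G / real (fst (fst k)) * (cmod (case k of (s, a, b) \<Rightarrow> M v \<phi> s a b))\<^sup>2)"
  proof (rule parseval_orthogonal)
    show "(\<Sum>g\<in>carrier G. F k g * cnj (F k' g)) =
      (if k = k' then complex_of_real (order_G / real (fst (fst k))) else 0)"
      if kk': "k \<in> ?K" "k' \<in> ?K" for k k'
    proof -
      obtain s a b where k: "k = (s, a, b)" "s \<in> Q" "a < fst s" "b < fst s" using kk'(1) by blast
      obtain t i j where k': "k' = (t, i, j)" "t \<in> Q" "i < fst t" "j < fst t" using kk'(2) by blast
      show ?thesis
        using orthogonality[OF k(2) k'(2) k(3,4) k'(3,4)] unfolding k(1) k'(1) F_def by simp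
    qed
  qed (use finite_Q in auto)
  also have "\<dots> = (\<Sum>s\<in>Q. \<Sum>a<fst s. \<Sum>b<fst s. order_G / real (fst s) * (cmod (M v \<phi> s a b))\<^sup>2)"
    unfolding K by (simp add: case_prod_unfold)
  finally show ?thesis by (simp add: sum_distrib_left)
qed

lemma overlap_bound:
  "(cmod (\<Sum>x<n. cnj (v x) * \<phi> x))\<^sup>2 \<le> kap * (\<Sum>g\<in>carrier G. (cmod (amplitude v \<phi> g))\<^sup>2)"
proof -
  define F where "F = (\<lambda>s. \<Sum>a<fst s. \<Sum>b<fst s. (cmod (M v \<phi> s a b))\<^sup>2)"
  define t where "t = (\<lambda>s. \<Sum>a<fst s. M v \<phi> s a a)"
  \<comment> \<open>The weights are chosen so that \<open>\<alpha> s * \<beta> s\<close> is the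
    bound for the squared trace at \<open>s\<close>, while \<open>\<alpha>\<close> sums to
    \<open>kap\<close> and \<open>\<beta>\<close> to the total squared amplitude.\<close>
  define \<alpha> where "\<alpha> = (\<lambda>s::'g rep. real (min (card (J s)) (fst s) * fst s) / order_G)"
  define \<beta> where "\<beta> = (\<lambda>s. order_G / real (fst s) * F s)"
  have F0: "0 \<le> F s" for s unfolding F_def by (intro sum_nonneg) auto
  have nn: "0 \<le> \<alpha> s" "0 \<le> \<beta> s" for s
    unfolding \<alpha>_def \<beta>_def using F0[of s] by simp_all
  have t: "cmod (t s) \<le> sqrt (\<alpha> s) * sqrt (\<beta> s)" if s: "s \<in> Q" for s
  proof -
    have "(cmod (t s))\<^sup>2 \<le> real (min (card (J s)) (fst s)) * F s"
      unfolding t_def F_def M_def by (rule trace_rank_bound) simp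
    also have "\<dots> = \<alpha> s * \<beta> s"
      unfolding \<alpha>_def \<beta>_def using order_G_pos dim_pos[OF s] by (simp add: field_simps)
    finally have "cmod (t s) \<le> sqrt (\<alpha> s * \<beta> s)" by (simp add: real_le_rsqrt)
    then show ?thesis by (simp add: real_sqrt_mult)
  qed
  have "cmod (\<Sum>x<n. cnj (v x) * \<phi> x) \<le> (\<Sum>s\<in>Q. cmod (t s))"
    unfolding inner_M t_def by (rule norm_sum)
  also have "\<dots> \<le> (\<Sum>s\<in>Q. sqrt (\<alpha> s) * sqrt (\<beta> s))" by (intro sum_mono t)
  finally have "(cmod (\<Sum>x<n. cnj (v x) * \<phi> x))\<^sup>2 \<le> (\<Sum>s\<in>Q. sqrt (\<alpha> s) * sqrt (\<beta> s))\<^sup>2"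
    by (intro power_mono) auto
  also have "\<dots> \<le> (\<Sum>s\<in>Q. (sqrt (\<alpha> s))\<^sup>2) * (\<Sum>s\<in>Q. (sqrt (\<beta> s))\<^sup>2)"
    by (rule Cauchy_Schwarz_ineq_sum)
  also have "\<dots> = kap * (\<Sum>g\<in>carrier G. (cmod (amplitude v \<phi> g))\<^sup>2)"
    unfolding kap_def sum_amplitude_squared using nn by (simp add: \<alpha>_def \<beta>_def F_def)
  finally show ?thesis .
qed

end

section \<open>Measurements\<close>

lemma finsum_mat_carrier_index:
  fixes E :: "'g \<Rightarrow> complex mat"
  assumes "finite S" "\<And>g. g \<in> S \<Longrightarrow> E g \<in> carrier_mat nr nc"
  shows "finsum (module_mat TYPE(complex) nr nc) E S \<in> carrier_mat nr nc \<and>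
    (\<forall>i<nr. \<forall>j<nc. finsum (module_mat TYPE(complex) nr nc) E S $$ (i, j) = (\<Sum>g\<in>S. E g $$ (i, j)))"
  using assms
proof (induction S rule: finite_induct)
  interpret abelian_group "module_mat TYPE(complex) nr nc" by (rule abelian_group_mat)
  case empty
  then show ?case by (simp add: module_mat_simps)
next
  interpret abelian_group "module_mat TYPE(complex) nr nc" by (rule abelian_group_mat)
  case (insert g S)
  have "finsum (module_mat TYPE(complex) nr nc) E (insert g S) =
      E g + finsum (module_mat TYPE(complex) nr nc) E S"
    using insert.hyps insert.prems by (subst finsum_insert) (auto simp: module_mat_simps)
  then show ?case using insert by auto
qed

lemma mat_trace_mult:
  assumes "A \<in> carrier_mat n k" "B \<in> carrier_mat k n"
  shows "mat_trace (A * B) = (\<Sum>i<n. \<Sum>x<k. A $$ (i, x) * B $$ (x, i))"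
  unfolding mat_trace_def using index_mult_sum[OF assms] assms by auto

lemma psd_mat_smult:
  assumes "psd_mat n A" "0 \<le> t"
  shows "psd_mat n (complex_of_real t \<cdot>\<^sub>m A)"
  unfolding psd_mat_iff
proof (intro conjI allI)
  have A: "A \<in> carrier_mat n n" and pos: "0 \<le> (\<Sum>i<n. \<Sum>j<n. A $$ (i, j) * v j * cnj (v i))" for v
    using assms(1) unfolding psd_mat_iff by auto
  show "complex_of_real t \<cdot>\<^sub>m A \<in> carrier_mat n n" using A by simp
  fix v
  have "(\<Sum>i<n. \<Sum>j<n. (complex_of_real t \<cdot>\<^sub>m A) $$ (i, j) * v j * cnj (v i)) =
      of_real t * (\<Sum>i<n. \<Sum>j<n. A $$ (i, j) * v j * cnj (v i))"
    using A by (simp add: sum_distrib_left mult.assoc)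
  then show "0 \<le> (\<Sum>i<n. \<Sum>j<n. (complex_of_real t \<cdot>\<^sub>m A) $$ (i, j) * v j * cnj (v i))"
    using pos[of v] assms(2) by (simp add: less_eq_complex_def)
qed

lemma psd_mat_add:
  assumes "psd_mat n A" "psd_mat n B"
  shows "psd_mat n (A + B)"
  unfolding psd_mat_iff
proof (intro conjI allI)
  have A: "A \<in> carrier_mat n n" and B: "B \<in> carrier_mat n n"
    and pos: "0 \<le> (\<Sum>i<n. \<Sum>j<n. A $$ (i, j) * v j * cnj (v i)) +
       (\<Sum>i<n. \<Sum>j<n. B $$ (i, j) * v j * cnj (v i))" for v
    using assms unfolding psd_mat_iff by auto
  show "A + B \<in> carrier_mat n n" using B by simp
  fix v
  have "(\<Sum>i<n. \<Sum>j<n. (A + B) $$ (i, j) * v j * cnj (v i)) =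
      (\<Sum>i<n. \<Sum>j<n. A $$ (i, j) * v j * cnj (v i)) + (\<Sum>i<n. \<Sum>j<n. B $$ (i, j) * v j * cnj (v i))"
    using A B by (simp add: distrib_right sum.distrib)
  then show "0 \<le> (\<Sum>i<n. \<Sum>j<n. (A + B) $$ (i, j) * v j * cnj (v i))" using pos[of v] by simp
qed

lemma psd_mat_one: "psd_mat n (1\<^sub>m n)"
  using psd_mat_mult_adjoint[of "1\<^sub>m n" n n] by simp

text \<open>With probability 1 - \<open>t\<close> the measurement result is replaced by the
  inconclusive outcome; success and error probabilities both shrink by the factor
  \<open>t\<close>.\<close>

lemma povm_scale:
  assumes povm: "povm G n E0 E" and fin: "finite (carrier G)" and t: "0 \<le> t" "t \<le> 1"
  shows "povm G n (complex_of_real (1 - t) \<cdot>\<^sub>m 1\<^sub>m n + complex_of_real t \<cdot>\<^sub>m E0)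
    (\<lambda>g. complex_of_real t \<cdot>\<^sub>m E g)"
  unfolding povm_def
proof (intro conjI ballI)
  let ?sum = "finsum (module_mat TYPE(complex) n n)"
  have E: "psd_mat n E0" "\<And>g. g \<in> carrier G \<Longrightarrow> psd_mat n (E g)" "E0 + ?sum E (carrier G) = 1\<^sub>m n"
    using povm unfolding povm_def by auto
  show "psd_mat n (complex_of_real (1 - t) \<cdot>\<^sub>m 1\<^sub>m n + complex_of_real t \<cdot>\<^sub>m E0)"
    by (intro psd_mat_add psd_mat_smult psd_mat_one E) (use t in auto)
  show "psd_mat n (complex_of_real t \<cdot>\<^sub>m E g)" if "g \<in> carrier G" for g
    using that t by (intro psd_mat_smult E)
  have c: "E0 \<in> carrier_mat n n" "\<And>g. g \<in> carrier G \<Longrightarrow> E g \<in> carrier_mat n n"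
    using E unfolding psd_mat_def by auto
  note f1 = finsum_mat_carrier_index[OF fin, of E n n, OF c(2)]
  note f2 = finsum_mat_carrier_index[OF fin, of "\<lambda>g. complex_of_real t \<cdot>\<^sub>m E g" n n,
      OF smult_carrier_mat[OF c(2)]]
  have f2': "?sum (\<lambda>g. complex_of_real t \<cdot>\<^sub>m E g) (carrier G) \<in> carrier_mat n n"
    "\<And>i j. i < n \<Longrightarrow> j < n \<Longrightarrow> ?sum (\<lambda>g. complex_of_real t \<cdot>\<^sub>m E g) (carrier G) $$ (i, j) =
      of_real t * (\<Sum>g\<in>carrier G. E g $$ (i, j))"
    using f2 carrier_matD[OF c(2)] by (auto simp: sum_distrib_left)
  show "complex_of_real (1 - t) \<cdot>\<^sub>m 1\<^sub>m n + complex_of_real t \<cdot>\<^sub>m E0 +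
      ?sum (\<lambda>g. complex_of_real t \<cdot>\<^sub>m E g) (carrier G) = 1\<^sub>m n"
  proof (rule eq_matI)
    fix i j assume "i < dim_row (1\<^sub>m n :: complex mat)" "j < dim_col (1\<^sub>m n :: complex mat)"
    then have ij: "i < n" "j < n" by auto
    have "(E0 + ?sum E (carrier G)) $$ (i, j) = 1\<^sub>m n $$ (i, j)" using E(3) by simp
    then have "E0 $$ (i, j) + (\<Sum>g\<in>carrier G. E g $$ (i, j)) = 1\<^sub>m n $$ (i, j)"
      using f1 carrier_matD[OF conjunct1[OF f1]] ij by simp
    moreover have "(complex_of_real (1 - t) \<cdot>\<^sub>m 1\<^sub>m n + complex_of_real t \<cdot>\<^sub>m E0 +
      ?sum (\<lambda>g. complex_of_real t \<cdot>\<^sub>m E g) (carrier G)) $$ (i, j) =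
      of_real (1 - t) * 1\<^sub>m n $$ (i, j) +
        of_real t * (E0 $$ (i, j) + (\<Sum>g\<in>carrier G. E g $$ (i, j)))"
      using f2' c(1) ij by (simp add: distrib_left)
    ultimately show "(complex_of_real (1 - t) \<cdot>\<^sub>m 1\<^sub>m n + complex_of_real t \<cdot>\<^sub>m E0 +
      ?sum (\<lambda>g. complex_of_real t \<cdot>\<^sub>m E g) (carrier G)) $$ (i, j) = 1\<^sub>m n $$ (i, j)"
      using ij by (simp add: left_diff_distrib)
  qed (use f2'(1) in auto)
qed

section \<open>Outcome probabilities as sums of squared amplitudes\<close>

context adapted_basis
begin

text \<open>Cyclicity of the trace turns the probability into the squared Frobenius norm of the
  adjoint of \<open>F\<close> times \<open>U h * R\<close>, and the entries of that matrix are
  amplitudes between columns of \<open>F\<close> and of \<open>R\<close>.\<close>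

lemma outcome_amplitude:
  assumes h: "h \<in> carrier G" and F: "F \<in> carrier_mat n p" and R: "R \<in> carrier_mat n r"
    and E: "E g = F * mat_adjoint F"
  shows "outcome_prob U (R * mat_adjoint R) E g h =
    (\<Sum>k<p. \<Sum>i<r. (cmod (amplitude (\<lambda>x. F $$ (x, k)) (\<lambda>y. R $$ (y, i)) h))\<^sup>2)"
proof -
  note Uh = unitary_proj_repD(2)[OF rep h]
  define X where "X = U h * R"
  have X: "X \<in> carrier_mat n r" unfolding X_def using Uh R by simp
  note Fa = mat_adjoint_carrier[OF F] and Xa = mat_adjoint_carrier[OF X]
    and Ra = mat_adjoint_carrier[OF R] and Ua = mat_adjoint_carrier[OF Uh]
  have FX: "mat_adjoint F * X \<in> carrier_mat p r" using Fa X by simp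
  have 1: "U h * (R * mat_adjoint R) * mat_adjoint (U h) = X * mat_adjoint X"
    unfolding X_def mat_adjoint_mult[OF Uh R] by (rule mult_mat_assoc4[OF Uh R Ra Ua, symmetric])
  have "mat_trace (F * mat_adjoint F * (X * mat_adjoint X)) =
      mat_trace (F * (mat_adjoint F * (X * mat_adjoint X)))"
    using assoc_mult_mat[OF F Fa mult_carrier_mat[OF X Xa]] by simp
  also have "\<dots> = mat_trace (mat_adjoint F * (X * mat_adjoint X) * F)"
    by (rule mat_trace_comm[OF F mult_carrier_mat[OF Fa mult_carrier_mat[OF X Xa]]])
  also have "mat_adjoint F * (X * mat_adjoint X) * F = mat_adjoint F * X * (mat_adjoint X * F)"
    by (rule mult_mat_assoc4[OF Fa X Xa F, symmetric])
  also have "mat_adjoint X * F = mat_adjoint (mat_adjoint F * X)"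
    using mat_adjoint_mult[OF Fa X] by simp
  finally have "outcome_prob U (R * mat_adjoint R) E g h =
      (\<Sum>k<p. \<Sum>i<r. (cmod ((mat_adjoint F * X) $$ (k, i)))\<^sup>2)"
    unfolding outcome_prob_def E 1 using mat_trace_mult_adjoint[OF FX] by simp
  also have "\<dots> = (\<Sum>k<p. \<Sum>i<r. (cmod (amplitude (\<lambda>x. F $$ (x, k)) (\<lambda>y. R $$ (y, i)) h))\<^sup>2)"
  proof (intro sum.cong refl)
    fix k i assume "k \<in> {..<p}" "i \<in> {..<r}"
    then have ki: "k < p" "i < r" by auto
    have "(mat_adjoint F * X) $$ (k, i) = (\<Sum>x<n. cnj (F $$ (x, k)) * X $$ (x, i))"
      using index_mult_sum[OF Fa X ki] F ki by simp
    also have "\<dots> = amplitude (\<lambda>x. F $$ (x, k)) (\<lambda>y. R $$ (y, i)) h"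
      unfolding amplitude_def X_def using index_mult_sum[OF Uh R _ ki(2)] by simp
    finally show "(cmod ((mat_adjoint F * X) $$ (k, i)))\<^sup>2 =
      (cmod (amplitude (\<lambda>x. F $$ (x, k)) (\<lambda>y. R $$ (y, i)) h))\<^sup>2" by simp
  qed
  finally show ?thesis .
qed

text \<open>Apply the overlap bound to U_g applied to \<open>\<phi>\<close>. Since U_h U_g is U_hg
  up to a phase, the squared amplitudes on the right are only permuted by h -> h g.\<close>

lemma amplitude_bound:
  assumes g: "g \<in> carrier G"
  shows "(cmod (amplitude v \<phi> g))\<^sup>2 \<le> kap * (\<Sum>h\<in>carrier G. (cmod (amplitude v \<phi> h))\<^sup>2)"
proof -
  interpret group G by (rule G)
  define \<psi> where "\<psi> = (\<lambda>x. \<Sum>y<n. U g $$ (x, y) * \<phi> y)"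
  note Ug = unitary_proj_repD(2)[OF rep g]
  have "(cmod (amplitude v \<psi> h))\<^sup>2 = (cmod (amplitude v \<phi> (h \<otimes>\<^bsub>G\<^esub> g)))\<^sup>2" if h: "h \<in> carrier G" for h
  proof -
    note Uh = unitary_proj_repD(2)[OF rep h]
    have hg: "h \<otimes>\<^bsub>G\<^esub> g \<in> carrier G" using h g by simp
    note Uhg = unitary_proj_repD(2)[OF rep hg]
    have "(\<Sum>y<n. U h $$ (x, y) * \<psi> y) = c h g * (\<Sum>y<n. U (h \<otimes>\<^bsub>G\<^esub> g) $$ (x, y) * \<phi> y)"
      if x: "x < n" for x
    proof -
      have "(\<Sum>y<n. U h $$ (x, y) * \<psi> y) = (\<Sum>z<n. (\<Sum>y<n. U h $$ (x, y) * U g $$ (y, z)) * \<phi> z)"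
        unfolding \<psi>_def by (simp add: sum_distrib_left sum_distrib_right mult.assoc) (rule sum.swap)
      also have "\<dots> = (\<Sum>z<n. (U h * U g) $$ (x, z) * \<phi> z)"
        using index_mult_sum[OF Uh Ug x] by simp
      also have "\<dots> = (\<Sum>z<n. c h g * U (h \<otimes>\<^bsub>G\<^esub> g) $$ (x, z) * \<phi> z)"
        unfolding unitary_proj_repD(4)[OF rep h g] using Uhg x by simp
      finally show ?thesis by (simp add: sum_distrib_left mult.assoc)
    qed
    then have "amplitude v \<psi> h = c h g * amplitude v \<phi> (h \<otimes>\<^bsub>G\<^esub> g)"
      unfolding amplitude_def by (simp add: sum_distrib_left mult_ac)
    then show ?thesis using unitary_proj_repD(3)[OF rep h g] by (simp add: norm_mult)
  qed
  then have "(\<Sum>h\<in>carrier G. (cmod (amplitude v \<psi> h))\<^sup>2) =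
      (\<Sum>h\<in>carrier G. (cmod (amplitude v \<phi> h))\<^sup>2)"
    using sum_group_shift_right[OF G g, of "\<lambda>h. (cmod (amplitude v \<phi> h))\<^sup>2"] by simp
  moreover have "(\<Sum>x<n. cnj (v x) * \<psi> x) = amplitude v \<phi> g"
    unfolding amplitude_def \<psi>_def ..
  ultimately show ?thesis using overlap_bound[of v \<psi>] by simp
qed

lemma kap_nonneg: "0 \<le> kap"
  unfolding kap_def by (intro sum_nonneg) auto

lemma outcome_bound:
  assumes g: "g \<in> carrier G" and \<rho>: "psd_mat n \<rho>" and E: "psd_mat n (E g)"
  shows "outcome_prob U \<rho> E g g \<le> kap * (\<Sum>h\<in>carrier G. outcome_prob U \<rho> E g h)"
proof -
  obtain r R where R: "R \<in> carrier_mat n r" "\<rho> = R * mat_adjoint R" using psd_mat_gram[OF \<rho>] .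
  obtain p F where F: "F \<in> carrier_mat n p" "E g = F * mat_adjoint F" using psd_mat_gram[OF E] .
  let ?a = "\<lambda>k i h. (cmod (amplitude (\<lambda>x. F $$ (x, k)) (\<lambda>y. R $$ (y, i)) h))\<^sup>2"
  have out: "outcome_prob U \<rho> E g h = (\<Sum>k<p. \<Sum>i<r. ?a k i h)" if "h \<in> carrier G" for h
    unfolding R(2) by (rule outcome_amplitude[where E = E and g = g, OF that F(1) R(1) F(2)])
  have "outcome_prob U \<rho> E g g \<le> (\<Sum>k<p. \<Sum>i<r. kap * (\<Sum>h\<in>carrier G. ?a k i h))"
    unfolding out[OF g] by (intro sum_mono amplitude_bound g)
  also have "\<dots> = kap * (\<Sum>k<p. \<Sum>i<r. \<Sum>h\<in>carrier G. ?a k i h)" by (simp add: sum_distrib_left)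
  also have "(\<Sum>k<p. \<Sum>i<r. \<Sum>h\<in>carrier G. ?a k i h) = (\<Sum>k<p. \<Sum>h\<in>carrier G. \<Sum>i<r. ?a k i h)"
    by (intro sum.cong refl sum.swap)
  also have "\<dots> = (\<Sum>h\<in>carrier G. \<Sum>k<p. \<Sum>i<r. ?a k i h)" by (rule sum.swap)
  also have "\<dots> = (\<Sum>h\<in>carrier G. outcome_prob U \<rho> E g h)" using out by simp
  finally show ?thesis .
qed

text \<open>Together with the inconclusive outcome the probabilities sum to the trace of the
  transformed state, which is 1, and the omitted probability is nonnegative.\<close>

lemma outcome_total:
  assumes h: "h \<in> carrier G" and \<rho>: "\<rho> \<in> density_operators n" and povm: "povm G n E0 E"
  shows "(\<Sum>g\<in>carrier G. outcome_prob U \<rho> E g h) \<le> 1"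
proof -
  let ?sum = "finsum (module_mat TYPE(complex) n n) E (carrier G)"
  have \<rho>': "psd_mat n \<rho>" "mat_trace \<rho> = 1" using \<rho> unfolding density_operators_def by auto
  have E: "psd_mat n E0" "\<And>g. g \<in> carrier G \<Longrightarrow> E g \<in> carrier_mat n n" "E0 + ?sum = 1\<^sub>m n"
    using povm unfolding povm_def psd_mat_def by auto
  have E0: "E0 \<in> carrier_mat n n" and \<rho>c: "\<rho> \<in> carrier_mat n n"
    using E(1) \<rho>'(1) unfolding psd_mat_def by auto
  obtain r R where R: "R \<in> carrier_mat n r" "\<rho> = R * mat_adjoint R" using psd_mat_gram[OF \<rho>'(1)] .
  obtain p F where F: "F \<in> carrier_mat n p" "E0 = F * mat_adjoint F" using psd_mat_gram[OF E(1)] .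
  note u = unitary_matD[OF unitary_proj_repD(1)[OF rep h]]
  define S where "S = U h * \<rho> * mat_adjoint (U h)"
  have S: "S \<in> carrier_mat n n" 
    unfolding S_def by (rule mult_carrier_mat[OF mult_carrier_mat[OF u(1) \<rho>c] mat_adjoint_carrier[OF u(1)]])
  have "mat_trace S = mat_trace (mat_adjoint (U h) * (U h * \<rho>))"
    unfolding S_def by (rule mat_trace_comm[OF mult_carrier_mat[OF u(1) \<rho>c] mat_adjoint_carrier[OF u(1)]])
  also have "\<dots> = 1"
    using assoc_mult_mat[OF mat_adjoint_carrier[OF u(1)] u(1) \<rho>c] u(3) \<rho>c \<rho>'(2) by simp
  finally have trS: "mat_trace S = 1" .
  \<comment> \<open>The inconclusive effect is viewed as a constant family of effects to reuse the
    amplitude formula; the identity element is only a placeholder index.\<close>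
  have "0 \<le> outcome_prob U (R * mat_adjoint R) (\<lambda>_. E0) \<one>\<^bsub>G\<^esub> h"
    using outcome_amplitude[OF h F(1) R(1), of "\<lambda>_. E0" "\<one>\<^bsub>G\<^esub>"] F(2) by (simp add: sum_nonneg)
  then have inc: "0 \<le> Re (mat_trace (E0 * S))" unfolding outcome_prob_def S_def R(2) .
  note fs = finsum_mat_carrier_index[OF finite_G, of E n n, OF E(2)]
  have "(\<Sum>g\<in>carrier G. mat_trace (E g * S)) =
      (\<Sum>g\<in>carrier G. \<Sum>i<n. \<Sum>x<n. E g $$ (i, x) * S $$ (x, i))"
    using mat_trace_mult[OF E(2) S] by simp
  also have "\<dots> = (\<Sum>i<n. \<Sum>g\<in>carrier G. \<Sum>x<n. E g $$ (i, x) * S $$ (x, i))" by (rule sum.swap)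
  also have "\<dots> = (\<Sum>i<n. \<Sum>x<n. \<Sum>g\<in>carrier G. E g $$ (i, x) * S $$ (x, i))"
    by (intro sum.cong refl sum.swap)
  also have "\<dots> = mat_trace (?sum * S)"
    using mat_trace_mult[OF _ S, of ?sum] fs by (simp add: sum_distrib_right)
  finally have "mat_trace (E0 * S) + (\<Sum>g\<in>carrier G. mat_trace (E g * S)) =
      mat_trace (E0 * S) + mat_trace (?sum * S)" by simp
  also have "\<dots> = mat_trace ((E0 + ?sum) * S)"
    using add_mult_distrib_mat[OF E0 conjunct1[OF fs] S]
      mat_trace_add[OF mult_carrier_mat[OF E0 S] mult_carrier_mat[OF conjunct1[OF fs] S]] by simp
  also have "\<dots> = 1" unfolding E(3) using S trS by simp
  finally have "Re (mat_trace (E0 * S)) + (\<Sum>g\<in>carrier G. Re (mat_trace (E g * S))) = 1"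
    by (metis Re_sum one_complex.sel(1) plus_complex.sel(1))
  then show ?thesis using inc unfolding outcome_prob_def S_def by simp
qed

lemma success_plus_error:
  "success_prob G U \<rho> E + error_prob G U \<rho> E =
     1 / order_G * (\<Sum>g\<in>carrier G. \<Sum>h\<in>carrier G. outcome_prob U \<rho> E g h)"
proof -
  have "(\<Sum>g\<in>carrier G. \<Sum>h\<in>carrier G. outcome_prob U \<rho> E g h) =
      (\<Sum>g\<in>carrier G. outcome_prob U \<rho> E g g + (\<Sum>h\<in>carrier G - {g}. outcome_prob U \<rho> E g h))"
    using finite_G by (intro sum.cong refl) (rule sum.remove)
  then show ?thesis unfolding success_prob_def error_prob_def by (simp add: sum.distrib distrib_left)
qed

lemma success_plus_error_le_one:
  assumes \<rho>: "\<rho> \<in> density_operators n" and povm: "povm G n E0 E"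
  shows "success_prob G U \<rho> E + error_prob G U \<rho> E \<le> 1"
proof -
  have "(\<Sum>h\<in>carrier G. \<Sum>g\<in>carrier G. outcome_prob U \<rho> E g h) \<le> (\<Sum>h\<in>carrier G. 1)"
    by (intro sum_mono outcome_total[OF _ \<rho> povm])
  then have "(\<Sum>g\<in>carrier G. \<Sum>h\<in>carrier G. outcome_prob U \<rho> E g h) \<le> order_G"
    by (subst sum.swap) simp
  then show ?thesis unfolding success_plus_error using order_G_pos by (simp add: field_simps)
qed

lemma success_le:
  assumes \<rho>: "\<rho> \<in> density_operators n" and povm: "povm G n E0 E"
  shows "success_prob G U \<rho> E \<le> kap * (success_prob G U \<rho> E + error_prob G U \<rho> E)"
proof -
  have "(\<Sum>g\<in>carrier G. outcome_prob U \<rho> E g g) \<le>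
      (\<Sum>g\<in>carrier G. kap * (\<Sum>h\<in>carrier G. outcome_prob U \<rho> E g h))"
    using \<rho> povm unfolding density_operators_def povm_def by (intro sum_mono outcome_bound) auto
  then have "1 / order_G * (\<Sum>g\<in>carrier G. outcome_prob U \<rho> E g g) \<le>
      1 / order_G * (kap * (\<Sum>g\<in>carrier G. \<Sum>h\<in>carrier G. outcome_prob U \<rho> E g h))"
    using order_G_pos by (intro mult_left_mono) (auto simp: sum_distrib_left)
  then show ?thesis unfolding success_plus_error unfolding success_prob_def by (simp add: mult_ac)
qed

lemma success_error_scale:
  assumes E: "\<And>g. g \<in> carrier G \<Longrightarrow> E g \<in> carrier_mat n n" and \<rho>: "\<rho> \<in> carrier_mat n n"
  shows "success_prob G U \<rho> (\<lambda>g. complex_of_real t \<cdot>\<^sub>m E g) = t * success_prob G U \<rho> E"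
    "error_prob G U \<rho> (\<lambda>g. complex_of_real t \<cdot>\<^sub>m E g) = t * error_prob G U \<rho> E"
proof -
  have *: "outcome_prob U \<rho> (\<lambda>g. complex_of_real t \<cdot>\<^sub>m E g) g h = t * outcome_prob U \<rho> E g h"
    if g: "g \<in> carrier G" and h: "h \<in> carrier G" for g h
  proof -
    note Uh = unitary_proj_repD(2)[OF rep h]
    have S: "U h * \<rho> * mat_adjoint (U h) \<in> carrier_mat n n"
      by (rule mult_carrier_mat[OF mult_carrier_mat[OF Uh \<rho>] mat_adjoint_carrier[OF Uh]])
    show ?thesis
      unfolding outcome_prob_def mult_smult_assoc_mat[OF E[OF g] S]
        mat_trace_smult[OF mult_carrier_mat[OF E[OF g] S]] by simp
  qed
  show "success_prob G U \<rho> (\<lambda>g. complex_of_real t \<cdot>\<^sub>m E g) = t * success_prob G U \<rho> E"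
    unfolding success_prob_def using * by (simp add: sum_distrib_left mult_ac)
  show "error_prob G U \<rho> (\<lambda>g. complex_of_real t \<cdot>\<^sub>m E g) = t * error_prob G U \<rho> E"
    unfolding error_prob_def using * by (simp add: sum_distrib_left mult_ac)
qed

end

section \<open>An optimal pure strategy\<close>

text \<open>This brings a pure state into the factored form expected by
  \<open>outcome_amplitude\<close>, with a single column.\<close>

lemma ket_bra_eq:
  assumes "\<phi> \<in> carrier_vec n"
  shows "ket_bra \<phi> = mat n 1 (\<lambda>(y, _). \<phi> $ y) * mat_adjoint (mat n 1 (\<lambda>(y, _). \<phi> $ y))"
  by (rule eq_matI) (use assms in \<open>auto simp: ket_bra_def scalar_prod_def\<close>)

lemma pure_states_density: "pure_states n \<subseteq> density_operators n"
proof
  fix \<rho> assume "\<rho> \<in> pure_states n"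
  then obtain \<phi> where \<phi>: "\<rho> = ket_bra \<phi>" "\<phi> \<in> carrier_vec n" "\<phi> \<bullet>c \<phi> = 1"
    unfolding pure_states_def by blast
  have "psd_mat n \<rho>" unfolding \<phi>(1) ket_bra_eq[OF \<phi>(2)] by (rule psd_mat_mult_adjoint[of _ n 1]) simp
  moreover have "mat_trace \<rho> = 1"
    using \<phi> cscalar_prod_sum[OF \<phi>(2), of \<phi>] by (simp add: mat_trace_def ket_bra_def)
  ultimately show "\<rho> \<in> density_operators n" unfolding density_operators_def by simp
qed

context adapted_basis
begin

lemma kap_pos: "0 < kap"
proof -
  \<comment> \<open>Without constituents the completeness relation at position (0, 0) would read 0 =
    1.\<close>
  have l: "0 < l" using basis_complete[OF n_pos n_pos] by (cases "l = 0") auto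
  let ?s = "q 0"
  have s: "?s \<in> Q" using q_in[OF l] .
  have "0 \<in> J ?s" using l by (simp add: J_def)
  then have "0 < card (J ?s)" using card_gt_0_iff finite_J by blast
  then have "0 < real (min (card (J ?s)) (fst ?s) * fst ?s) / order_G"
    using dim_pos[OF s] order_G_pos by simp
  then show ?thesis unfolding kap_def by (rule sum_pos2[OF finite_Q s]) simp
qed

text \<open>The state entangles \<open>min m\<^sub>\<sigma> d\<^sub>\<sigma>\<close> copies of each \<open>\<sigma>\<close> with distinct basis vectors, weighted so that its
  orbit is a tight frame of the cyclic subspace it generates, whose dimension is \<open>\<kappa> |G|\<close>.\<close>

lemma optimal_pure_strategy:
  "\<exists>\<phi> E0 E. \<phi> \<in> carrier_vec n \<and> \<phi> \<bullet>c \<phi> = 1 \<and> povm G n E0 E \<and>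
     success_prob G U (ket_bra \<phi>) E = kap"
proof -
  have "\<forall>s. \<exists>h. bij_betw h (J s) {0..<card (J s)}"
    using ex_bij_betw_finite_nat[OF finite_J] by blast
  then obtain h where h: "\<And>s. bij_betw (h s) (J s) {0..<card (J s)}" by metis
  \<comment> \<open>\<open>p j\<close> numbers constituent \<open>j\<close>, from 0, among the
    copies of its class. The same number selects the basis vector paired with that copy, so exactly
    the copies numbered below the dimension are usable: \<open>A\<close> collects min(m_s, d_s)
    copies of each class, and \<open>r\<close> is the dimension they span.\<close>
  define p where "p = (\<lambda>j. h (q j) j)"
  define A where "A = {j. j < l \<and> p j < fst (q j)}"
  define r where "r = real (\<Sum>j\<in>A. fst (q j))"
  have finA: "finite A" unfolding A_def by simp
  have Al: "j < l" and Ap: "p j < fst (q j)" if "j \<in> A" for j using that by (auto simp: A_def)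
  have p_inj: "j = k" if "j \<in> A" "k \<in> A" "q j = q k" "p j = p k" for j k
  proof -
    have "j \<in> J (q j)" "k \<in> J (q j)" using that by (auto simp: A_def J_def)
    then show ?thesis using h[of "q j"] that unfolding bij_betw_def p_def by (auto dest: inj_onD)
  qed
  have r_eq: "r = kap * order_G"
  proof -
    have "(\<Sum>j\<in>A. fst (q j)) = (\<Sum>j<l. if p j < fst (q j) then fst (q j) else 0)"
      unfolding A_def by (rule sum.mono_neutral_cong_left) auto
    also have "\<dots> = (\<Sum>s\<in>Q. \<Sum>j\<in>J s. if h s j < fst s then fst s else 0)"
      unfolding sum_J by (intro sum.cong refl) (auto simp: J_def p_def)
    also have "\<dots> = (\<Sum>s\<in>Q. min (card (J s)) (fst s) * fst s)"
    proof (rule sum.cong[OF refl])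
      fix s
      have "(\<Sum>j\<in>J s. if h s j < fst s then fst s else 0) = (\<Sum>i\<in>{0..<card (J s)}. if i < fst s then fst s else 0)"
        by (rule sum.reindex_bij_betw[OF h])
      also have "\<dots> = (\<Sum>i\<in>{0..<min (card (J s)) (fst s)}. fst s)"
        by (rule sum.mono_neutral_cong_right) auto
      finally show "(\<Sum>j\<in>J s. if h s j < fst s then fst s else 0) = min (card (J s)) (fst s) * fst s" by simp
    qed
    finally have "r = (\<Sum>s\<in>Q. real (min (card (J s)) (fst s) * fst s))"
      unfolding r_def by (simp only: of_nat_sum)
    then show ?thesis
      unfolding kap_def using order_G_pos by (simp add: sum_divide_distrib[symmetric])
  qed
  have r: "0 < r" unfolding r_eq using kap_pos order_G_pos by simp
  \<comment> \<open>The squared weights d / r sum to 1 over \<open>A\<close>, and their factor d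
    cancels the one in the orthogonality relations.\<close>
  define w where "w = (\<lambda>j. complex_of_real (sqrt (real (fst (q j)) / r)))"
  have ww: "w j * cnj (w j) = of_nat (fst (q j)) / of_real r" for j
  proof -
    have "sqrt (real (fst (q j)) / r) * sqrt (real (fst (q j)) / r) = real (fst (q j)) / r"
      using r by simp
    from arg_cong[OF this, of complex_of_real] show ?thesis
      by (simp only: w_def complex_cnj_complex_of_real of_real_mult of_real_divide of_real_of_nat_eq)
  qed
  define f where "f = (\<lambda>x. \<Sum>j\<in>A. w j * e j (p j) x)"
  have coord_f: "coord f k b = (if k \<in> A \<and> b = p k then w k else 0)" if k: "k < l" "b < fst (q k)" for k b
  proof -
    have "coord f k b = (\<Sum>x<n. \<Sum>j\<in>A. w j * (e j (p j) x * cnj (e k b x)))"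
      by (simp add: coord_def f_def sum_distrib_left mult_ac)
    also have "\<dots> = (\<Sum>j\<in>A. w j * (\<Sum>x<n. e j (p j) x * cnj (e k b x)))"
      by (subst sum.swap) (simp add: sum_distrib_left)
    also have "\<dots> = (\<Sum>j\<in>A. if j = k then (if p k = b then w k else 0) else 0)"
      using basis_orthonormal[OF Al Ap k] by (intro sum.cong refl) simp
    finally show ?thesis using finA by auto
  qed
  have f_norm: "(\<Sum>x<n. f x * cnj (f x)) = 1"
  proof -
    have "(\<Sum>x<n. f x * cnj (f x)) = (\<Sum>j<l. \<Sum>a<fst (q j). cnj (coord f j a) * coord f j a)"
      using inner_coord[of f f] by (simp add: mult.commute)
    also have "\<dots> = (\<Sum>j<l. \<Sum>a<fst (q j). if a = p j then (if j \<in> A then w j * cnj (w j) else 0) else 0)"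
      using coord_f by (intro sum.cong refl) auto
    also have "\<dots> = (\<Sum>j<l. if j \<in> A then w j * cnj (w j) else 0)"
      by (intro sum.cong refl) (auto simp: A_def)
    also have "\<dots> = (\<Sum>j\<in>A. w j * cnj (w j))"
      by (rule sum.mono_neutral_cong_right) (auto simp: A_def)
    also have "\<dots> = of_nat (\<Sum>j\<in>A. fst (q j)) / of_real r"
      unfolding ww by (simp add: sum_divide_distrib)
    also have "\<dots> = 1" using r unfolding r_def by (metis divide_self less_irrefl of_real_eq_0_iff of_real_of_nat_eq)
    finally show ?thesis .
  qed
  define \<phi> where "\<phi> = vec n f"
  have \<phi>c: "\<phi> \<in> carrier_vec n" by (simp add: \<phi>_def)
  have \<phi>1: "\<phi> \<bullet>c \<phi> = 1"
    using f_norm cscalar_prod_sum[OF \<phi>c, of \<phi>] by (simp add: \<phi>_def)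
  define \<psi> where "\<psi> = (\<lambda>g x. \<Sum>y<n. U g $$ (x, y) * f y)"
  have \<psi>_norm: "(\<Sum>x<n. cnj (\<psi> g x) * \<psi> g x) = 1" if g: "g \<in> carrier G" for g
  proof -
    note u = unitary_matD[OF unitary_proj_repD(1)[OF rep g]]
    have U\<phi>: "(U g *\<^sub>v \<phi>) $ x = \<psi> g x" if "x < n" for x
      using index_mult_vec_sum[OF u(1) \<phi>c that] by (simp add: \<psi>_def \<phi>_def)
    have "(U g *\<^sub>v \<phi>) \<bullet>c (U g *\<^sub>v \<phi>) = \<phi> \<bullet>c (mat_adjoint (U g) *\<^sub>v (U g *\<^sub>v \<phi>))"
      by (rule cscalar_prod_adjoint[OF u(1) \<phi>c mult_mat_vec_carrier[OF u(1) \<phi>c]])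
    also have "mat_adjoint (U g) *\<^sub>v (U g *\<^sub>v \<phi>) = \<phi>"
      using assoc_mult_mat_vec[OF mat_adjoint_carrier[OF u(1)] u(1) \<phi>c] u(3) \<phi>c by simp
    finally show ?thesis
      using \<phi>1 cscalar_prod_sum[OF mult_mat_vec_carrier[OF u(1) \<phi>c], of "U g *\<^sub>v \<phi>"] U\<phi>
      by (simp add: mult.commute del: index_mult_mat_vec)
  qed
  let ?K = "Sigma A (\<lambda>j. {..<fst (q j)})"
  define F where "F = (\<lambda>(j, a) g. snd (q j) g $$ (a, p j) :: complex)"
  have \<psi>_exp: "\<psi> g x = (\<Sum>k\<in>?K. (w (fst k) * e (fst k) (snd k) x) * F k g)"
    if g: "g \<in> carrier G" and x: "x < n" for g x
  proof -
    have coord_\<psi>: "coord (\<psi> g) j a = (if j \<in> A then w j * snd (q j) g $$ (a, p j) else 0)"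
      if ja: "j < l" "a < fst (q j)" for j a
    proof -
      have "coord (\<psi> g) j a = (\<Sum>b<fst (q j). snd (q j) g $$ (a, b) * coord f j b)"
        unfolding \<psi>_def by (rule coord_action[OF g ja])
      also have "\<dots> = (\<Sum>b<fst (q j). if b = p j then (if j \<in> A then w j * snd (q j) g $$ (a, p j) else 0) else 0)"
        using coord_f[OF ja(1)] by (intro sum.cong refl) auto
      finally show ?thesis by (auto simp: A_def)
    qed
    have "\<psi> g x = (\<Sum>j<l. \<Sum>a<fst (q j). if j \<in> A then w j * e j a x * snd (q j) g $$ (a, p j) else 0)"
      unfolding expand[OF x, of "\<psi> g"] using coord_\<psi> by (intro sum.cong refl) (auto simp: mult_ac)
    also have "\<dots> = (\<Sum>j\<in>A. \<Sum>a<fst (q j). w j * e j a x * snd (q j) g $$ (a, p j))"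
      by (rule sum.mono_neutral_cong_right) (auto simp: A_def)
    finally show ?thesis using finA by (simp add: sum.Sigma F_def case_prod_unfold)
  qed
  \<comment> \<open>Only diagonal terms survive, each with coefficient (|G| / d) (d / r). As the
    dimension cancels, all classes get the same constant |G| / r, which is tightness of the
    frame.\<close>
  have frame: "(\<Sum>g\<in>carrier G. \<psi> g x * cnj (\<psi> g y)) =
      of_real (order_G / r) * (\<Sum>j\<in>A. \<Sum>a<fst (q j). e j a x * cnj (e j a y))"
    if xy: "x < n" "y < n" for x y
  proof -
    have "(\<Sum>g\<in>carrier G. \<psi> g x * cnj (\<psi> g y)) =
        (\<Sum>g\<in>carrier G. (\<Sum>k\<in>?K. (w (fst k) * e (fst k) (snd k) x) * F k g) *
          cnj (\<Sum>k\<in>?K. (w (fst k) * e (fst k) (snd k) y) * F k g))"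
      using \<psi>_exp xy by (intro sum.cong refl) simp
    also have "\<dots> = (\<Sum>k\<in>?K. (of_nat (card (carrier G)) / of_nat (fst (q (fst k)))) *
        ((w (fst k) * e (fst k) (snd k) x) * cnj (w (fst k) * e (fst k) (snd k) y)))"
    proof (rule parseval_sesquilinear)
      show "(\<Sum>g\<in>carrier G. F k g * cnj (F k' g)) =
          (if k = k' then of_nat (card (carrier G)) / of_nat (fst (q (fst k))) else 0)"
        if kk': "k \<in> ?K" "k' \<in> ?K" for k k'
      proof -
        obtain j a where k: "k = (j, a)" "j \<in> A" "a < fst (q j)" using kk'(1) by blast
        obtain j' a' where k': "k' = (j', a')" "j' \<in> A" "a' < fst (q j')" using kk'(2) by blast
        \<comment> \<open>Copies of one class share their matrices, so orthogonality of their
          coefficient functions rests on \<open>p\<close> assigning them different columns.\<close>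
        have "q j = q j' \<and> a = a' \<and> p j = p j' \<longleftrightarrow> j = j' \<and> a = a'"
          using p_inj k(2) k'(2) by blast
        then show ?thesis
          using orthogonality[OF q_in[OF Al[OF k(2)]] q_in[OF Al[OF k'(2)]] k(3) Ap[OF k(2)] k'(3) Ap[OF k'(2)]]
          unfolding k(1) k'(1) F_def by simp
      qed
    qed (use finA in auto)
    also have "\<dots> = (\<Sum>k\<in>?K. of_real (order_G / r) * (e (fst k) (snd k) x * cnj (e (fst k) (snd k) y)))"
    proof (rule sum.cong[OF refl])
      fix k assume "k \<in> ?K"
      then have d: "fst (q (fst k)) \<noteq> 0" by auto
      have "(of_nat (card (carrier G)) / of_nat (fst (q (fst k)))) *
        ((w (fst k) * e (fst k) (snd k) x) * cnj (w (fst k) * e (fst k) (snd k) y)) =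
        (of_nat (card (carrier G)) / of_nat (fst (q (fst k)))) * (w (fst k) * cnj (w (fst k))) *
        (e (fst k) (snd k) x * cnj (e (fst k) (snd k) y))" by (simp add: mult_ac)
      also have "\<dots> = of_real (order_G / r) * (e (fst k) (snd k) x * cnj (e (fst k) (snd k) y))"
        unfolding ww using d by simp
      finally show "(of_nat (card (carrier G)) / of_nat (fst (q (fst k)))) *
        ((w (fst k) * e (fst k) (snd k) x) * cnj (w (fst k) * e (fst k) (snd k) y)) =
        of_real (order_G / r) * (e (fst k) (snd k) x * cnj (e (fst k) (snd k) y))" .
    qed
    also have "\<dots> = of_real (order_G / r) * (\<Sum>j\<in>A. \<Sum>a<fst (q j). e j a x * cnj (e j a y))"
      using finA by (simp add: sum.Sigma case_prod_unfold sum_distrib_left)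
    finally show ?thesis .
  qed
  \<comment> \<open>The inverse root of the frame constant: with this scaling the effects sum to the
    projection onto the constituents in \<open>A\<close>.\<close>
  define s where "s = complex_of_real (sqrt (r / order_G))"
  have ss: "s * cnj s = of_real (r / order_G)"
  proof -
    have "sqrt (r / order_G) * sqrt (r / order_G) = r / order_G" using r by simp
    from arg_cong[OF this, of complex_of_real] show ?thesis
      by (simp only: s_def complex_cnj_complex_of_real of_real_mult)
  qed
  define V where "V = (\<lambda>g. mat n 1 (\<lambda>(x, _). s * \<psi> g x))"
  have V: "V g \<in> carrier_mat n 1" for g by (simp add: V_def)
  define E where "E = (\<lambda>g. V g * mat_adjoint (V g))"
  have Ec: "E g \<in> carrier_mat n n" for g
    unfolding E_def by (rule mult_carrier_mat[OF V mat_adjoint_carrier[OF V]])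
  have E_psd: "psd_mat n (E g)" for g unfolding E_def by (rule psd_mat_mult_adjoint[OF V])
  have E_ent: "E g $$ (x, y) = of_real (r / order_G) * (\<psi> g x * cnj (\<psi> g y))" if "x < n" "y < n" for g x y
  proof -
    have "E g $$ (x, y) = (s * cnj s) * (\<psi> g x * cnj (\<psi> g y))"
      unfolding E_def using index_mult_sum[OF V mat_adjoint_carrier[OF V] that, of g g] that
      by (simp add: V_def mult_ac)
    then show ?thesis unfolding ss .
  qed
  define B where "B = {..<l} - A"
  define E0 where "E0 = mat n n (\<lambda>(x, y). \<Sum>j\<in>B. \<Sum>a<fst (q j). e j a x * cnj (e j a y))"
  have "psd_mat n E0"
    unfolding psd_mat_iff
  proof (intro conjI allI)
    fix v
    have "(\<Sum>x<n. \<Sum>y<n. E0 $$ (x, y) * v y * cnj (v x)) =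
        (\<Sum>x<n. \<Sum>y<n. \<Sum>j\<in>B. \<Sum>a<fst (q j). (e j a x * cnj (v x)) * (cnj (e j a y) * v y))"
      by (simp add: E0_def sum_distrib_left sum_distrib_right mult_ac)
    also have "\<dots> = (\<Sum>x<n. \<Sum>j\<in>B. \<Sum>y<n. \<Sum>a<fst (q j). (e j a x * cnj (v x)) * (cnj (e j a y) * v y))"
      by (intro sum.cong refl sum.swap)
    also have "\<dots> = (\<Sum>j\<in>B. \<Sum>x<n. \<Sum>y<n. \<Sum>a<fst (q j). (e j a x * cnj (v x)) * (cnj (e j a y) * v y))"
      by (rule sum.swap)
    also have "\<dots> = (\<Sum>j\<in>B. \<Sum>x<n. \<Sum>a<fst (q j). \<Sum>y<n. (e j a x * cnj (v x)) * (cnj (e j a y) * v y))"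
      by (intro sum.cong refl sum.swap)
    also have "\<dots> = (\<Sum>j\<in>B. \<Sum>a<fst (q j). \<Sum>x<n. \<Sum>y<n. (e j a x * cnj (v x)) * (cnj (e j a y) * v y))"
      by (intro sum.cong refl sum.swap)
    also have "\<dots> = (\<Sum>j\<in>B. \<Sum>a<fst (q j). cnj (coord v j a) * coord v j a)"
      by (simp add: coord_def sum_product)
    also have "\<dots> = complex_of_real (\<Sum>j\<in>B. \<Sum>a<fst (q j). (cmod (coord v j a))\<^sup>2)"
      by (simp only: of_real_sum complex_norm_square mult.commute)
    finally have eq: "(\<Sum>x<n. \<Sum>y<n. E0 $$ (x, y) * v y * cnj (v x)) =
      complex_of_real (\<Sum>j\<in>B. \<Sum>a<fst (q j). (cmod (coord v j a))\<^sup>2)" .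
    show "0 \<le> (\<Sum>x<n. \<Sum>y<n. E0 $$ (x, y) * v y * cnj (v x))"
      unfolding eq by (simp add: less_eq_complex_def sum_nonneg)
  qed (simp add: E0_def)
  moreover have "E0 + finsum (module_mat TYPE(complex) n n) E (carrier G) = 1\<^sub>m n"
  proof (rule eq_matI)
    fix x y assume "x < dim_row (1\<^sub>m n :: complex mat)" "y < dim_col (1\<^sub>m n :: complex mat)"
    then have xy: "x < n" "y < n" by auto
    note fs = finsum_mat_carrier_index[OF finite_G, of E n n, OF Ec]
    have "finsum (module_mat TYPE(complex) n n) E (carrier G) $$ (x, y) = (\<Sum>g\<in>carrier G. E g $$ (x, y))"
      using fs xy by blast
    also have "\<dots> = of_real (r / order_G) * (of_real (order_G / r) * (\<Sum>j\<in>A. \<Sum>a<fst (q j). e j a x * cnj (e j a y)))"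
      unfolding frame[OF xy, symmetric] using E_ent[OF xy] by (simp add: sum_distrib_left)
    also have "\<dots> = (\<Sum>j\<in>A. \<Sum>a<fst (q j). e j a x * cnj (e j a y))"
      using r order_G_pos by simp
    finally have "(E0 + finsum (module_mat TYPE(complex) n n) E (carrier G)) $$ (x, y) =
        (\<Sum>j\<in>B. \<Sum>a<fst (q j). e j a x * cnj (e j a y)) + (\<Sum>j\<in>A. \<Sum>a<fst (q j). e j a x * cnj (e j a y))"
      using carrier_matD[OF conjunct1[OF fs]] xy by (simp add: E0_def)
    also have "\<dots> = (\<Sum>j<l. \<Sum>a<fst (q j). e j a x * cnj (e j a y))"
      unfolding B_def by (rule sum.subset_diff[symmetric]) (auto simp: A_def)
    also have "\<dots> = 1\<^sub>m n $$ (x, y)" using basis_complete[OF xy] xy by simp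
    finally show "(E0 + finsum (module_mat TYPE(complex) n n) E (carrier G)) $$ (x, y) = 1\<^sub>m n $$ (x, y)" .
  qed (use conjunct1[OF finsum_mat_carrier_index[OF finite_G, of E n n, OF Ec]] in auto)
  ultimately have povm: "povm G n E0 E" unfolding povm_def using E_psd by blast
  have "outcome_prob U (ket_bra \<phi>) E g g = kap" if g: "g \<in> carrier G" for g
  proof -
    let ?R = "mat n 1 (\<lambda>(y, _). \<phi> $ y)"
    have R: "?R \<in> carrier_mat n 1" by simp
    have amp: "amplitude (\<lambda>x. V g $$ (x, 0)) (\<lambda>y. ?R $$ (y, 0)) g = cnj s"
    proof -
      have "amplitude (\<lambda>x. V g $$ (x, 0)) (\<lambda>y. ?R $$ (y, 0)) g = (\<Sum>x<n. cnj s * (cnj (\<psi> g x) * \<psi> g x))"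
        unfolding amplitude_def by (simp add: V_def \<phi>_def \<psi>_def mult.assoc)
      then show ?thesis using \<psi>_norm[OF g] by (simp flip: sum_distrib_left)
    qed
    have "outcome_prob U (ket_bra \<phi>) E g g = (cmod (cnj s))\<^sup>2"
      unfolding ket_bra_eq[OF \<phi>c]
      using outcome_amplitude[where E = E and g = g, OF g V R] amp by (simp add: E_def)
    also have "\<dots> = r / order_G" using r by (simp add: s_def)
    also have "\<dots> = kap" unfolding r_eq using order_G_pos by simp
    finally show ?thesis .
  qed
  then have "success_prob G U (ket_bra \<phi>) E = kap"
    unfolding success_prob_def using order_G_pos by simp
  then show ?thesis using \<phi>c \<phi>1 povm by blast
qed

text \<open>The set \<open>R\<close> of states lies anywhere between pure states and density
  operators: the upper bound holds for all density operators and the witness is pure, so both maxima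
  of the theorem are instances.\<close>

lemma maximum_success_values:
  assumes m: "0 \<le> m" "m \<le> 1" and R: "pure_states n \<subseteq> R" "R \<subseteq> density_operators n"
  shows "is_maximum (success_values G n U R m) (if 1 - kap \<le> m then kap else kap / (1 - kap) * m)"
proof -
  let ?v = "if 1 - kap \<le> m then kap else kap / (1 - kap) * m"
  obtain \<phi> E0 E where \<phi>: "\<phi> \<in> carrier_vec n" "\<phi> \<bullet>c \<phi> = 1" and povm: "povm G n E0 E"
    and succ: "success_prob G U (ket_bra \<phi>) E = kap"
    using optimal_pure_strategy by blast
  have pure: "ket_bra \<phi> \<in> pure_states n" unfolding pure_states_def using \<phi> by blast
  then have dens: "ket_bra \<phi> \<in> density_operators n" using pure_states_density by blast
  have err: "error_prob G U (ket_bra \<phi>) E \<le> 1 - kap"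
    using success_plus_error_le_one[OF dens povm] succ by simp
  have "?v \<in> success_values G n U R m"
  proof (cases "1 - kap \<le> m")
    case True
    then show ?thesis
      unfolding success_values_def using pure R(1) povm succ err
      by (intro CollectI exI[of _ "ket_bra \<phi>"] exI[of _ E0] exI[of _ E]) auto
  next
    case False
    \<comment> \<open>The optimal strategy errs with probability at most \<open>1 - kap\<close>;
      this factor reduces that bound to exactly \<open>m\<close>.\<close>
    define t where "t = m / (1 - kap)"
    have k: "0 < 1 - kap" using False m by linarith
    have t: "0 \<le> t" "t \<le> 1" using False m k by (auto simp: t_def)
    have c: "\<And>g. g \<in> carrier G \<Longrightarrow> E g \<in> carrier_mat n n" "ket_bra \<phi> \<in> carrier_mat n n"
      using povm \<phi>(1) unfolding povm_def psd_mat_def by (auto simp: ket_bra_def)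
    have sc: "success_prob G U (ket_bra \<phi>) (\<lambda>g. complex_of_real t \<cdot>\<^sub>m E g) = t * success_prob G U (ket_bra \<phi>) E"
      "error_prob G U (ket_bra \<phi>) (\<lambda>g. complex_of_real t \<cdot>\<^sub>m E g) = t * error_prob G U (ket_bra \<phi>) E"
      using success_error_scale[of E "ket_bra \<phi>" t] c by blast+
    have "t * error_prob G U (ket_bra \<phi>) E \<le> t * (1 - kap)" using err t(1) by (rule mult_left_mono)
    also have "\<dots> = m" using k by (simp add: t_def)
    finally have "error_prob G U (ket_bra \<phi>) (\<lambda>g. complex_of_real t \<cdot>\<^sub>m E g) \<le> m" unfolding sc(2) .
    moreover have "success_prob G U (ket_bra \<phi>) (\<lambda>g. complex_of_real t \<cdot>\<^sub>m E g) = ?v"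
      unfolding sc(1) succ using False by (simp add: t_def)
    moreover have "ket_bra \<phi> \<in> R" using pure R(1) by blast
    ultimately show ?thesis
      unfolding success_values_def using povm_scale[OF povm finite_G t]
      by (intro CollectI exI[of _ "ket_bra \<phi>"] exI[of _ "complex_of_real (1 - t) \<cdot>\<^sub>m 1\<^sub>m n + complex_of_real t \<cdot>\<^sub>m E0"]
          exI[of _ "\<lambda>g. complex_of_real t \<cdot>\<^sub>m E g"]) simp
  qed
  moreover have "x \<le> ?v" if x_in: "x \<in> success_values G n U R m" for x
  proof -
    obtain \<rho> F0 F where x: "x = success_prob G U \<rho> F" and "\<rho> \<in> R" and F: "povm G n F0 F"
      and e: "error_prob G U \<rho> F \<le> m"
      using x_in unfolding success_values_def by blast
    then have \<rho>: "\<rho> \<in> density_operators n" using R(2) by blast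
    have le: "x \<le> kap * (x + error_prob G U \<rho> F)" unfolding x by (rule success_le[OF \<rho> F])
    show ?thesis
    proof (cases "1 - kap \<le> m")
      case True
      have "kap * (x + error_prob G U \<rho> F) \<le> kap * 1"
        using success_plus_error_le_one[OF \<rho> F] kap_nonneg unfolding x by (intro mult_left_mono)
      then show ?thesis using le True by simp
    next
      case False
      have k: "0 < 1 - kap" using False m by linarith
      have "kap * (x + error_prob G U \<rho> F) \<le> kap * (x + m)"
        using e kap_nonneg by (intro mult_left_mono) auto
      \<comment> \<open>The unknown success probability occurs on both sides of x <= kap (x + m);
        solving for it produces the denominator \<open>1 - kap\<close>, positive in this
        branch.\<close>
      then have "x * (1 - kap) \<le> kap * m" using le by (simp add: algebra_simps)
      then have "x \<le> kap * m / (1 - kap)" using k by (simp add: pos_le_divide_eq)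
      then show ?thesis using False by simp
    qed
  qed
  ultimately show ?thesis unfolding is_maximum_def by blast
qed

end

theorem mainTheorem3:
  fixes G :: "('g, 'b) monoid_scheme"
    and c :: "'g \<Rightarrow> 'g \<Rightarrow> complex"
    and n :: nat
    and U :: "'g \<Rightarrow> complex mat"
    and m :: real
  assumes "group G"
    and "finite (carrier G)"
    and "0 < n"
    and "unitary_proj_rep G c n U"
    and "0 \<le> m" and "m \<le> 1"
  shows "let \<kappa> = kappa G c n U;
             m\<^sub>c = 1 - \<kappa>;
             v = (if m\<^sub>c \<le> m then \<kappa> else \<kappa> / (1 - \<kappa>) * m)
         in is_P_max G n U m v \<and> is_P_max_pure G n U m v"
proof -
  obtain Q l q e where ab: "adapted_basis G c n U Q l q e"
    and k: "kappa G c n U = (\<Sum>s\<in>Q. real (min (card {j. j < l \<and> q j = s}) (fst s) * fst s) /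
      real (card (carrier G)))"
    using adapted_basis_exists[OF assms(1-4)] by blast
  interpret adapted_basis G c n U Q l q e by (rule ab)
  have \<kappa>: "kappa G c n U = kap" unfolding k kap_def J_def ..
  show ?thesis
    unfolding Let_def is_P_max_def is_P_max_pure_def \<kappa>
    by (intro conjI maximum_success_values assms pure_states_density subset_refl)
qed

end
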